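(* (Nash–Gagliardo–Nirenberg type inequality) Let $N\ge1$, $p\ge1$, $r>1$ and $0<\gamma<\min\{N,2\}$. There is a constant $C=C(p,r,\gamma,N)>0$ such that for any $v\in L^p(\mathbb{R}^N)$ with $(-\Delta)^{\gamma/2}v\in L^r(\mathbb{R}^N)$ we have $$\|v\|_{r_2}^{\alpha+1}\le C\,\|(-\Delta)^{\gamma/2}v\|_r\,\|v\|_p^{\alpha},$$ where $r_2=\dfrac{N(rp+r-p)}{r(N-\gamma)}$ and $\alpha=\dfrac{p(r-1)}{r}$.
   Context: $\|\cdot\|_q$ is the norm of $L^q(\mathbb{R}^N)$, and the fractional Laplacian is defined by $\widehat{(-\Delta)^{\gamma/2}v}(\xi)=|\xi|^\gamma\hat v(\xi)$. *)

theory Defs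
  imports "HOL-Analysis.Analysis"
begin

definition Lp_space :: "real \<Rightarrow> (real ^ 'n::finite \<Rightarrow> complex) set" where
  "Lp_space q = {f \<in> borel_measurable lebesgue. integrable lebesgue (\<lambda>x. norm (f x) powr q)}"

text \<open>
  Only meaningful for members of \<^term>\<open>Lp_space q\<close>: the Bochner integral is 0 when
  the integrand is not integrable.
\<close>

definition Lp_norm :: "real \<Rightarrow> (real ^ 'n::finite \<Rightarrow> complex) \<Rightarrow> real" where
  "Lp_norm q f = (LINT x|lebesgue. norm (f x) powr q) powr (1 / q)"

definition partial_deriv :: "'n \<Rightarrow> (real ^ 'n::finite \<Rightarrow> complex) \<Rightarrow> real ^ 'n \<Rightarrow> complex" where
  "partial_deriv i f x = frechet_derivative f (at x) (axis i 1)"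

fun partial_derivs :: "'n list \<Rightarrow> (real ^ 'n::finite \<Rightarrow> complex) \<Rightarrow> real ^ 'n \<Rightarrow> complex" where
  "partial_derivs [] f = f"
| "partial_derivs (i # is) f = partial_deriv i (partial_derivs is f)"

text \<open>
  The Schwartz space: all iterated partial derivatives are Frechet differentiable everywhere
  (equivalently, the function is smooth) and decay faster than any power.
\<close>

definition schwartz :: "(real ^ 'n::finite \<Rightarrow> complex) set" where
  "schwartz = {f. \<forall>is. (\<forall>x. partial_derivs is f differentiable (at x)) \<and>
                      (\<forall>k::nat. bounded (range (\<lambda>x. norm x ^ k *\<^sub>R partial_derivs is f x)))}"

text \<open>
  No factor \<open>2 \<pi>\<close> in the exponent, so that the symbol of the negative Laplacian is
  \<open>|\<xi>|\<^sup>2\<close>. A constant prefactor would cancel in the definition of the fractional Laplacian.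
\<close>

definition fourier :: "(real ^ 'n::finite \<Rightarrow> complex) \<Rightarrow> real ^ 'n \<Rightarrow> complex" where
  "fourier f \<xi> = (LINT x|lebesgue. exp (- \<i> * complex_of_real (x \<bullet> \<xi>)) * f x)"

text \<open>
  The Fourier transform of \<open>w\<close> as a tempered distribution, i.e. as the functional that sends
  a test function \<open>\<phi>\<close> to the integral of \<open>w\<close> against the Fourier transform of \<open>\<phi>\<close>.
\<close>

definition fourier_distr :: "(real ^ 'n::finite \<Rightarrow> complex) \<Rightarrow> (real ^ 'n \<Rightarrow> complex) \<Rightarrow> complex" where
  "fourier_distr w \<phi> = (LINT x|lebesgue. w x * fourier \<phi> x)"

text \<open>
  \<open>g\<close> is (a representative of) the fractional Laplacian of order \<open>\<gamma> / 2\<close> of \<open>v\<close>: the Fourier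
  transform of \<open>g\<close> is \<open>|\<xi>|\<^sup>\<gamma>\<close> times the Fourier transform of \<open>v\<close>, as distributions. As usual,
  the product of a distribution with the function \<open>|\<xi>|\<^sup>\<gamma>\<close> is formed by moving the function onto
  the test function. Although \<open>|\<xi>|\<^sup>\<gamma> \<phi>(\<xi>)\<close> need not be smooth at the origin, for \<open>\<gamma> > 0\<close> its
  Fourier transform is bounded and of size \<open>O(|x| powr (-N-\<gamma>))\<close> at infinity, hence belongs to
  every Lebesgue space, and both pairings below are absolutely convergent when \<open>v\<close> and \<open>g\<close> lie
  in Lebesgue spaces with exponents in \<open>[1,\<infinity>)\<close>. The function \<open>g\<close> is then determined by \<open>v\<close> up
  to a null set.
\<close>

definition is_frac_laplacian ::
  "real \<Rightarrow> (real ^ 'n::finite \<Rightarrow> complex) \<Rightarrow> (real ^ 'n \<Rightarrow> complex) \<Rightarrow> bool" where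
  "is_frac_laplacian \<gamma> v g \<longleftrightarrow>
     (\<forall>\<phi>\<in>schwartz. fourier_distr g \<phi> = fourier_distr v (\<lambda>\<xi>. complex_of_real (norm \<xi> powr \<gamma>) * \<phi> \<xi>))"

end

theory Submission
  imports Defs "HOL-Probability.Probability"
begin

text \<open>
  Put \<open>k = \<gamma> / 2\<close> and let \<open>U\<^sub>s\<close>, \<open>W\<^sub>s\<close> be the convolutions of \<open>v\<close> and of \<open>g = (-\<Delta>)\<^sup>k v\<close> with the
  heat kernel at time \<open>s\<close>. Testing the equation for \<open>g\<close> with modulated Gaussians and subordinating
  \<open>|\<xi>|\<^sup>\<gamma>\<close> to \<open>exp (- s |\<xi>|\<^sup>2)\<close> gives, for all \<open>\<delta>, t > 0\<close>,
  \<open>\<Gamma>(k) (U\<^sub>\<delta> - U\<^sub>t\<^sub>+\<^sub>\<delta>) = \<integral> m\<^sub>t(s) W\<^sub>s\<^sub>+\<^sub>\<delta> ds\<close> with \<open>m\<^sub>t(s) = s\<^sub>+ powr (k - 1) - (s - t)\<^sub>+ powr (k - 1)\<close>,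
  an integrable weight of mass proportional to \<open>t powr k\<close>.

  To bound the measure of \<open>{|U\<^sub>\<delta>| > l}\<close>, take \<open>t\<close> so large that \<open>|U\<^sub>t\<^sub>+\<^sub>\<delta>| \<le> l / 4\<close>, which costs only
  \<open>\<parallel>v\<parallel>\<^sub>p\<close>, and split \<open>g\<close> at a height \<open>\<mu>\<close> such that its bounded part contributes at most \<open>l / 4\<close>.
  The remaining part of \<open>g\<close> is integrable and is handled by Markov's inequality. Integrating over \<open>l\<close>
  as in the proof of the Marcinkiewicz interpolation theorem yields strong type bounds for \<open>U\<^sub>\<delta>\<close>
  uniformly in \<open>\<delta>\<close>, without a maximal function, and Fatou's lemma as \<open>\<delta> \<rightarrow> 0\<close> yields them for \<open>v\<close>.
\<close>

section \<open>The heat kernel\<close>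

text \<open>The hypotheses do not force \<open>r * \<gamma> < N\<close>, so the Riesz potential of
  \<open>g\<close> may diverge and \<open>v\<close> cannot simply be written as a potential.
  Comparing the heat extension at two times truncates the potential: the shifted weight cancels the
  non-integrable end \<open>s powr (k - 1)\<close> at infinity, and the price is the late value,
  which \<open>v\<close> in Lp controls. The shift \<open>\<delta>\<close> serves absolute
  convergence: for times at least \<open>\<delta>\<close> the kernels of the fractional Laplacian of
  the heat flow are bounded and integrable uniformly, while the final constants do not involve
  \<open>\<delta>\<close>. The exponent \<open>r2\<close> arises from a second cut, of the time axis
  at \<open>T\<close>. The unbounded part of \<open>g\<close> is measured in L1 for
  \<open>s < T\<close> and uniformly for \<open>s \<ge> T\<close>, which gives a level set bound
  proportional to \<open>min t T powr k\<close>. Weighted geometric means of \<open>t powr k\<close>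
  and \<open>T powr k\<close>, with weight \<open>\<omega>\<close>, turn this into a family of
  estimates. Raised to the power \<open>\<rho> = N / (N - \<gamma>)\<close>, the theorem asks for
  the power \<open>\<rho>\<close> of the norm of \<open>g\<close>; this determines
  \<open>\<omega>\<close> if \<open>r \<le> \<rho>\<close>. If \<open>r > \<rho>\<close>, the case
  \<open>\<omega> = 0\<close> is interpolated with the Lp bound for \<open>v\<close>.\<close>

definition heat :: "real \<Rightarrow> 'a::euclidean_space \<Rightarrow> real" where
  "heat s z = (4 * pi * s) powr (- (real DIM('a) / 2)) * exp (- (norm z)\<^sup>2 / (4 * s))"

lemma heat_nonneg [simp]: "0 \<le> heat s z"
  by (simp add: heat_def)

lemma heat_minus [simp]: "heat s (- z) = heat s z"
  by (simp add: heat_def)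

lemma heat_commute: "heat s (x - y) = heat s (y - x)"
  by (metis heat_minus minus_diff_eq)

lemma heat_measurable [measurable (raw)]:
  fixes g :: "'b \<Rightarrow> 'a::euclidean_space"
  assumes [measurable]: "f \<in> borel_measurable M" "g \<in> borel_measurable M"
  shows "(\<lambda>x. heat (f x) (g x)) \<in> borel_measurable M"
  unfolding heat_def by measurable

lemma heat_le:
  fixes z :: "'a::euclidean_space"
  assumes "0 < s"
  shows "heat s z \<le> s powr (- (real DIM('a) / 2))"
proof -
  have "(4 * pi * s) powr (- (real DIM('a) / 2)) \<le> s powr (- (real DIM('a) / 2))"
    using assms pi_gt3 by (intro powr_mono2') (auto simp: mult_le_cancel_right1)
  moreover have "exp (- (norm z)\<^sup>2 / (4 * s)) \<le> 1"
    using assms by simp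
  ultimately show ?thesis
    unfolding heat_def by (metis exp_ge_zero mult_mono mult.right_neutral powr_ge_zero)
qed

lemma lborel_nn_integral_shift:
  fixes y :: "'a::euclidean_space"
  assumes [measurable]: "f \<in> borel_measurable borel"
  shows "(\<integral>\<^sup>+x. f (x - y) \<partial>lborel) = (\<integral>\<^sup>+x. f x \<partial>lborel)"
proof -
  have "(\<integral>\<^sup>+x. f x \<partial>lborel) = (\<integral>\<^sup>+x. f x \<partial>distr lborel borel ((+) (- y)))"
    by (simp only: lborel_distr_plus)
  also have "\<dots> = (\<integral>\<^sup>+x. f (x - y) \<partial>lborel)"
    by (subst nn_integral_distr) auto
  finally show ?thesis by simp
qed

text \<open>Rescaling by \<open>c\<close> turns the Gaussian into a multiple of the standard normal
  density, whose characteristic function is known.\<close>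

lemma fourier_gaussian_real:
  fixes s t :: real
  assumes s: "0 < s"
  shows "integrable lborel (\<lambda>x. exp (- \<i> * of_real (t * x)) * of_real (exp (- s * x\<^sup>2)))" (is ?I)
    and "(LINT x|lborel. exp (- \<i> * of_real (t * x)) * of_real (exp (- s * x\<^sup>2)))
           = of_real (sqrt (pi / s) * exp (- t\<^sup>2 / (4 * s)))"  (is ?E)
proof -
  define c where "c = 1 / sqrt (2 * s)"
  have c: "c > 0" using s by (simp add: c_def)
  have c2: "c\<^sup>2 = 1 / (2 * s)" using s by (simp add: c_def power_divide)
  define D where "D = (\<lambda>x. complex_of_real (std_normal_density x))"
  define f where "f = (\<lambda>x. exp (- \<i> * of_real (t * x)) * complex_of_real (exp (- s * x\<^sup>2)))"
  have f: "f (0 + c * x) = sqrt (2 * pi) *\<^sub>R (exp (\<i> * of_real ((- t * c) * x)) * D x)" for x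
  proof -
    have "exp (- s * (c * x)\<^sup>2) = exp (- x\<^sup>2 / 2)"
      using s by (simp add: power_mult_distrib c2)
    then show ?thesis
      by (simp add: f_def D_def std_normal_density_def scaleR_conv_of_real flip: of_real_mult)
         (simp add: mult_ac)
  qed
  have int1: "integrable lborel (\<lambda>x. std_normal_density x)"
    by simp
  have int2: "integrable lborel (\<lambda>x. exp (\<i> * of_real ((- t * c) * x)) * D x)"
  proof (rule Bochner_Integration.integrable_bound[OF int1])
    show "AE x in lborel. norm (exp (\<i> * of_real ((- t * c) * x)) * D x) \<le> norm (std_normal_density x)"
      by (simp add: D_def norm_mult)
  qed (auto simp: D_def)
  have int3: "integrable lborel (\<lambda>x. f (0 + c * x))"
    unfolding f using int2 by (intro integrable_scaleR_right) auto
  then show ?I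
    using lborel_integrable_real_affine_iff[of c f 0] c by (simp add: f_def)
  have "(LINT x|lborel. f x) = c *\<^sub>R (LINT x|lborel. f (0 + c * x))"
    using lborel_integral_real_affine[of c f 0] c by simp
  also have "\<dots> = c *\<^sub>R sqrt (2 * pi) *\<^sub>R (LINT x|lborel. exp (\<i> * of_real ((- t * c) * x)) * D x)"
    unfolding f by simp
  also have "(LINT x|lborel. exp (\<i> * of_real ((- t * c) * x)) * D x) = char std_normal_distribution (- t * c)"
    unfolding char_def D_def
    by (subst integral_density) (auto simp: scaleR_conv_of_real mult_ac)
  also have "\<dots> = of_real (exp (- (t\<^sup>2) / (4 * s)))"
    by (simp add: char_std_normal_distribution power_mult_distrib c2)
  also have "c *\<^sub>R sqrt (2 * pi) *\<^sub>R complex_of_real (exp (- (t\<^sup>2) / (4 * s)))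
      = of_real ((c * sqrt (2 * pi)) * exp (- (t\<^sup>2) / (4 * s)))"
    by (simp add: scaleR_conv_of_real)
  also have "c * sqrt (2 * pi) = sqrt (pi / s)"
    using s by (simp add: c_def real_sqrt_divide real_sqrt_mult)
  finally show ?E by (simp add: f_def)
qed

text \<open>The integrand factorises over the coordinates, with \<open>J\<close> rebuilding a point
  from its coordinates, so the one-dimensional formula is applied in each of them.\<close>

lemma fourier_gaussian:
  fixes z :: "'a::euclidean_space"
  assumes s: "0 < s"
  shows "integrable lborel (\<lambda>x. exp (- \<i> * of_real (z \<bullet> x)) * of_real (exp (- s * (norm x)\<^sup>2)))" (is ?I)
    and "(LINT x|lborel. exp (- \<i> * of_real (z \<bullet> x)) * of_real (exp (- s * (norm x)\<^sup>2)))
           = of_real ((2 * pi) ^ DIM('a) * heat s z)"  (is ?E)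
proof -
  interpret product_sigma_finite "\<lambda>b::'a. lborel :: real measure" ..
  define F where "F = (\<lambda>x::'a. exp (- \<i> * of_real (z \<bullet> x)) * complex_of_real (exp (- s * (norm x)\<^sup>2)))"
  define G where "G = (\<lambda>b x. exp (- \<i> * of_real ((z \<bullet> b) * x)) * complex_of_real (exp (- s * x\<^sup>2)))"
  define J where "J = (\<lambda>f. \<Sum>b\<in>Basis. f b *\<^sub>R b :: 'a)"
  have F: "F (J x) = (\<Prod>b\<in>Basis. G b (x b))" for x
  proof -
    have 1: "z \<bullet> J x = (\<Sum>b\<in>Basis. (z \<bullet> b) * x b)"
      by (subst euclidean_inner) (simp add: J_def inner_sum_left inner_Basis if_distrib sum.delta cong: if_cong)
    have 2: "(norm (J x))\<^sup>2 = (\<Sum>b\<in>Basis. (x b)\<^sup>2)"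
      unfolding power2_norm_eq_inner
      by (subst euclidean_inner) (simp add: J_def inner_sum_left inner_Basis if_distrib sum.delta power2_eq_square cong: if_cong)
    show ?thesis
      unfolding F_def 1 2 G_def prod.distrib
      by (simp only: of_real_sum sum_distrib_left exp_sum finite_Basis of_real_prod)
  qed
  have Fm [measurable]: "F \<in> borel_measurable borel"
    unfolding F_def by measurable
  have Jm [measurable]: "J \<in> measurable (\<Pi>\<^sub>M b\<in>Basis. lborel) borel"
    unfolding J_def by measurable
  have G: "integrable lborel (G b)" for b
    unfolding G_def using fourier_gaussian_real(1)[OF s] .
  have "integrable (\<Pi>\<^sub>M b\<in>Basis. lborel) (\<lambda>x. F (J x))"
    unfolding F using G by (intro product_integrable_prod) auto
  then show ?I
    unfolding F_def[symmetric] by (subst lborel_eq) (simp add: integrable_distr_eq J_def[symmetric])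
  have "(LINT x|lborel. F x) = (LINT x|(\<Pi>\<^sub>M b\<in>Basis. lborel). F (J x))"
    by (subst lborel_eq) (simp add: integral_distr J_def[symmetric])
  also have "\<dots> = (\<Prod>b\<in>Basis. LINT x|lborel. G b x)"
    unfolding F using G by (intro product_integral_prod) auto
  also have "\<dots> = (\<Prod>b\<in>Basis. of_real (sqrt (pi / s) * exp (- (z \<bullet> b)\<^sup>2 / (4 * s))))"
    unfolding G_def using fourier_gaussian_real(2)[OF s] by simp
  also have "\<dots> = of_real (sqrt (pi / s) ^ DIM('a) * exp (- (norm z)\<^sup>2 / (4 * s)))"
  proof -
    have "(norm z)\<^sup>2 = (\<Sum>b\<in>Basis. (z \<bullet> b)\<^sup>2)"
      unfolding power2_norm_eq_inner by (subst euclidean_inner) (simp add: power2_eq_square)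
    then show ?thesis
      by (simp add: prod.distrib sum_divide_distrib exp_sum flip: of_real_prod sum_negf)
  qed
  also have "sqrt (pi / s) ^ DIM('a) * exp (- (norm z)\<^sup>2 / (4 * s)) = (2 * pi) ^ DIM('a) * heat s z"
  proof -
    have "sqrt (pi / s) ^ DIM('a) = (pi / s) powr (real DIM('a) / 2)"
      using s by (simp add: powr_half_sqrt[symmetric] powr_powr flip: powr_realpow)
    also have "\<dots> = ((2 * pi) powr 2 / (4 * pi * s)) powr (real DIM('a) / 2)"
      using s by (simp add: powr_numeral power2_eq_square)
    also have "\<dots> = (2 * pi) powr (real DIM('a)) * (4 * pi * s) powr (- (real DIM('a) / 2))"
      using s by (subst powr_divide) (auto simp only: powr_powr powr_minus, auto simp: divide_simps)
    also have "(2 * pi) powr (real DIM('a)) = (2 * pi) ^ DIM('a)"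
      by (simp add: powr_realpow)
    finally show ?thesis by (simp add: heat_def)
  qed
  finally show ?E by (simp only: F_def)
qed

text \<open>This is the Fourier integral of a Gaussian at frequency 0. Its parameter is
  \<open>1 / (4 * s)\<close>, so the value appears through the heat kernel at that time, and the
  powers of pi cancel.\<close>

lemma heat_integral:
  assumes s: "0 < s"
  shows "integrable lborel (heat s :: 'a::euclidean_space \<Rightarrow> real)" (is ?I)
    and "(LINT z|lborel. heat s (z :: 'a)) = 1" (is ?E)
proof -
  define c where "c = (4 * pi * s) powr (- (real DIM('a) / 2))"
  have h: "heat s z = c * exp (- (1 / (4 * s)) * (norm z)\<^sup>2)" for z :: 'a
    by (simp add: heat_def c_def)
  have s': "0 < 1 / (4 * s)" using s by simp
  have 1: "integrable lborel (\<lambda>x::'a. complex_of_real (exp (- (1 / (4 * s)) * (norm x)\<^sup>2)))"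
    using fourier_gaussian(1)[OF s', of "0::'a"] by simp
  then have 2: "integrable lborel (\<lambda>x::'a. exp (- (1 / (4 * s)) * (norm x)\<^sup>2))"
    by (subst (asm) complex_of_real_integrable_eq)
  show ?I unfolding h using 2 by (intro integrable_mult_right) auto
  have "complex_of_real (LINT x::'a|lborel. exp (- (1 / (4 * s)) * (norm x)\<^sup>2))
        = of_real ((2 * pi) ^ DIM('a) * heat (1 / (4 * s)) (0 :: 'a))"
    using fourier_gaussian(2)[OF s', of "0::'a"] by (simp flip: integral_complex_of_real)
  then have "(LINT x::'a|lborel. exp (- (1 / (4 * s)) * (norm x)\<^sup>2)) = (2 * pi) ^ DIM('a) * heat (1 / (4 * s)) (0 :: 'a)"
    by (simp only: of_real_eq_iff)
  moreover have "c * ((2 * pi) ^ DIM('a) * heat (1 / (4 * s)) (0 :: 'a)) = 1"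
  proof -
    have "(2 * pi) ^ DIM('a) = ((2 * pi) powr 2) powr (real DIM('a) / 2)"
      by (simp only: powr_powr) (simp add: powr_realpow)
    moreover have "c = (1 / (4 * pi * s)) powr (real DIM('a) / 2)"
      using s by (simp add: c_def powr_minus_divide powr_divide)
    moreover have "heat (1 / (4 * s)) (0 :: 'a) = (s / pi) powr (real DIM('a) / 2)"
      using s by (simp add: heat_def powr_minus_divide powr_divide)
    ultimately have "c * ((2 * pi) ^ DIM('a) * heat (1 / (4 * s)) (0 :: 'a))
        = (1 / (4 * pi * s) * ((2 * pi) powr 2 * (s / pi))) powr (real DIM('a) / 2)"
      using s by (simp only: powr_mult)
    also have "1 / (4 * pi * s) * ((2 * pi) powr 2 * (s / pi)) = 1"
      using s by (simp add: powr_numeral power2_eq_square)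
    finally show ?thesis by simp
  qed
  ultimately show ?E unfolding h by simp
qed

lemma heat_nn_integral:
  assumes "0 < s"
  shows "(\<integral>\<^sup>+z. ennreal (heat s (z - y)) \<partial>lborel) = 1"
    and "(\<integral>\<^sup>+z. ennreal (heat s (y - z)) \<partial>lborel) = 1"
proof -
  show 1: "(\<integral>\<^sup>+z. ennreal (heat s (z - y)) \<partial>lborel) = 1"
    using lborel_nn_integral_shift[of "\<lambda>z. ennreal (heat s z)" y] heat_integral[OF assms, where 'a = 'a]
    by (simp add: nn_integral_eq_integral)
  then show "(\<integral>\<^sup>+z. ennreal (heat s (y - z)) \<partial>lborel) = 1"
    by (simp add: heat_commute[of s y])
qed

text \<open>Both halves of the minimum are used later: linear decay as \<open>u\<close> tends to 0
  and boundedness for large \<open>u\<close> make the bound integrable against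
  \<open>u powr (- k - 1)\<close> for \<open>0 < k < 1\<close>.\<close>

lemma heat_diff_L1:
  assumes s: "0 < s" and u: "0 \<le> u"
  shows "(\<integral>\<^sup>+z. ennreal \<bar>heat s z - heat (s + u) (z::'a::euclidean_space)\<bar> \<partial>lborel)
           \<le> ennreal (min 2 (real DIM('a) * u / s))"
proof -
  \<comment> \<open>The ratio of the two normalising factors. The exponential factor increases with
    time, so \<open>\<theta> * heat s\<close> stays below the later kernel.\<close>
  define \<theta> where "\<theta> = (1 + u / s) powr (- (real DIM('a) / 2))"
  have le: "\<theta> * heat s z \<le> heat (s + u) z" for z :: 'a
  proof -
    have "exp (- (norm z)\<^sup>2 / (4 * s)) \<le> exp (- (norm z)\<^sup>2 / (4 * (s + u)))"
      using s u by (auto intro!: divide_left_mono)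
    moreover have "\<theta> * (4 * pi * s) powr (- (real DIM('a) / 2)) = (4 * pi * (s + u)) powr (- (real DIM('a) / 2))"
    proof -
      have "(1 + u / s) * (4 * pi * s) = 4 * pi * (s + u)"
        using s by (simp add: field_simps)
      moreover have "\<theta> * (4 * pi * s) powr (- (real DIM('a) / 2)) = ((1 + u / s) * (4 * pi * s)) powr (- (real DIM('a) / 2))"
        unfolding \<theta>_def using s u by (simp only: powr_mult)
      ultimately show ?thesis by (simp only:)
    qed
    ultimately show ?thesis
      by (simp add: heat_def mult_left_mono mult.assoc[symmetric])
  qed
  have \<theta>: "0 \<le> \<theta>" "\<theta> \<le> 1"
    using s u powr_mono2'[of "- (real DIM('a) / 2)" 1 "1 + u / s"] by (auto simp: \<theta>_def)
  have bern: "1 - \<theta> \<le> real DIM('a) / 2 * (u / s)"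
  proof -
    have "ln (1 + u / s) \<le> u / s" using s u by (intro ln_add_one_self_le_self) auto
    then have "real DIM('a) / 2 * ln (1 + u / s) \<le> real DIM('a) / 2 * (u / s)"
      by (intro mult_left_mono) auto
    moreover have "1 + (- (real DIM('a) / 2) * ln (1 + u / s)) \<le> exp (- (real DIM('a) / 2) * ln (1 + u / s))"
      by (rule exp_ge_add_one_self)
    moreover have "\<theta> = exp (- (real DIM('a) / 2) * ln (1 + u / s))"
    proof -
      have "1 + u / s > 0" using s u by (simp add: add_pos_nonneg)
      then show ?thesis by (simp add: \<theta>_def powr_def)
    qed
    ultimately show ?thesis by linarith
  qed
  have su: "0 < s + u" using s u by simp
  note [simp] = heat_integral[OF s, where 'a = 'a] heat_integral[OF su, where 'a = 'a]
  \<comment> \<open>both kernels have integral 1, so only the positive part of the difference matters\<close>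
  have abs_le: "\<bar>heat s z - heat (s + u) z\<bar> \<le> 2 * (1 - \<theta>) * heat s z - (heat s z - heat (s + u) z)" for z :: 'a
    using le[of z] mult_right_mono[OF \<theta>(2), of "heat s z"] heat_nonneg[of s z]
    by (auto simp: algebra_simps abs_if)
  then have "(\<integral>\<^sup>+z. ennreal \<bar>heat s z - heat (s + u) (z::'a)\<bar> \<partial>lborel)
      \<le> (\<integral>\<^sup>+z. ennreal (2 * (1 - \<theta>) * heat s z - (heat s z - heat (s + u) (z::'a))) \<partial>lborel)"
    by (intro nn_integral_mono ennreal_leI) auto
  also have "\<dots> = ennreal (LINT z|lborel. 2 * (1 - \<theta>) * heat s z - (heat s z - heat (s + u) (z::'a)))"
    by (intro nn_integral_eq_integral AE_I2 order_trans[OF abs_ge_zero abs_le]) auto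
  also have "(LINT z|lborel. 2 * (1 - \<theta>) * heat s z - (heat s z - heat (s + u) (z::'a))) = 2 * (1 - \<theta>)"
    by simp
  also have "ennreal \<dots> \<le> ennreal (min 2 (real DIM('a) * u / s))"
  proof (intro ennreal_leI min.boundedI)
    show "2 * (1 - \<theta>) \<le> real DIM('a) * u / s"
      using bern s by (simp add: field_simps)
  qed (use \<theta> in simp)
  finally show ?thesis .
qed

section \<open>One-dimensional integrals\<close>

lemma nn_integral_FTC_Ioi:
  fixes f F :: "real \<Rightarrow> real"
  assumes "\<And>x. a < x \<Longrightarrow> DERIV F x :> f x" and "\<And>x. a < x \<Longrightarrow> isCont f x"
    and nonneg: "\<And>x. a < x \<Longrightarrow> 0 \<le> f x"
    and "(F \<longlongrightarrow> A) (at_right a)" and "(F \<longlongrightarrow> B) at_top"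
  shows "(\<integral>\<^sup>+x. ennreal (f x) * indicator {a<..} x \<partial>lborel) = ennreal (B - A)"
proof -
  have A: "((F \<circ> real_of_ereal) \<longlongrightarrow> A) (at_right (ereal a))"
    using assms(4) by (simp add: ereal_tendsto_simps)
  have B: "((F \<circ> real_of_ereal) \<longlongrightarrow> B) (at_left \<infinity>)"
    using assms(5) by (simp add: ereal_tendsto_simps)
  have set: "einterval (ereal a) \<infinity> = {a<..}"
    by (auto simp: einterval_def)
  note * = interval_integral_FTC_nonneg[of "ereal a" \<infinity> F f A B, simplified, OF _ _ _ A B]
  have 1: "set_integrable lborel {a<..} f" "(LBINT x=a..\<infinity>. f x) = B - A"
    using * assms(1,2,3) by (auto simp: set)
  have "(\<integral>\<^sup>+x. ennreal (f x) * indicator {a<..} x \<partial>lborel)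
      = (\<integral>\<^sup>+x. ennreal (indicator {a<..} x *\<^sub>R f x) \<partial>lborel)"
    by (intro nn_integral_cong) (auto simp: indicator_def)
  also have "\<dots> = ennreal (LINT x|lborel. indicator {a<..} x *\<^sub>R f x)"
    using 1(1) nonneg unfolding set_integrable_def
    by (intro nn_integral_eq_integral) (auto simp: indicator_def)
  also have "(LINT x|lborel. indicator {a<..} x *\<^sub>R f x) = B - A"
    using 1(2) by (simp add: interval_lebesgue_integral_def set set_lebesgue_integral_def)
  finally show ?thesis .
qed

lemma nn_integral_FTC_Ioo:
  fixes f F :: "real \<Rightarrow> real"
  assumes "a < b" and "\<And>x. a < x \<Longrightarrow> x < b \<Longrightarrow> DERIV F x :> f x" and "\<And>x. a < x \<Longrightarrow> x < b \<Longrightarrow> isCont f x"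
    and nonneg: "\<And>x. a < x \<Longrightarrow> x < b \<Longrightarrow> 0 \<le> f x"
    and "(F \<longlongrightarrow> A) (at_right a)" and "(F \<longlongrightarrow> B) (at_left b)"
  shows "(\<integral>\<^sup>+x. ennreal (f x) * indicator {a<..<b} x \<partial>lborel) = ennreal (B - A)"
proof -
  have A: "((F \<circ> real_of_ereal) \<longlongrightarrow> A) (at_right (ereal a))"
    using assms(5) by (simp add: ereal_tendsto_simps)
  have B: "((F \<circ> real_of_ereal) \<longlongrightarrow> B) (at_left (ereal b))"
    using assms(6) by (simp add: ereal_tendsto_simps)
  have set: "einterval (ereal a) (ereal b) = {a<..<b}"
    by (auto simp: einterval_def)
  note * = interval_integral_FTC_nonneg[of "ereal a" "ereal b" F f A B, simplified, OF _ _ _ _ A B]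
  have 1: "set_integrable lborel {a<..<b} f" "(LBINT x=a..b. f x) = B - A"
    using * assms(1-4) by (auto simp: set)
  have "(\<integral>\<^sup>+x. ennreal (f x) * indicator {a<..<b} x \<partial>lborel)
      = (\<integral>\<^sup>+x. ennreal (indicator {a<..<b} x *\<^sub>R f x) \<partial>lborel)"
    by (intro nn_integral_cong) (auto simp: indicator_def)
  also have "\<dots> = ennreal (LINT x|lborel. indicator {a<..<b} x *\<^sub>R f x)"
    using 1(1) nonneg unfolding set_integrable_def
    by (intro nn_integral_eq_integral) (auto simp: indicator_def)
  also have "(LINT x|lborel. indicator {a<..<b} x *\<^sub>R f x) = B - A"
    using 1(2) \<open>a < b\<close> by (simp add: interval_lebesgue_integral_def set set_lebesgue_integral_def)
  finally show ?thesis .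
qed

lemma nn_integral_powr_Ioo:
  fixes T k :: real
  assumes "0 < T" "0 < k"
  shows "(\<integral>\<^sup>+s. ennreal (s powr (k - 1)) * indicator {0<..<T} s \<partial>lborel) = ennreal (T powr k / k)"
proof -
  have "(\<integral>\<^sup>+s. ennreal (s powr (k - 1)) * indicator {0<..<T} s \<partial>lborel) = ennreal (T powr k / k - 0)"
  proof (rule nn_integral_FTC_Ioo[where F = "\<lambda>s. s powr k / k"])
    show "((\<lambda>s. s powr k / k) \<longlongrightarrow> 0) (at_right 0)"
      using assms by real_asymp
    show "((\<lambda>s. s powr k / k) \<longlongrightarrow> T powr k / k) (at_left T)"
      using assms by (auto intro!: tendsto_intros)
  qed (use assms in \<open>auto intro!: derivative_eq_intros continuous_intros\<close>)
  then show ?thesis by simp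
qed

lemma nn_integral_powr_Ioi:
  fixes T b :: real
  assumes "0 < T" "b < 0"
  shows "(\<integral>\<^sup>+s. ennreal (s powr (b - 1)) * indicator {T<..} s \<partial>lborel) = ennreal (T powr b / (- b))"
proof -
  have "(\<integral>\<^sup>+s. ennreal (s powr (b - 1)) * indicator {T<..} s \<partial>lborel) = ennreal (0 - T powr b / b)"
  proof (rule nn_integral_FTC_Ioi[where F = "\<lambda>s. s powr b / b"])
    show "((\<lambda>s. s powr b / b) \<longlongrightarrow> 0) at_top"
      using assms by real_asymp
    show "((\<lambda>s. s powr b / b) \<longlongrightarrow> T powr b / b) (at_right T)"
      using assms by (auto intro!: tendsto_intros)
  qed (use assms in \<open>auto intro!: derivative_eq_intros continuous_intros\<close>)
  then show ?thesis by simp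
qed

text \<open>Each power alone has infinite integral over the half-line. The primitive of the
  difference tends to 0 at infinity because \<open>k < 1\<close>, so the whole value comes from the
  endpoint \<open>t\<close>.\<close>

lemma nn_integral_powr_shift_diff:
  fixes t k :: real
  assumes "0 < t" "0 < k" "k < 1"
  shows "(\<integral>\<^sup>+s. ennreal ((s - t) powr (k - 1) - s powr (k - 1)) * indicator {t<..} s \<partial>lborel) = ennreal (t powr k / k)"
proof -
  have "(\<integral>\<^sup>+s. ennreal ((s - t) powr (k - 1) - s powr (k - 1)) * indicator {t<..} s \<partial>lborel)
      = ennreal (0 - (- (t powr k) / k))"
  proof (rule nn_integral_FTC_Ioi[where F = "\<lambda>s. ((s - t) powr k - s powr k) / k"])
    show "((\<lambda>s. ((s - t) powr k - s powr k) / k) \<longlongrightarrow> 0) at_top"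
      using assms by real_asymp
    have "((\<lambda>s. s powr k) \<longlongrightarrow> 0) (at_right 0)"
      using assms by real_asymp
    then have "((\<lambda>s. (s - t) powr k) \<longlongrightarrow> 0) (at_right t)"
      using filterlim_at_right_to_0[of "\<lambda>s. (s - t) powr k" _ t] by simp
    moreover have "((\<lambda>s. s powr k) \<longlongrightarrow> t powr k) (at_right t)"
      using assms by (auto intro!: tendsto_intros)
    ultimately have "((\<lambda>s. ((s - t) powr k - s powr k) / k) \<longlongrightarrow> (0 - t powr k) / k) (at_right t)"
      using assms by (intro tendsto_intros) auto
    then show "((\<lambda>s. ((s - t) powr k - s powr k) / k) \<longlongrightarrow> (- (t powr k) / k)) (at_right t)"
      by simp
    fix s assume "t < s"
    then show "0 \<le> (s - t) powr (k - 1) - s powr (k - 1)"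
      using assms powr_mono2'[of "k - 1" "s - t" s] by simp
    show "DERIV (\<lambda>s. ((s - t) powr k - s powr k) / k) s :> (s - t) powr (k - 1) - s powr (k - 1)"
      using assms \<open>t < s\<close> by (auto intro!: derivative_eq_intros simp: field_simps)
  qed (use assms in \<open>auto intro!: continuous_intros\<close>)
  then show ?thesis by simp
qed

text \<open>The kernel of the fractional integral of order \<open>k\<close> minus its shift by \<open>t\<close>; the cancellation
  at infinity makes the difference integrable.\<close>

definition riesz_weight :: "real \<Rightarrow> real \<Rightarrow> real \<Rightarrow> real" where
  "riesz_weight k t s = s powr (k - 1) * indicator {0<..} s - (s - t) powr (k - 1) * indicator {t<..} s"

lemma riesz_weight_measurable [measurable]: "riesz_weight k t \<in> borel_measurable borel"
  unfolding riesz_weight_def by measurable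

text \<open>Since \<open>k - 1\<close> is negative, the weight is positive on
  \<open>{0<..<t}\<close> and negative beyond \<open>t\<close>. At \<open>s = t\<close> itself the
  left side is positive and the right side is 0; that point is later discarded as a null
  set.\<close>

lemma abs_riesz_weight:
  assumes "0 < t" "0 < k" "k < 1" "s \<noteq> t"
  shows "ennreal \<bar>riesz_weight k t s\<bar> = ennreal (s powr (k - 1)) * indicator {0<..<t} s
    + ennreal ((s - t) powr (k - 1) - s powr (k - 1)) * indicator {t<..} s"
  using assms powr_mono2'[of "k - 1" "s - t" s]
  by (auto simp: riesz_weight_def indicator_def)

lemma riesz_weight_nonpos: "s \<le> 0 \<Longrightarrow> 0 < t \<Longrightarrow> riesz_weight k t s = 0"
  by (simp add: riesz_weight_def)

text \<open>The two sides of \<open>t\<close> carry the same mass \<open>t powr k / k\<close>, with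
  opposite signs; hence the factor 2.\<close>

lemma nn_integral_riesz_weight:
  assumes "0 < t" "0 < k" "k < 1"
  shows "(\<integral>\<^sup>+s. ennreal \<bar>riesz_weight k t s\<bar> \<partial>lborel) = ennreal (2 * t powr k / k)"
proof -
  have "(\<integral>\<^sup>+s. ennreal \<bar>riesz_weight k t s\<bar> \<partial>lborel)
     = (\<integral>\<^sup>+s. ennreal (s powr (k - 1)) * indicator {0<..<t} s
    + ennreal ((s - t) powr (k - 1) - s powr (k - 1)) * indicator {t<..} s \<partial>lborel)"
    using abs_riesz_weight[OF assms] AE_lborel_singleton[of t] by (intro nn_integral_cong_AE) auto
  also have "\<dots> = ennreal (t powr k / k) + ennreal (t powr k / k)"
    by (subst nn_integral_add) (simp_all only: nn_integral_powr_Ioo[OF assms(1,2)] nn_integral_powr_shift_diff[OF assms], auto)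
  also have "\<dots> = ennreal (2 * t powr k / k)"
    using assms by (simp flip: ennreal_plus)
  finally show ?thesis .
qed

lemma nn_integral_riesz_weight_less:
  assumes "0 < T" "T \<le> t" "0 < k" "k < 1"
  shows "(\<integral>\<^sup>+s. ennreal \<bar>riesz_weight k t s\<bar> * indicator {..<T} s \<partial>lborel) = ennreal (T powr k / k)"
proof -
  have "(\<integral>\<^sup>+s. ennreal \<bar>riesz_weight k t s\<bar> * indicator {..<T} s \<partial>lborel)
     = (\<integral>\<^sup>+s. ennreal (s powr (k - 1)) * indicator {0<..<T} s \<partial>lborel)"
    using assms by (intro nn_integral_cong) (auto simp: riesz_weight_def indicator_def)
  then show ?thesis using nn_integral_powr_Ioo[of T k] assms by simp
qed

text \<open>The factor \<open>s powr (- n)\<close> stands for the supremum bound of the heat kernel,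
  with \<open>n\<close> half the dimension. Between \<open>T\<close> and \<open>t\<close> the weight
  is \<open>s powr (k - 1)\<close>, and \<open>k < n\<close> makes the product integrable at
  infinity. Beyond \<open>t\<close> the factor is at most \<open>t powr (- n)\<close> and the
  remaining mass is \<open>t powr k / k\<close>.\<close>

lemma nn_integral_riesz_weight_ge:
  assumes "0 < T" "T \<le> t" "0 < k" "k < 1" "k < n"
  shows "(\<integral>\<^sup>+s. ennreal (\<bar>riesz_weight k t s\<bar> * s powr (- n)) * indicator {T..} s \<partial>lborel)
    \<le> ennreal ((1 / (n - k) + 1 / k) * T powr (k - n))"
proof -
  have t: "0 < t" using assms by simp
  have "(\<integral>\<^sup>+s. ennreal (\<bar>riesz_weight k t s\<bar> * s powr (- n)) * indicator {T..} s \<partial>lborel)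
     \<le> (\<integral>\<^sup>+s. ennreal (s powr ((k - n) - 1)) * indicator {T<..} s
    + ennreal (t powr (- n)) * (ennreal ((s - t) powr (k - 1) - s powr (k - 1)) * indicator {t<..} s) \<partial>lborel)"
  proof (intro nn_integral_mono_AE, use AE_lborel_singleton[of t] AE_lborel_singleton[of T] in eventually_elim)
    case (elim s)
    show ?case
    proof (cases "t < s")
      case True
      then have "s powr (- n) \<le> t powr (- n)" using assms by (intro powr_mono2') auto
      then have "ennreal (\<bar>riesz_weight k t s\<bar> * s powr (- n)) \<le> ennreal \<bar>riesz_weight k t s\<bar> * ennreal (t powr (- n))"
        by (subst ennreal_mult[symmetric]) (auto intro!: ennreal_leI mult_left_mono)
      also have "\<dots> = ennreal (t powr (- n)) * (ennreal ((s - t) powr (k - 1) - s powr (k - 1)) * indicator {t<..} s)"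
        using True t assms by (subst abs_riesz_weight) (auto simp: mult.commute)
      finally show ?thesis using True assms by (auto intro: order_trans add_increasing)
    next
      case False
      then have "ennreal (\<bar>riesz_weight k t s\<bar> * s powr (- n)) * indicator {T..} s
        = ennreal (s powr ((k - n) - 1)) * indicator {T<..} s"
        using elim assms by (auto simp: riesz_weight_def indicator_def powr_add[symmetric] algebra_simps)
      then show ?thesis by simp
    qed
  qed
  also have "\<dots> = ennreal (T powr (k - n) / (n - k)) + ennreal (t powr (- n)) * ennreal (t powr k / k)"
    using assms t nn_integral_powr_Ioi[of T "k - n"]
    by (subst nn_integral_add) (auto simp: nn_integral_cmult nn_integral_powr_shift_diff)
  also have "\<dots> = ennreal (T powr (k - n) / (n - k) + t powr (k - n) / k)"
    using assms by (simp add: ennreal_mult'[symmetric] powr_add[symmetric] flip: ennreal_plus)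
  also have "\<dots> \<le> ennreal ((1 / (n - k) + 1 / k) * T powr (k - n))"
    using assms powr_mono2'[of "k - n" T t] by (intro ennreal_leI) (simp add: algebra_simps divide_right_mono)
  finally show ?thesis .
qed

lemma Gamma_integral_scaled:
  fixes k l :: real
  assumes "0 < k" "0 < l"
  shows "integrable lborel (\<lambda>s. indicator {0<..} s * s powr (k - 1) * exp (- s * l))" (is ?I)
    and "(LINT s|lborel. indicator {0<..} s * s powr (k - 1) * exp (- s * l)) = Gamma k * l powr (- k)" (is ?E)
proof -
  define f where "f = (\<lambda>s. indicator {0<..} s * s powr (k - 1) * exp (- s * l))"
  have f: "f (0 + (1 / l) * x) = l powr (1 - k) * (indicator {0..} x * x powr (k - 1) / exp x)" for x
    using assms by (cases "x = 0") (auto simp: f_def indicator_def powr_divide powr_diff exp_minus field_simps zero_less_divide_iff)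
  define g where "g = (\<lambda>x. indicator {0..} x * x powr (k - 1) / exp x)"
  have "(\<integral>\<^sup>+x. ennreal (g x) \<partial>lborel) = ennreal (Gamma k)"
    using Gamma_conv_nn_integral_real[of k] assms by (simp add: g_def)
  then have "has_bochner_integral lborel g (Gamma k)"
    using assms by (intro has_bochner_integral_nn_integral) (auto simp: g_def Gamma_real_nonneg less_imp_le)
  then have "has_bochner_integral lborel (\<lambda>x. f (0 + (1 / l) * x)) (l powr (1 - k) * Gamma k)"
    unfolding f g_def by (rule has_bochner_integral_mult_right)
  then have "has_bochner_integral lborel f ((1 / l) * (l powr (1 - k) * Gamma k))"
    using assms lborel_has_bochner_integral_real_affine_iff[of "1 / l" f "(1 / l) * (l powr (1 - k) * Gamma k)" 0] by simp
  moreover have "(1 / l) * (l powr (1 - k) * Gamma k) = Gamma k * l powr (- k)"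
    using assms by (simp add: powr_diff powr_minus field_simps)
  ultimately show ?I ?E
    by (auto simp: f_def has_bochner_integral_iff)
qed

text \<open>The identity for which the weight is made: the shift by \<open>t\<close> multiplies the
  Laplace transform by \<open>exp (- t * l)\<close>. For \<open>l = |\<xi>|^2\<close> the factor
  \<open>l powr k\<close> is the symbol of the fractional Laplacian, and the right side is the
  symbol of the difference of heat extensions over a time \<open>t\<close>.\<close>

lemma riesz_weight_laplace:
  fixes k l t :: real
  assumes "0 < k" "0 < l" "0 < t"
  shows "(LINT s|lborel. riesz_weight k t s * exp (- s * l)) * l powr k = Gamma k * (1 - exp (- t * l))"
proof -
  define f where "f = (\<lambda>s. indicator {0<..} s * s powr (k - 1) * exp (- s * l))"
  have f: "integrable lborel f" "integral\<^sup>L lborel f = Gamma k * l powr (- k)"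
    unfolding f_def using Gamma_integral_scaled[OF assms(1,2)] by auto
  have "integrable lborel (\<lambda>s. f (- t + 1 * s))" "(LINT s|lborel. f (- t + 1 * s)) = Gamma k * l powr (- k)"
    using f lborel_integrable_real_affine_iff[of 1 f "- t"] lborel_integral_real_affine[of 1 f "- t"] by auto
  note shift = this
  have "riesz_weight k t s * exp (- s * l) = f s - exp (- t * l) * f (- t + 1 * s)" for s
    by (simp add: f_def riesz_weight_def indicator_def algebra_simps flip: exp_add)
  then have "(LINT s|lborel. riesz_weight k t s * exp (- s * l)) = (LINT s|lborel. f s - exp (- t * l) * f (- t + 1 * s))"
    by simp
  also have "\<dots> = Gamma k * l powr (- k) - exp (- t * l) * (Gamma k * l powr (- k))"
    using f shift by (subst Bochner_Integration.integral_diff) auto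
  also have "\<dots> * l powr k = Gamma k * (1 - exp (- t * l)) * (l powr (- k) * l powr k)"
    by (simp add: algebra_simps)
  also have "l powr (- k) * l powr k = 1"
    using assms by (simp add: powr_add[symmetric])
  finally show ?thesis by simp
qed

lemma nn_integral_min_powr_finite:
  fixes k D :: real
  assumes "0 < k" "k < 1" "0 \<le> D"
  shows "(\<integral>\<^sup>+u. ennreal (min 2 (D * u) * u powr (- k - 1)) * indicator {0<..} u \<partial>lborel) < \<infinity>"
proof -
  have "(\<integral>\<^sup>+u. ennreal (min 2 (D * u) * u powr (- k - 1)) * indicator {0<..} u \<partial>lborel)
     \<le> (\<integral>\<^sup>+u. ennreal D * (ennreal (u powr ((1 - k) - 1)) * indicator {0<..<1} u)
            + ennreal 2 * (ennreal (u powr (- k - 1)) * indicator {1<..} u) \<partial>lborel)"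
  proof (intro nn_integral_mono_AE, use AE_lborel_singleton[of 1] in eventually_elim)
    case (elim u)
    have "u powr (- k) = u * u powr (- k - 1)" if "0 < u"
      using that by (simp add: powr_diff)
    moreover have "ennreal (min 2 (D * u) * u powr (- k - 1)) \<le> ennreal 2 * ennreal (u powr (- k - 1))"
      by (subst ennreal_mult[symmetric]) (auto intro!: ennreal_leI mult_right_mono)
    ultimately show ?case using elim assms
      by (auto simp: indicator_def ennreal_mult'[symmetric] mult.assoc intro!: ennreal_leI mult_right_mono mult_left_mono)
  qed
  also have "\<dots> = ennreal D * ennreal (1 / (1 - k)) + ennreal 2 * ennreal (1 / k)"
    using assms nn_integral_powr_Ioo[of 1 "1 - k"] nn_integral_powr_Ioi[of 1 "- k"]
    by (subst nn_integral_add) (simp_all add: nn_integral_cmult del: ennreal_numeral)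
  also have "\<dots> < \<infinity>" using assms by (simp add: ennreal_mult_less_top)
  finally show ?thesis .
qed

text \<open>The substitution \<open>u -> u / l\<close> extracts \<open>l powr k\<close> from the
  integral at \<open>l = 1\<close>. That integral is finite by the bound \<open>min 2 u\<close> for
  \<open>1 - exp (- u)\<close>, and positive because of its part over \<open>u > 1\<close>; its
  value is irrelevant for the estimates.\<close>

lemma powr_conv_nn_integral:
  fixes k :: real
  assumes "0 < k" "k < 1"
  obtains I where "0 < I" "\<And>l. 0 \<le> l \<Longrightarrow>
    (\<integral>\<^sup>+u. ennreal ((1 - exp (- u * l)) * u powr (- k - 1)) * indicator {0<..} u \<partial>lborel) = ennreal (I * l powr k)"
proof -
  define f where "f = (\<lambda>u. (1 - exp (- u)) * u powr (- k - 1))"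
  define J where "J = (\<integral>\<^sup>+u. ennreal (f u) * indicator {0<..} u \<partial>lborel)"
  have [measurable]: "f \<in> borel_measurable borel" unfolding f_def by measurable
  have "J \<le> (\<integral>\<^sup>+u. ennreal (min 2 (1 * u) * u powr (- k - 1)) * indicator {0<..} u \<partial>lborel)"
    unfolding J_def f_def
  proof (intro nn_integral_mono mult_right_mono ennreal_leI mult_mono)
    fix u :: real show "1 - exp (- u) \<le> min 2 (1 * u)"
      using exp_ge_add_one_self[of "- u"] exp_gt_zero[of "- u"] by linarith
  qed auto
  also have "\<dots> < \<infinity>" by (rule nn_integral_min_powr_finite[OF assms]) simp
  finally have fin: "J < \<infinity>" .
  have "0 < ennreal (1 - exp (- 1)) * ennreal (1 / k)"
    using assms by (simp add: ennreal_zero_less_mult_iff)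
  also have "\<dots> = (\<integral>\<^sup>+u. ennreal (1 - exp (- 1)) * (ennreal (u powr (- k - 1)) * indicator {1<..} u) \<partial>lborel)"
    using assms nn_integral_powr_Ioi[of 1 "- k"] by (simp add: nn_integral_cmult)
  also have "\<dots> \<le> J"
    unfolding J_def f_def
    by (intro nn_integral_mono) (auto simp: indicator_def ennreal_mult'[symmetric] intro!: ennreal_leI mult_right_mono)
  finally have pos: "0 < J" .
  have J: "J = ennreal (enn2real J)" using fin by simp
  show thesis
  proof (rule that[of "enn2real J"])
    show "0 < enn2real J" using pos fin by (simp add: enn2real_positive_iff)
    fix l :: real assume "0 \<le> l"
    show "(\<integral>\<^sup>+u. ennreal ((1 - exp (- u * l)) * u powr (- k - 1)) * indicator {0<..} u \<partial>lborel) = ennreal (enn2real J * l powr k)"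
    proof (cases "l = 0")
      case False
      then have l: "0 < l" using \<open>0 \<le> l\<close> by simp
      have "(\<integral>\<^sup>+u. ennreal ((1 - exp (- u * l)) * u powr (- k - 1)) * indicator {0<..} u \<partial>lborel)
        = ennreal (1 / l) * (\<integral>\<^sup>+u. ennreal (l powr (k + 1)) * (ennreal (f u) * indicator {0<..} u) \<partial>lborel)"
      proof (subst nn_integral_real_affine[where c = "1 / l" and t = 0])
        have *: "(u / l) powr (- k - 1) = l powr (k + 1) * u powr (- k - 1)" if "0 < u" for u
        proof -
          have "(- k - 1) = - (k + 1)" by simp
          then show ?thesis using that l by (simp only: powr_divide powr_minus) (simp add: field_simps)
        qed
        have "ennreal ((1 - exp (- (0 + 1 / l * u) * l)) * (0 + 1 / l * u) powr (- k - 1)) * indicator {0<..} (0 + 1 / l * u)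
            = ennreal (l powr (k + 1)) * (ennreal (f u) * indicator {0<..} u)" for u
          using l by (cases "0 < u") (auto simp: * f_def indicator_def ennreal_mult'[symmetric] mult_ac zero_less_divide_iff)
        then show "ennreal \<bar>1 / l\<bar> * (\<integral>\<^sup>+u. ennreal ((1 - exp (- (0 + 1 / l * u) * l)) * (0 + 1 / l * u) powr (- k - 1)) * indicator {0<..} (0 + 1 / l * u) \<partial>lborel)
          = ennreal (1 / l) * (\<integral>\<^sup>+u. ennreal (l powr (k + 1)) * (ennreal (f u) * indicator {0<..} u) \<partial>lborel)"
          using l by simp
      qed (use l in auto)
      also have "\<dots> = ennreal (1 / l) * (ennreal (l powr (k + 1)) * J)"
        by (simp add: nn_integral_cmult J_def)
      also have "\<dots> = ennreal (enn2real J * l powr k)"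
        by (subst J) (use l in \<open>simp add: ennreal_mult'[symmetric] powr_add mult_ac\<close>)
      finally show ?thesis .
    qed simp
  qed
qed

section \<open>The fractional Laplacian of the heat kernel\<close>

lemma Fubini_lborel:
  fixes f :: "'a::euclidean_space \<Rightarrow> 'b::euclidean_space \<Rightarrow> 'c::{banach,second_countable_topology}"
  assumes [measurable]: "case_prod f \<in> borel_measurable (lborel \<Otimes>\<^sub>M lborel)"
    and fin: "(\<integral>\<^sup>+x. \<integral>\<^sup>+y. ennreal (norm (f x y)) \<partial>lborel \<partial>lborel) < \<infinity>"
  shows "(LINT x|lborel. LINT y|lborel. f x y) = (LINT y|lborel. LINT x|lborel. f x y)"
proof -
  have "(\<integral>\<^sup>+z. ennreal (norm (case_prod f z)) \<partial>(lborel \<Otimes>\<^sub>M lborel)) < \<infinity>"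
    using fin by (subst lborel.nn_integral_fst[symmetric]) auto
  then have "integrable (lborel \<Otimes>\<^sub>M lborel) (case_prod f)"
    by (intro integrableI_bounded) auto
  then show ?thesis by (rule lborel_pair.Fubini_integral[symmetric])
qed

text \<open>Integrability may be left open: a Bochner integral that does not exist is 0 by
  convention.\<close>

lemma norm_integral_le_nn_integral:
  fixes f :: "'a \<Rightarrow> 'b::{banach,second_countable_topology}"
  shows "ennreal (norm (integral\<^sup>L M f)) \<le> (\<integral>\<^sup>+x. ennreal (norm (f x)) \<partial>M)"
  by (cases "integrable M f") (simp_all add: integral_norm_bound_ennreal not_integrable_integral_eq)

text \<open>This elementary bound replaces Hoelder's inequality: optimising over \<open>L\<close> recovers it.\<close>

lemma le_add_powr:
  fixes a L p :: real
  assumes "0 \<le> a" "0 < L" "1 \<le> p"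
  shows "a \<le> L + L powr (1 - p) * a powr p"
proof (cases "a \<le> L")
  case False
  then have "a powr (1 - p) \<le> L powr (1 - p)"
    using assms by (intro powr_mono2') auto
  then have "a powr (1 - p) * a powr p \<le> L powr (1 - p) * a powr p"
    by (intro mult_right_mono) auto
  moreover have "a powr (1 - p) * a powr p = a"
    using assms False by (simp add: powr_add[symmetric])
  ultimately show ?thesis using assms by simp
qed (use assms in \<open>simp add: add_increasing2\<close>)

text \<open>A kernel that is both bounded and integrable pairs with every Lp function. The term
  \<open>L\<close> is integrated with the mass of \<open>H\<close>, the power term with its
  supremum; \<open>L\<close> is left free so that the two can be balanced.\<close>

lemma nn_integral_mult_le:
  fixes v :: "'a::euclidean_space \<Rightarrow> 'b::real_normed_vector"
  assumes [measurable]: "v \<in> borel_measurable borel" "H \<in> borel_measurable borel"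
    and H: "\<And>x. 0 \<le> H x" "\<And>x. H x \<le> B" and L: "0 < L" and p: "1 \<le> p"
  shows "(\<integral>\<^sup>+x. ennreal (norm (v x) * H x) \<partial>lborel)
    \<le> ennreal L * (\<integral>\<^sup>+x. ennreal (H x) \<partial>lborel)
      + ennreal (L powr (1 - p) * B) * (\<integral>\<^sup>+x. ennreal (norm (v x) powr p) \<partial>lborel)"
proof -
  have B: "0 \<le> B" using H(1)[of 0] H(2)[of 0] by linarith
  have "(\<integral>\<^sup>+x. ennreal (norm (v x) * H x) \<partial>lborel)
    \<le> (\<integral>\<^sup>+x. ennreal L * ennreal (H x) + ennreal (L powr (1 - p) * B) * ennreal (norm (v x) powr p) \<partial>lborel)"
  proof (rule nn_integral_mono)
    fix x
    have "norm (v x) * H x \<le> (L + L powr (1 - p) * norm (v x) powr p) * H x"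
      using le_add_powr[OF norm_ge_zero L p] H by (intro mult_right_mono) auto
    also have "\<dots> = L * H x + L powr (1 - p) * norm (v x) powr p * H x"
      by (simp add: algebra_simps)
    also have "\<dots> \<le> L * H x + L powr (1 - p) * norm (v x) powr p * B"
      using H by (intro add_left_mono mult_left_mono) auto
    finally have "ennreal (norm (v x) * H x) \<le> ennreal (L * H x + L powr (1 - p) * norm (v x) powr p * B)"
      by (rule ennreal_leI)
    also have "\<dots> = ennreal L * ennreal (H x) + ennreal (L powr (1 - p) * B) * ennreal (norm (v x) powr p)"
      using H L B by (simp add: ennreal_mult'[symmetric] mult_ac flip: ennreal_plus)
    finally show "ennreal (norm (v x) * H x) \<le> \<dots>" .
  qed
  also have "\<dots> = ennreal L * (\<integral>\<^sup>+x. ennreal (H x) \<partial>lborel)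
      + ennreal (L powr (1 - p) * B) * (\<integral>\<^sup>+x. ennreal (norm (v x) powr p) \<partial>lborel)"
    by (subst nn_integral_add) (auto simp: nn_integral_cmult)
  finally show ?thesis .
qed

text \<open>The fractional Laplacian of order \<open>\<gamma> / 2\<close> applied to the heat
  kernel, as an inverse Fourier integral. The symbol is radial, so the sign in the exponent is
  immaterial.\<close>

definition frac_heat :: "real \<Rightarrow> real \<Rightarrow> 'a::euclidean_space \<Rightarrow> complex" where
  "frac_heat \<gamma> s z =
     (LINT \<xi>|lborel. exp (- \<i> * of_real (z \<bullet> \<xi>)) * of_real (norm \<xi> powr \<gamma> * exp (- s * (norm \<xi>)\<^sup>2)))
       / of_real ((2 * pi) ^ DIM('a))"

lemma frac_heat_measurable [measurable]:
  "(\<lambda>(s, z). frac_heat \<gamma> s (z::'a::euclidean_space)) \<in> borel_measurable (borel \<Otimes>\<^sub>M borel)"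
  unfolding frac_heat_def by measurable

lemma frac_heat_measurable' [measurable (raw)]:
  fixes g :: "'b \<Rightarrow> 'a::euclidean_space"
  assumes [measurable]: "f \<in> borel_measurable M" "g \<in> borel_measurable M"
  shows "(\<lambda>x. frac_heat \<gamma> (f x) (g x)) \<in> borel_measurable M"
  using measurable_compose[OF measurable_Pair[OF assms] frac_heat_measurable] by simp

lemma integrable_powr_gauss:
  assumes "0 < s" "0 \<le> \<gamma>" "\<gamma> < 2"
  shows "integrable lborel (\<lambda>\<xi>::'a::euclidean_space. norm \<xi> powr \<gamma> * exp (- s * (norm \<xi>)\<^sup>2))"
proof -
  have g: "integrable lborel (\<lambda>x::'a. exp (- s * (norm x)\<^sup>2))" if "0 < s" for s
  proof -
    have "integrable lborel (\<lambda>x::'a. complex_of_real (exp (- s * (norm x)\<^sup>2)))"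
      using fourier_gaussian(1)[OF that, of "0::'a"] by simp
    then show ?thesis by (subst (asm) complex_of_real_integrable_eq)
  qed
  have "integrable lborel (\<lambda>x::'a. (1 + 2 / s) * exp (- (s / 2) * (norm x)\<^sup>2))"
    using g[of "s / 2"] assms by (intro integrable_mult_right) auto
  then show ?thesis
  proof (rule Bochner_Integration.integrable_bound)
    have "norm \<xi> powr \<gamma> * exp (- s * (norm \<xi>)\<^sup>2) \<le> (1 + 2 / s) * exp (- (s / 2) * (norm \<xi>)\<^sup>2)" for \<xi> :: 'a
    proof -
      define q where "q = (norm \<xi>)\<^sup>2"
      have q: "0 \<le> q" by (simp add: q_def)
      have "norm \<xi> powr \<gamma> \<le> 1 + q"
      proof (cases "norm \<xi> \<le> 1")
        case True
        then have "norm \<xi> powr \<gamma> \<le> 1" using assms by (intro powr_le1) auto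
        then show ?thesis using q by simp
      next
        case False
        then have "norm \<xi> powr \<gamma> \<le> norm \<xi> powr 2" using assms by (intro powr_mono) auto
        also have "\<dots> = q" using False by (simp add: q_def)
        finally show ?thesis by simp
      qed
      \<comment> \<open>Half of the Gaussian exponent is spent on absorbing the growth of the power;
        the other half stays integrable.\<close>
      also have "1 + q \<le> (1 + 2 / s) * exp (s / 2 * q)"
      proof -
        have "s / 2 * q \<le> exp (s / 2 * q)"
          using exp_ge_add_one_self[of "s / 2 * q"] by linarith
        from mult_left_mono[OF this, of "2 / s"] have "q \<le> (2 / s) * exp (s / 2 * q)"
          using assms by simp
        moreover have "1 \<le> exp (s / 2 * q)" using assms q by simp
        ultimately show ?thesis by (simp only: distrib_right mult_1 add_mono)
      qed
      finally have "norm \<xi> powr \<gamma> * exp (- s * q) \<le> (1 + 2 / s) * exp (s / 2 * q) * exp (- s * q)"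
        by (intro mult_right_mono) auto
      also have "\<dots> = (1 + 2 / s) * exp (- (s / 2) * q)"
        by (simp add: mult.assoc exp_add[symmetric])
      finally show ?thesis by (simp add: q_def)
    qed
    then show "AE x in lborel. norm (norm x powr \<gamma> * exp (- s * (norm (x::'a))\<^sup>2)) \<le> norm ((1 + 2 / s) * exp (- (s / 2) * (norm x)\<^sup>2))"
      using assms by (intro AE_I2) simp
  qed measurable
qed

lemma norm_frac_heat_le:
  fixes z :: "'a::euclidean_space"
  assumes "0 < \<delta>" "\<delta> \<le> s" "0 \<le> \<gamma>" "\<gamma> < 2"
  shows "norm (frac_heat \<gamma> s z) \<le> (LINT \<xi>::'a|lborel. norm \<xi> powr \<gamma> * exp (- \<delta> * (norm \<xi>)\<^sup>2)) / (2 * pi) ^ DIM('a)"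
proof -
  have "norm (LINT \<xi>|lborel. exp (- \<i> * of_real (z \<bullet> \<xi>)) * complex_of_real (norm \<xi> powr \<gamma> * exp (- s * (norm \<xi>)\<^sup>2)))
    \<le> (LINT \<xi>::'a|lborel. norm \<xi> powr \<gamma> * exp (- \<delta> * (norm \<xi>)\<^sup>2))"
  proof (rule order_trans[OF integral_norm_bound], rule integral_mono)
    show i: "integrable lborel (\<lambda>\<xi>::'a. norm \<xi> powr \<gamma> * exp (- \<delta> * (norm \<xi>)\<^sup>2))"
      using assms by (intro integrable_powr_gauss) auto
    have le: "norm \<xi> powr \<gamma> * exp (- s * (norm \<xi>)\<^sup>2) \<le> norm \<xi> powr \<gamma> * exp (- \<delta> * (norm \<xi>)\<^sup>2)" for \<xi> :: 'a
      using assms by (intro mult_left_mono) (auto intro: mult_right_mono)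
    show "norm (exp (- \<i> * of_real (z \<bullet> \<xi>)) * complex_of_real (norm \<xi> powr \<gamma> * exp (- s * (norm \<xi>)\<^sup>2)))
      \<le> norm \<xi> powr \<gamma> * exp (- \<delta> * (norm \<xi>)\<^sup>2)" for \<xi>
      using le[of \<xi>] by (simp add: norm_mult)
    show "integrable lborel (\<lambda>\<xi>. norm (exp (- \<i> * of_real (z \<bullet> \<xi>)) * complex_of_real (norm \<xi> powr \<gamma> * exp (- s * (norm \<xi>)\<^sup>2))))"
      using assms by (intro integrable_norm Bochner_Integration.integrable_bound[OF integrable_powr_gauss[of s \<gamma>]])
        (auto simp: norm_mult)
  qed
  then show ?thesis
    unfolding frac_heat_def by (simp add: norm_divide norm_mult norm_power divide_right_mono)
qed

text \<open>Subordination: \<open>\<lambda>\<^sup>k\<close> is an average of \<open>1 - exp (- u \<lambda>)\<close>, so the Fourier transform is an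
  average of differences of heat kernels, whose \<open>L\<^sup>1\<close> norms are under control.\<close>

lemma frac_heat_L1:
  assumes "0 < \<delta>" "0 < \<gamma>" "\<gamma> < 2"
  obtains K where "\<And>s. \<delta> \<le> s \<Longrightarrow> (\<integral>\<^sup>+z. ennreal (norm (frac_heat \<gamma> s (z::'a::euclidean_space))) \<partial>lborel) \<le> ennreal K"
proof -
  define k where "k = \<gamma> / 2"
  have k: "0 < k" "k < 1" using assms by (auto simp: k_def)
  obtain I where I: "0 < I" and I': "\<And>l. 0 \<le> l \<Longrightarrow>
    (\<integral>\<^sup>+u. ennreal ((1 - exp (- u * l)) * u powr (- k - 1)) * indicator {0<..} u \<partial>lborel) = ennreal (I * l powr k)"
    using powr_conv_nn_integral[OF k] by blast
  define w where "w = (\<lambda>u::real. indicator {0<..} u * u powr (- k - 1))"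
  have w: "0 \<le> w u" for u by (simp add: w_def)
  have [measurable]: "w \<in> borel_measurable borel" unfolding w_def by measurable
  have I'': "(\<integral>\<^sup>+u. ennreal ((1 - exp (- u * l)) * w u) \<partial>lborel) = ennreal (I * l powr k)" if "0 \<le> l" for l
    unfolding I'[OF that, symmetric] w_def by (intro nn_integral_cong) (auto simp: indicator_def)
  have I3: "(LINT u|lborel. (1 - exp (- u * l)) * w u) = I * l powr k" if "0 \<le> l" for l
  proof -
    have "(LINT u|lborel. (1 - exp (- u * l)) * w u) = enn2real (\<integral>\<^sup>+u. ennreal ((1 - exp (- u * l)) * w u) \<partial>lborel)"
      using that by (intro integral_eq_nn_integral) (auto simp: w_def indicator_def)
    then show ?thesis unfolding I''[OF that] using I by simp
  qed
  have lk: "((norm \<xi>)\<^sup>2) powr k = norm \<xi> powr \<gamma>" for \<xi> :: 'a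
    by (cases "\<xi> = 0") (simp_all add: k_def powr_powr flip: powr_numeral)
  have rep: "of_real I * frac_heat \<gamma> s z = (LINT u|lborel. of_real (w u * (heat s z - heat (s + u) z)))"
    if s: "0 < s" for s and z :: 'a
  proof -
    define f where "f = (\<lambda>(\<xi>::'a) u. exp (- \<i> * of_real (z \<bullet> \<xi>)) * complex_of_real (exp (- s * (norm \<xi>)\<^sup>2) * ((1 - exp (- u * (norm \<xi>)\<^sup>2)) * w u)))"
    have [measurable]: "case_prod f \<in> borel_measurable (lborel \<Otimes>\<^sub>M lborel)"
      unfolding f_def by measurable
    have nf: "norm (f \<xi> u) = exp (- s * (norm \<xi>)\<^sup>2) * ((1 - exp (- u * (norm \<xi>)\<^sup>2)) * w u)" for \<xi> u
    proof -
      have "0 \<le> (1 - exp (- u * (norm \<xi>)\<^sup>2)) * w u"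
        by (cases "0 < u") (auto simp: w_def)
      then have "norm (complex_of_real (exp (- s * (norm \<xi>)\<^sup>2) * ((1 - exp (- u * (norm \<xi>)\<^sup>2)) * w u)))
        = exp (- s * (norm \<xi>)\<^sup>2) * ((1 - exp (- u * (norm \<xi>)\<^sup>2)) * w u)"
        unfolding norm_of_real by (intro abs_of_nonneg mult_nonneg_nonneg[OF exp_ge_zero])
      then show ?thesis unfolding f_def norm_mult by simp
    qed
    have "(\<integral>\<^sup>+\<xi>. \<integral>\<^sup>+u. ennreal (norm (f \<xi> u)) \<partial>lborel \<partial>lborel)
      = (\<integral>\<^sup>+\<xi>. ennreal (I * (norm (\<xi>::'a) powr \<gamma> * exp (- s * (norm \<xi>)\<^sup>2))) \<partial>lborel)"
    proof (intro nn_integral_cong)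
      fix \<xi> :: 'a
      show "(\<integral>\<^sup>+u. ennreal (norm (f \<xi> u)) \<partial>lborel) = ennreal (I * (norm \<xi> powr \<gamma> * exp (- s * (norm \<xi>)\<^sup>2)))"
        unfolding nf ennreal_mult'[OF exp_ge_zero]
        by (subst nn_integral_cmult)
           (simp_all only: I''[OF zero_le_power2] lk, auto simp: ennreal_mult''[symmetric] ennreal_mult'[symmetric] mult_ac)
    qed
    also have "\<dots> < \<infinity>"
      using integrable_powr_gauss[of s \<gamma>, where 'a = 'a] s assms I
      by (subst nn_integral_eq_integral) (auto intro!: integrable_mult_right)
    finally have "(LINT \<xi>|lborel. LINT u|lborel. f \<xi> u) = (LINT u|lborel. LINT \<xi>|lborel. f \<xi> u)"
      by (intro Fubini_lborel) auto
    moreover have "(LINT u|lborel. f \<xi> u)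
       = of_real I * (exp (- \<i> * of_real (z \<bullet> \<xi>)) * complex_of_real (norm \<xi> powr \<gamma> * exp (- s * (norm \<xi>)\<^sup>2)))" for \<xi>
      unfolding f_def integral_mult_right_zero integral_complex_of_real I3[OF zero_le_power2] lk
      by simp
    moreover have "(LINT \<xi>|lborel. f \<xi> u) = of_real ((2 * pi) ^ DIM('a)) * of_real (w u * (heat s z - heat (s + u) z))" for u
    proof (cases "0 < u")
      case True
      have "f \<xi> u = of_real (w u) * (exp (- \<i> * of_real (z \<bullet> \<xi>)) * complex_of_real (exp (- s * (norm \<xi>)\<^sup>2))
          - exp (- \<i> * of_real (z \<bullet> \<xi>)) * complex_of_real (exp (- (s + u) * (norm \<xi>)\<^sup>2)))" for \<xi>
      proof -
        have "exp (- (s + u) * (norm \<xi>)\<^sup>2) = exp (- s * (norm \<xi>)\<^sup>2) * exp (- u * (norm \<xi>)\<^sup>2)"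
          by (simp add: exp_add[symmetric] algebra_simps)
        then show ?thesis
          unfolding f_def by (simp only: of_real_mult of_real_diff of_real_1) (simp add: algebra_simps)
      qed
      moreover have su: "0 < s + u" using s True by simp
      ultimately have "(LINT \<xi>|lborel. f \<xi> u) = of_real (w u) * (of_real ((2 * pi) ^ DIM('a) * heat s z) - of_real ((2 * pi) ^ DIM('a) * heat (s + u) z))"
        by (simp only: integral_mult_right_zero fourier_gaussian(2)[OF s] fourier_gaussian(2)[OF su]
            Bochner_Integration.integral_diff[OF fourier_gaussian(1)[OF s] fourier_gaussian(1)[OF su]])
      also have "\<dots> = of_real ((2 * pi) ^ DIM('a)) * of_real (w u * (heat s z - heat (s + u) z))"
        by (simp add: algebra_simps)
      finally show ?thesis .
    qed (simp add: f_def w_def)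
    ultimately have "of_real I * (LINT \<xi>|lborel. exp (- \<i> * of_real (z \<bullet> \<xi>)) * complex_of_real (norm \<xi> powr \<gamma> * exp (- s * (norm \<xi>)\<^sup>2)))
      = of_real ((2 * pi) ^ DIM('a)) * (LINT u|lborel. of_real (w u * (heat s z - heat (s + u) z)))"
      by (simp del: mult_minus_left of_real_mult of_real_power)
    then show ?thesis
      unfolding frac_heat_def by (simp add: field_simps del: mult_minus_left of_real_mult)
  qed
  \<comment> \<open>The time \<open>s\<close> enters \<open>heat_diff_L1\<close> through
    \<open>u / s\<close> only, and is replaced there by its lower bound \<open>\<delta>\<close>.
    This makes \<open>K\<close> independent of \<open>s\<close>.\<close>
  define K where "K = (\<integral>\<^sup>+u. ennreal (w u * min 2 (real DIM('a) / \<delta> * u)) \<partial>lborel)"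
  have K: "K < \<infinity>"
  proof -
    have "K = (\<integral>\<^sup>+u. ennreal (min 2 (real DIM('a) / \<delta> * u) * u powr (- k - 1)) * indicator {0<..} u \<partial>lborel)"
      unfolding K_def w_def by (intro nn_integral_cong) (auto simp: indicator_def mult.commute)
    also have "\<dots> < \<infinity>" using nn_integral_min_powr_finite[OF k, of "real DIM('a) / \<delta>"] assms by simp
    finally show ?thesis .
  qed
  show thesis
  proof (rule that[of "enn2real (ennreal (1 / I) * K)"])
    fix s :: real assume "\<delta> \<le> s"
    then have s: "0 < s" using assms by simp
    have "(\<integral>\<^sup>+z. ennreal (norm (frac_heat \<gamma> s (z::'a))) \<partial>lborel)
      \<le> (\<integral>\<^sup>+z. ennreal (1 / I) * (\<integral>\<^sup>+u. ennreal (w u * \<bar>heat s (z::'a) - heat (s + u) z\<bar>) \<partial>lborel) \<partial>lborel)"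
    proof (intro nn_integral_mono)
      fix z :: 'a
      have "ennreal I * ennreal (norm (frac_heat \<gamma> s z)) = ennreal (norm (of_real I * frac_heat \<gamma> s z))"
        using I by (simp add: norm_mult ennreal_mult')
      also have "\<dots> \<le> (\<integral>\<^sup>+u. ennreal (norm (complex_of_real (w u * (heat s z - heat (s + u) z)))) \<partial>lborel)"
        unfolding rep[OF s] by (rule norm_integral_le_nn_integral)
      also have "\<dots> = (\<integral>\<^sup>+u. ennreal (w u * \<bar>heat s z - heat (s + u) z\<bar>) \<partial>lborel)"
        using w by (intro nn_integral_cong) (simp only: norm_of_real abs_mult abs_of_nonneg)
      finally have "ennreal (1 / I) * (ennreal I * ennreal (norm (frac_heat \<gamma> s z)))
         \<le> ennreal (1 / I) * (\<integral>\<^sup>+u. ennreal (w u * \<bar>heat s z - heat (s + u) z\<bar>) \<partial>lborel)"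
        by (rule mult_left_mono) simp
      then show "ennreal (norm (frac_heat \<gamma> s z)) \<le> ennreal (1 / I) * (\<integral>\<^sup>+u. ennreal (w u * \<bar>heat s z - heat (s + u) z\<bar>) \<partial>lborel)"
        using I by (simp add: ennreal_mult'[symmetric] mult.assoc[symmetric])
    qed
    also have "\<dots> = ennreal (1 / I) * (\<integral>\<^sup>+u. \<integral>\<^sup>+z. ennreal (w u * \<bar>heat s (z::'a) - heat (s + u) z\<bar>) \<partial>lborel \<partial>lborel)"
      by (subst nn_integral_cmult) (auto intro!: arg_cong2[where f = "(*)"] lborel_pair.Fubini')
    also have "\<dots> \<le> ennreal (1 / I) * K"
      unfolding K_def
    proof (intro mult_left_mono nn_integral_mono)
      fix u :: real
      show "(\<integral>\<^sup>+z. ennreal (w u * \<bar>heat s (z::'a) - heat (s + u) z\<bar>) \<partial>lborel) \<le> ennreal (w u * min 2 (real DIM('a) / \<delta> * u))"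
      proof (cases "0 < u")
        case True
        have "(\<integral>\<^sup>+z. ennreal (w u * \<bar>heat s (z::'a) - heat (s + u) z\<bar>) \<partial>lborel)
          = ennreal (w u) * (\<integral>\<^sup>+z. ennreal \<bar>heat s (z::'a) - heat (s + u) z\<bar> \<partial>lborel)"
          using w by (simp add: ennreal_mult' nn_integral_cmult)
        also have "\<dots> \<le> ennreal (w u) * ennreal (min 2 (real DIM('a) * u / s))"
          using s True by (intro mult_left_mono heat_diff_L1) auto
        also have "\<dots> \<le> ennreal (w u * min 2 (real DIM('a) / \<delta> * u))"
        proof -
          have "real DIM('a) * u / s \<le> real DIM('a) / \<delta> * u"
            using \<open>\<delta> \<le> s\<close> assms s True by (simp add: divide_left_mono)
          then show ?thesis
            using w True s by (subst ennreal_mult[symmetric]) (auto intro!: ennreal_leI mult_left_mono)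
        qed
        finally show ?thesis .
      qed (simp add: w_def)
    qed simp
    also have "\<dots> = ennreal (enn2real (ennreal (1 / I) * K))"
      using K by (simp add: ennreal_mult_less_top)
    finally show "(\<integral>\<^sup>+z. ennreal (norm (frac_heat \<gamma> s (z::'a))) \<partial>lborel) \<le> ennreal (enn2real (ennreal (1 / I) * K))" .
  qed
qed

text \<open>The kernel form of \<open>riesz_weight_laplace\<close>: on the Fourier side, integrating
  over \<open>s\<close> first leaves the difference of two Gaussians. The factor
  \<open>exp (- \<delta> * |\<xi>|^2)\<close> and the finite mass of the weight justify the exchange
  of the integrals.\<close>

lemma frac_heat_riesz:
  fixes z :: "'a::euclidean_space"
  assumes "0 < \<delta>" "0 < \<gamma>" "\<gamma> < 2" "0 < t"
  shows "(LINT s|lborel. of_real (riesz_weight (\<gamma> / 2) t s) * frac_heat \<gamma> (s + \<delta>) z)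
    = of_real (Gamma (\<gamma> / 2) * (heat \<delta> z - heat (t + \<delta>) z))"
proof -
  define k where "k = \<gamma> / 2"
  have k: "0 < k" "k < 1" using assms by (auto simp: k_def)
  have lk: "((norm \<xi>)\<^sup>2) powr k = norm \<xi> powr \<gamma>" for \<xi> :: 'a
    by (cases "\<xi> = 0") (simp_all add: k_def powr_powr flip: powr_numeral)
  define f where "f = (\<lambda>s (\<xi>::'a). exp (- \<i> * of_real (z \<bullet> \<xi>)) * complex_of_real (riesz_weight k t s * (norm \<xi> powr \<gamma> * exp (- (s + \<delta>) * (norm \<xi>)\<^sup>2))))"
  have [measurable]: "case_prod f \<in> borel_measurable (lborel \<Otimes>\<^sub>M lborel)"
    unfolding f_def by measurable
  have "(\<integral>\<^sup>+s. \<integral>\<^sup>+\<xi>. ennreal (norm (f s \<xi>)) \<partial>lborel \<partial>lborel)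
    \<le> (\<integral>\<^sup>+s. \<integral>\<^sup>+\<xi>. ennreal \<bar>riesz_weight k t s\<bar> * ennreal (norm \<xi> powr \<gamma> * exp (- \<delta> * (norm (\<xi>::'a))\<^sup>2)) \<partial>lborel \<partial>lborel)"
  proof (intro nn_integral_mono)
    fix s and \<xi> :: 'a
    have "norm (f s \<xi>) \<le> \<bar>riesz_weight k t s\<bar> * (norm \<xi> powr \<gamma> * exp (- \<delta> * (norm \<xi>)\<^sup>2))"
    proof (cases "0 < s")
      case True
      then have "exp (- (s + \<delta>) * (norm \<xi>)\<^sup>2) \<le> exp (- \<delta> * (norm \<xi>)\<^sup>2)"
        by (subst exp_le_cancel_iff, intro mult_right_mono) auto
      then show ?thesis
        unfolding f_def norm_mult norm_of_real abs_mult by (auto intro!: mult_left_mono simp del: mult_minus_left)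
    qed (use assms in \<open>simp add: f_def riesz_weight_nonpos\<close>)
    then show "ennreal (norm (f s \<xi>)) \<le> ennreal \<bar>riesz_weight k t s\<bar> * ennreal (norm \<xi> powr \<gamma> * exp (- \<delta> * (norm \<xi>)\<^sup>2))"
      by (subst ennreal_mult[symmetric]) (auto intro: ennreal_leI)
  qed
  also have "\<dots> = (\<integral>\<^sup>+s. ennreal \<bar>riesz_weight k t s\<bar> \<partial>lborel) * (\<integral>\<^sup>+\<xi>. ennreal (norm \<xi> powr \<gamma> * exp (- \<delta> * (norm (\<xi>::'a))\<^sup>2)) \<partial>lborel)"
    by (simp add: nn_integral_cmult nn_integral_multc del: mult_minus_left)
  also have "\<dots> < \<infinity>"
    using integrable_powr_gauss[of \<delta> \<gamma>, where 'a = 'a] assms k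
    by (subst nn_integral_eq_integral) (auto simp: nn_integral_riesz_weight ennreal_mult_less_top)
  finally have swap: "(LINT s|lborel. LINT \<xi>|lborel. f s \<xi>) = (LINT \<xi>|lborel. LINT s|lborel. f s \<xi>)"
    by (intro Fubini_lborel) auto
  have A: "(LINT \<xi>|lborel. f s \<xi>) = of_real ((2 * pi) ^ DIM('a)) * (of_real (riesz_weight k t s) * frac_heat \<gamma> (s + \<delta>) z)" for s
  proof -
    have "f s \<xi> = of_real (riesz_weight k t s) * (exp (- \<i> * of_real (z \<bullet> \<xi>)) * complex_of_real (norm \<xi> powr \<gamma> * exp (- (s + \<delta>) * (norm \<xi>)\<^sup>2)))" for \<xi>
      by (simp add: f_def)
    then have "(LINT \<xi>|lborel. f s \<xi>) = of_real (riesz_weight k t s) * (LINT \<xi>|lborel. exp (- \<i> * of_real (z \<bullet> \<xi>)) * complex_of_real (norm \<xi> powr \<gamma> * exp (- (s + \<delta>) * (norm \<xi>)\<^sup>2)))"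
      by (simp only: integral_mult_right_zero)
    then show ?thesis by (simp add: frac_heat_def)
  qed
  have B: "(LINT s|lborel. f s \<xi>) = of_real (Gamma k) * (exp (- \<i> * of_real (z \<bullet> \<xi>)) * complex_of_real (exp (- \<delta> * (norm \<xi>)\<^sup>2))
      - exp (- \<i> * of_real (z \<bullet> \<xi>)) * complex_of_real (exp (- (t + \<delta>) * (norm \<xi>)\<^sup>2)))" for \<xi>
  proof -
    define E where "E = exp (- \<i> * of_real (z \<bullet> \<xi>))"
    have "f s \<xi> = E * of_real (exp (- \<delta> * (norm \<xi>)\<^sup>2) * (norm \<xi> powr \<gamma> * (riesz_weight k t s * exp (- s * (norm \<xi>)\<^sup>2))))" for s
      by (simp add: f_def E_def exp_add[symmetric] algebra_simps flip: of_real_mult)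
    then have "(LINT s|lborel. f s \<xi>) = E * of_real (exp (- \<delta> * (norm \<xi>)\<^sup>2) * ((LINT s|lborel. riesz_weight k t s * exp (- s * (norm \<xi>)\<^sup>2)) * norm \<xi> powr \<gamma>))"
      by (simp only: integral_mult_right_zero integral_complex_of_real mult.commute)
    \<comment> \<open>The Laplace identity asks for a positive argument. At \<open>\<xi> = 0\<close>
      both sides are 0, the left one because \<open>0 powr \<gamma> = 0\<close>.\<close>
    also have "(LINT s|lborel. riesz_weight k t s * exp (- s * (norm \<xi>)\<^sup>2)) * norm \<xi> powr \<gamma> = Gamma k * (1 - exp (- t * (norm \<xi>)\<^sup>2))"
      using riesz_weight_laplace[of k "(norm \<xi>)\<^sup>2" t] k assms lk[of \<xi>] by (cases "\<xi> = 0") auto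
    finally have "(LINT s|lborel. f s \<xi>) = E * of_real (exp (- \<delta> * (norm \<xi>)\<^sup>2) * (Gamma k * (1 - exp (- t * (norm \<xi>)\<^sup>2))))" .
    moreover have "exp (- (t + \<delta>) * (norm \<xi>)\<^sup>2) = exp (- \<delta> * (norm \<xi>)\<^sup>2) * exp (- t * (norm \<xi>)\<^sup>2)"
      by (simp add: exp_add[symmetric] algebra_simps)
    ultimately show ?thesis
      unfolding E_def[symmetric] by (simp only: of_real_mult of_real_diff of_real_1) (simp add: algebra_simps)
  qed
  have t\<delta>: "0 < t + \<delta>" using assms by simp
  have "of_real ((2 * pi) ^ DIM('a)) * (LINT s|lborel. of_real (riesz_weight k t s) * frac_heat \<gamma> (s + \<delta>) z)
    = (LINT \<xi>|lborel. LINT s|lborel. f s \<xi>)"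
    unfolding swap[symmetric] A by (simp only: integral_mult_right_zero)
  also have "\<dots> = of_real (Gamma k) * (of_real ((2 * pi) ^ DIM('a) * heat \<delta> z) - of_real ((2 * pi) ^ DIM('a) * heat (t + \<delta>) z))"
    unfolding B integral_mult_right_zero
      Bochner_Integration.integral_diff[OF fourier_gaussian(1)[OF assms(1)] fourier_gaussian(1)[OF t\<delta>]]
      fourier_gaussian(2)[OF assms(1)] fourier_gaussian(2)[OF t\<delta>] ..
  also have "\<dots> = of_real ((2 * pi) ^ DIM('a)) * complex_of_real (Gamma k * (heat \<delta> z - heat (t + \<delta>) z))"
    by (simp add: algebra_simps)
  finally show ?thesis by (simp add: k_def)
qed

section \<open>Heat extensions of functions in Lebesgue spaces\<close>

definition heat_conv :: "real \<Rightarrow> ('a::euclidean_space \<Rightarrow> complex) \<Rightarrow> 'a \<Rightarrow> complex" where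
  "heat_conv s v y = (LINT x|lborel. v x * of_real (heat s (x - y)))"

lemma heat_conv_measurable [measurable (raw)]:
  assumes [measurable]: "v \<in> borel_measurable borel" "f \<in> borel_measurable M" "g \<in> borel_measurable M"
  shows "(\<lambda>x. heat_conv (f x) v (g x)) \<in> borel_measurable M"
  unfolding heat_conv_def by measurable

lemma nn_integral_heat_mult_le:
  fixes v :: "'a::euclidean_space \<Rightarrow> complex" and s :: real
  assumes [measurable]: "v \<in> borel_measurable borel" and "0 < s" "0 < L" "1 \<le> p"
  shows "(\<integral>\<^sup>+x. ennreal (norm (v x) * heat s (x - y)) \<partial>lborel)
    \<le> ennreal L + ennreal (L powr (1 - p) * s powr (- (real DIM('a) / 2))) * (\<integral>\<^sup>+x. ennreal (norm (v x) powr p) \<partial>lborel)"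
  using nn_integral_mult_le[of v "\<lambda>x. heat s (x - y)" "s powr (- (real DIM('a) / 2))" L p] heat_le[OF assms(2), where 'a = 'a] assms
  by (simp add: heat_nn_integral)

lemma integrable_heat_mult:
  fixes v :: "'a::euclidean_space \<Rightarrow> complex"
  assumes [measurable]: "v \<in> borel_measurable borel" and s: "0 < s" "1 \<le> p"
    and fin: "(\<integral>\<^sup>+x. ennreal (norm (v x) powr p) \<partial>lborel) < \<infinity>"
  shows "integrable lborel (\<lambda>x. v x * of_real (heat s (x - y)))"
proof (rule integrableI_bounded)
  have "(\<integral>\<^sup>+x. ennreal (norm (v x * of_real (heat s (x - y)))) \<partial>lborel)
      = (\<integral>\<^sup>+x. ennreal (norm (v x) * heat s (x - y)) \<partial>lborel)"
    by (simp add: norm_mult)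
  also have "\<dots> < \<infinity>"
    using le_less_trans[OF nn_integral_heat_mult_le[of v s 1 p y]] fin s
    by (simp add: ennreal_mult_less_top)
  finally show "(\<integral>\<^sup>+x. ennreal (norm (v x * of_real (heat s (x - y)))) \<partial>lborel) < \<infinity>" .
qed measurable

text \<open>\<open>frac_heat_riesz\<close> integrated against \<open>v\<close>. For all times from
  \<open>\<delta>\<close> on, the pairing of \<open>|v|\<close> with the kernels is at most one
  number \<open>M\<close>, and the weight has finite mass; so Fubini applies. The function
  \<open>g\<close> enters only at the end, when \<open>eq\<close> rewrites the inner integral at
  time \<open>s + \<delta>\<close>.\<close>

lemma heat_conv_diff_eq:
  fixes v g :: "'a::euclidean_space \<Rightarrow> complex"
  assumes [measurable]: "v \<in> borel_measurable borel"
    and fin: "(\<integral>\<^sup>+x. ennreal (norm (v x) powr p) \<partial>lborel) < \<infinity>"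
    and p: "1 \<le> p" and \<gamma>: "0 < \<gamma>" "\<gamma> < 2" and t: "0 < t" and \<delta>: "0 < \<delta>"
    and eq: "\<And>s. 0 < s \<Longrightarrow> heat_conv s g y = (LINT x|lborel. v x * frac_heat \<gamma> s (x - y))"
  shows "of_real (Gamma (\<gamma> / 2)) * (heat_conv \<delta> v y - heat_conv (t + \<delta>) v y)
    = (LINT s|lborel. of_real (riesz_weight (\<gamma> / 2) t s) * heat_conv (s + \<delta>) g y)"
proof -
  define B where "B = (LINT \<xi>::'a|lborel. norm \<xi> powr \<gamma> * exp (- \<delta> * (norm \<xi>)\<^sup>2)) / (2 * pi) ^ DIM('a)"
  have B: "norm (frac_heat \<gamma> s z) \<le> B" if "\<delta> \<le> s" for s and z :: 'a
    unfolding B_def using norm_frac_heat_le[of \<delta> s \<gamma> z] that \<gamma> \<delta> by simp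
  obtain K where K: "\<And>s. \<delta> \<le> s \<Longrightarrow> (\<integral>\<^sup>+z. ennreal (norm (frac_heat \<gamma> s (z::'a))) \<partial>lborel) \<le> ennreal K"
    using frac_heat_L1[OF \<delta> \<gamma>] by blast
  define M where "M = ennreal K + ennreal B * (\<integral>\<^sup>+x. ennreal (norm (v x) powr p) \<partial>lborel)"
  have M: "(\<integral>\<^sup>+x. ennreal (norm (v x) * norm (frac_heat \<gamma> s (x - y))) \<partial>lborel) \<le> M" if "\<delta> \<le> s" for s
  proof -
    have "(\<integral>\<^sup>+x. ennreal (norm (v x) * norm (frac_heat \<gamma> s (x - y))) \<partial>lborel)
      \<le> (\<integral>\<^sup>+x. ennreal (norm (frac_heat \<gamma> s (x - y))) \<partial>lborel) + ennreal B * (\<integral>\<^sup>+x. ennreal (norm (v x) powr p) \<partial>lborel)"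
      using nn_integral_mult_le[of v "\<lambda>x. norm (frac_heat \<gamma> s (x - y))" B 1 p] B[OF that] p by simp
    also have "\<dots> \<le> M"
      unfolding M_def using K[OF that] lborel_nn_integral_shift[of "\<lambda>x. ennreal (norm (frac_heat \<gamma> s x))" y]
      by (intro add_right_mono) simp
    finally show ?thesis .
  qed
  define k where "k = \<gamma> / 2"
  have k: "0 < k" "k < 1" using \<gamma> by (auto simp: k_def)
  define f where "f = (\<lambda>s x. of_real (riesz_weight k t s) * (v x * frac_heat \<gamma> (s + \<delta>) (x - y)))"
  have [measurable]: "case_prod f \<in> borel_measurable (lborel \<Otimes>\<^sub>M lborel)"
    unfolding f_def by measurable
  have "(\<integral>\<^sup>+s. \<integral>\<^sup>+x. ennreal (norm (f s x)) \<partial>lborel \<partial>lborel) \<le> (\<integral>\<^sup>+s. ennreal \<bar>riesz_weight k t s\<bar> * M \<partial>lborel)"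
  proof (intro nn_integral_mono)
    fix s
    show "(\<integral>\<^sup>+x. ennreal (norm (f s x)) \<partial>lborel) \<le> ennreal \<bar>riesz_weight k t s\<bar> * M"
    proof (cases "0 < s")
      case True
      have "(\<integral>\<^sup>+x. ennreal (norm (f s x)) \<partial>lborel)
        = ennreal \<bar>riesz_weight k t s\<bar> * (\<integral>\<^sup>+x. ennreal (norm (v x) * norm (frac_heat \<gamma> (s + \<delta>) (x - y))) \<partial>lborel)"
        by (simp add: f_def norm_mult ennreal_mult' nn_integral_cmult)
      also have "\<dots> \<le> ennreal \<bar>riesz_weight k t s\<bar> * M"
        using True by (intro mult_left_mono M) auto
      finally show ?thesis .
    qed (use t in \<open>simp add: f_def riesz_weight_nonpos\<close>)
  qed
  also have "\<dots> = ennreal (2 * t powr k / k) * M"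
    by (simp add: nn_integral_multc nn_integral_riesz_weight[OF t k])
  also have "\<dots> < \<infinity>"
    using fin by (simp add: M_def ennreal_mult_less_top)
  finally have "(LINT s|lborel. LINT x|lborel. f s x) = (LINT x|lborel. LINT s|lborel. f s x)"
    by (intro Fubini_lborel) auto
  moreover have "(LINT x|lborel. f s x) = of_real (riesz_weight k t s) * heat_conv (s + \<delta>) g y" for s
  proof (cases "0 < s")
    case True
    then show ?thesis using \<delta> unfolding f_def by (simp add: eq)
  qed (use t in \<open>simp add: f_def riesz_weight_nonpos\<close>)
  moreover have "(LINT s|lborel. f s x)
      = of_real (Gamma k) * (v x * of_real (heat \<delta> (x - y)) - v x * of_real (heat (t + \<delta>) (x - y)))" for x
  proof -
    have "(LINT s|lborel. f s x) = (LINT s|lborel. v x * (of_real (riesz_weight k t s) * frac_heat \<gamma> (s + \<delta>) (x - y)))"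
      by (simp add: f_def mult_ac)
    also have "\<dots> = v x * of_real (Gamma k * (heat \<delta> (x - y) - heat (t + \<delta>) (x - y)))"
      using frac_heat_riesz[OF \<delta> \<gamma> t, of "x - y"] by (simp only: integral_mult_right_zero k_def)
    finally show ?thesis by (simp add: algebra_simps)
  qed
  moreover have "(LINT x|lborel. of_real (Gamma k) * (v x * of_real (heat \<delta> (x - y)) - v x * of_real (heat (t + \<delta>) (x - y))))
      = of_real (Gamma k) * (heat_conv \<delta> v y - heat_conv (t + \<delta>) v y)"
    unfolding heat_conv_def integral_mult_right_zero
    using \<delta> t p fin by (subst Bochner_Integration.integral_diff) (auto intro!: integrable_heat_mult)
  ultimately show ?thesis by (simp only: k_def)
qed

lemma norm_heat_conv_le:
  fixes v :: "'a::euclidean_space \<Rightarrow> complex"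
  assumes [measurable]: "v \<in> borel_measurable borel" and "0 < s" "0 < V" "1 \<le> p"
    and V: "(\<integral>\<^sup>+x. ennreal (norm (v x) powr p) \<partial>lborel) \<le> ennreal (V powr p)"
  shows "norm (heat_conv s v y) \<le> 2 * s powr (- (real DIM('a) / 2) / p) * V"
proof -
  \<comment> \<open>The choice that makes the two terms of the elementary bound equal; hence the
    factor 2 in place of the sharp constant from Hoelder's inequality.\<close>
  define L where "L = s powr (- (real DIM('a) / 2) / p) * V"
  have L: "0 < L" using assms by (simp add: L_def)
  have Lp: "L powr p = s powr (- (real DIM('a) / 2)) * V powr p"
    using assms by (simp add: L_def powr_mult powr_powr)
  have "ennreal (norm (heat_conv s v y)) \<le> (\<integral>\<^sup>+x. ennreal (norm (v x) * heat s (x - y)) \<partial>lborel)"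
    unfolding heat_conv_def by (rule order_trans[OF norm_integral_le_nn_integral]) (simp add: norm_mult)
  also have "\<dots> \<le> ennreal L + ennreal (L powr (1 - p) * s powr (- (real DIM('a) / 2))) * (\<integral>\<^sup>+x. ennreal (norm (v x) powr p) \<partial>lborel)"
    using assms L by (intro nn_integral_heat_mult_le) auto
  also have "\<dots> \<le> ennreal L + ennreal (L powr (1 - p) * s powr (- (real DIM('a) / 2))) * ennreal (V powr p)"
    using V by (intro add_left_mono mult_left_mono) auto
  also have "\<dots> = ennreal (L + L powr (1 - p) * L powr p)"
    using L by (simp add: Lp ennreal_mult'[symmetric] mult_ac flip: ennreal_plus)
  also have "L + L powr (1 - p) * L powr p = 2 * L"
    using L by (simp add: powr_add[symmetric])
  finally show ?thesis using L by (simp add: L_def)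
qed

text \<open>The version for nonnegative extended functions, for which Tonelli's theorem applies
  without any integrability to check.\<close>

definition nn_heat_conv :: "real \<Rightarrow> ('a::euclidean_space \<Rightarrow> ennreal) \<Rightarrow> 'a \<Rightarrow> ennreal" where
  "nn_heat_conv s w y = (\<integral>\<^sup>+x. w x * ennreal (heat s (x - y)) \<partial>lborel)"

lemma nn_heat_conv_measurable [measurable (raw)]:
  assumes [measurable]: "v \<in> borel_measurable borel" "f \<in> borel_measurable M" "g \<in> borel_measurable M"
  shows "(\<lambda>x. nn_heat_conv (f x) v (g x)) \<in> borel_measurable M"
  unfolding nn_heat_conv_def by measurable

lemma nn_heat_conv_le:
  fixes w :: "'a::euclidean_space \<Rightarrow> ennreal"
  assumes [measurable]: "w \<in> borel_measurable borel" and "0 < s"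
  shows "nn_heat_conv s w y \<le> ennreal (s powr (- (real DIM('a) / 2))) * (\<integral>\<^sup>+x. w x \<partial>lborel)"
proof -
  have "nn_heat_conv s w y \<le> (\<integral>\<^sup>+x. w x * ennreal (s powr (- (real DIM('a) / 2))) \<partial>lborel)"
    unfolding nn_heat_conv_def using assms by (intro nn_integral_mono mult_left_mono ennreal_leI heat_le) auto
  then show ?thesis by (simp add: nn_integral_multc mult.commute)
qed

lemma nn_integral_nn_heat_conv:
  fixes w :: "'a::euclidean_space \<Rightarrow> ennreal"
  assumes [measurable]: "w \<in> borel_measurable borel" and "0 < s"
  shows "(\<integral>\<^sup>+y. nn_heat_conv s w y \<partial>lborel) = (\<integral>\<^sup>+x. w x \<partial>lborel)"
proof -
  have "(\<integral>\<^sup>+y. nn_heat_conv s w y \<partial>lborel) = (\<integral>\<^sup>+x. \<integral>\<^sup>+y. w x * ennreal (heat s (x - y)) \<partial>lborel \<partial>lborel)"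
    unfolding nn_heat_conv_def by (rule lborel_pair.Fubini') measurable
  also have "\<dots> = (\<integral>\<^sup>+x. w x \<partial>lborel)"
    using assms by (simp add: nn_integral_cmult heat_nn_integral)
  finally show ?thesis .
qed

section \<open>Integrating level set bounds\<close>

text \<open>The integration step of the Marcinkiewicz theorem. After Tonelli's theorem the inner
  integral runs over those levels \<open>l\<close> at which the point still counts as one where
  \<open>h\<close> is large. It converges at \<open>l = 0\<close> because \<open>d < q\<close>, and
  contributes the extra power \<open>(q - d) / b\<close> of \<open>h\<close>.\<close>

lemma layer_cake_bound:
  fixes f h :: "'a::euclidean_space \<Rightarrow> real"
  assumes [measurable]: "f \<in> borel_measurable borel" "h \<in> borel_measurable borel"
    and nonneg: "\<And>x. 0 \<le> f x" "\<And>x. 0 \<le> h x"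
    and AB: "0 \<le> A" "0 < B" "0 < b" "d < q" "0 < q"
    and le: "\<And>l. 0 < l \<Longrightarrow> emeasure lborel {x. l < f x}
      \<le> ennreal (A * l powr (- d)) * (\<integral>\<^sup>+x. ennreal (h x) * indicator {x. B * l powr b < h x} x \<partial>lborel)"
  shows "(\<integral>\<^sup>+x. ennreal (f x powr q) \<partial>lborel)
    \<le> ennreal (q * A / (q - d) * B powr (- (q - d) / b)) * (\<integral>\<^sup>+x. ennreal (h x powr (1 + (q - d) / b)) \<partial>lborel)"
proof -
  have fq: "ennreal (f x powr q) = (\<integral>\<^sup>+l. ennreal (q * l powr (q - 1)) * indicator {0<..} l * indicator {x. l < f x} x \<partial>lborel)" for x
  proof (cases "f x = 0")
    case False
    then have "0 < f x" using nonneg by (simp add: order_less_le)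
    have "(\<integral>\<^sup>+l. ennreal (q * l powr (q - 1)) * indicator {0<..} l * indicator {x. l < f x} x \<partial>lborel)
       = (\<integral>\<^sup>+l. ennreal q * (ennreal (l powr (q - 1)) * indicator {0<..<f x} l) \<partial>lborel)"
      using AB by (intro nn_integral_cong) (auto simp: indicator_def ennreal_mult')
    also have "\<dots> = ennreal (f x powr q)"
      using nn_integral_powr_Ioo[OF \<open>0 < f x\<close> \<open>0 < q\<close>] AB by (simp add: nn_integral_cmult ennreal_mult'[symmetric])
    finally show ?thesis by simp
  next
    case True
    have "(\<lambda>l. ennreal (q * l powr (q - 1)) * indicator {0<..} l * indicator {x. l < f x} x) = (\<lambda>l. 0)"
      using True by (auto simp: indicator_def fun_eq_iff)
    then show ?thesis using True AB by simp
  qed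
  have "(\<integral>\<^sup>+x. ennreal (f x powr q) \<partial>lborel)
     = (\<integral>\<^sup>+l. \<integral>\<^sup>+x. ennreal (q * l powr (q - 1)) * indicator {0<..} l * indicator {x. l < f x} x \<partial>lborel \<partial>lborel)"
    unfolding fq by (rule lborel_pair.Fubini') measurable
  also have "\<dots> = (\<integral>\<^sup>+l. ennreal (q * l powr (q - 1)) * indicator {0<..} l * emeasure lborel {x. l < f x} \<partial>lborel)"
    by (subst nn_integral_cmult_indicator) auto
  also have "\<dots> \<le> (\<integral>\<^sup>+l. \<integral>\<^sup>+x. ennreal (q * A * l powr ((q - d) - 1)) * indicator {0<..} l * (ennreal (h x) * indicator {x. B * l powr b < h x} x) \<partial>lborel \<partial>lborel)"
  proof (intro nn_integral_mono)
    fix l :: real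
    show "ennreal (q * l powr (q - 1)) * indicator {0<..} l * emeasure lborel {x. l < f x}
      \<le> (\<integral>\<^sup>+x. ennreal (q * A * l powr ((q - d) - 1)) * indicator {0<..} l * (ennreal (h x) * indicator {x. B * l powr b < h x} x) \<partial>lborel)"
    proof (cases "0 < l")
      case True
      have "ennreal (q * l powr (q - 1)) * emeasure lborel {x. l < f x}
        \<le> ennreal (q * l powr (q - 1)) * (ennreal (A * l powr (- d)) * (\<integral>\<^sup>+x. ennreal (h x) * indicator {x. B * l powr b < h x} x \<partial>lborel))"
        by (intro mult_left_mono le True) auto
      also have "ennreal (q * l powr (q - 1)) * (ennreal (A * l powr (- d)) * (\<integral>\<^sup>+x. ennreal (h x) * indicator {x. B * l powr b < h x} x \<partial>lborel))
        = ennreal (q * A * (l powr (q - 1) * l powr (- d))) * (\<integral>\<^sup>+x. ennreal (h x) * indicator {x. B * l powr b < h x} x \<partial>lborel)"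
        using AB by (simp add: ennreal_mult'[symmetric] mult.assoc[symmetric] ) (simp add: mult_ac)
      also have "l powr (q - 1) * l powr (- d) = l powr ((q - d) - 1)"
        by (simp add: powr_add[symmetric] algebra_simps)
      finally show ?thesis using True by (simp add: nn_integral_cmult)
    qed simp
  qed
  also have "\<dots> = (\<integral>\<^sup>+x. \<integral>\<^sup>+l. ennreal (q * A * l powr ((q - d) - 1)) * indicator {0<..} l * (ennreal (h x) * indicator {x. B * l powr b < h x} x) \<partial>lborel \<partial>lborel)"
    by (rule lborel_pair.Fubini') measurable
  also have "\<dots> = (\<integral>\<^sup>+x. ennreal (q * A / (q - d) * B powr (- (q - d) / b)) * ennreal (h x powr (1 + (q - d) / b)) \<partial>lborel)"
  proof (intro nn_integral_cong)
    fix x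
    show "(\<integral>\<^sup>+l. ennreal (q * A * l powr ((q - d) - 1)) * indicator {0<..} l * (ennreal (h x) * indicator {x. B * l powr b < h x} x) \<partial>lborel)
      = ennreal (q * A / (q - d) * B powr (- (q - d) / b)) * ennreal (h x powr (1 + (q - d) / b))"
    proof (cases "h x = 0")
      case False
      then have h: "0 < h x" using nonneg by (simp add: order_less_le)
      \<comment> \<open>The level at which \<open>B * l powr b\<close> reaches \<open>h x\<close>;
        the condition on the set becomes an upper limit for \<open>l\<close>.\<close>
      define \<Lambda> where "\<Lambda> = (h x / B) powr (1 / b)"
      have \<Lambda>: "0 < \<Lambda>" using h AB by (simp add: \<Lambda>_def)
      have iff: "B * l powr b < h x \<longleftrightarrow> l < \<Lambda>" if "0 < l" for l
      proof -
        have "B * l powr b < h x \<longleftrightarrow> l powr b < h x / B"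
          using AB by (simp add: field_simps)
        also have "h x / B = \<Lambda> powr b" using AB h by (simp add: \<Lambda>_def powr_powr)
        also have "l powr b < \<Lambda> powr b \<longleftrightarrow> l < \<Lambda>"
          using AB that \<Lambda> by (auto simp: powr_less_mono2 not_less[symmetric] dest: powr_mono2[rotated 2, of _ _ b])
            (meson AB(3) \<Lambda> less_le_not_le linorder_not_less powr_mono2)
        finally show ?thesis .
      qed
      have "(\<integral>\<^sup>+l. ennreal (q * A * l powr ((q - d) - 1)) * indicator {0<..} l * (ennreal (h x) * indicator {x. B * l powr b < h x} x) \<partial>lborel)
        = (\<integral>\<^sup>+l. ennreal (q * A * h x) * (ennreal (l powr ((q - d) - 1)) * indicator {0<..<\<Lambda>} l) \<partial>lborel)"
        using AB h by (intro nn_integral_cong) (auto simp: indicator_def iff ennreal_mult'[symmetric] ennreal_mult''[symmetric] mult_ac)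
      also have "\<dots> = ennreal (q * A * h x * (\<Lambda> powr (q - d) / (q - d)))"
        using nn_integral_powr_Ioo[OF \<Lambda>, of "q - d"] AB h by (simp add: nn_integral_cmult ennreal_mult'[symmetric])
      also have "\<Lambda> powr (q - d) = B powr (- (q - d) / b) * h x powr ((q - d) / b)"
      proof -
        have "\<Lambda> powr (q - d) = (h x / B) powr ((q - d) / b)"
          using AB h by (simp add: \<Lambda>_def powr_powr)
        also have "\<dots> = B powr (- ((q - d) / b)) * h x powr ((q - d) / b)"
          using AB h by (simp only: powr_minus powr_divide) (simp add: field_simps)
        finally show ?thesis by (simp only: minus_divide_left)
      qed
      also have "q * A * h x * (B powr (- (q - d) / b) * h x powr ((q - d) / b) / (q - d))
         = (q * A / (q - d) * B powr (- (q - d) / b)) * h x powr (1 + (q - d) / b)"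
        using h by (simp add: powr_add)
      finally show ?thesis using AB by (simp add: ennreal_mult'[symmetric] ennreal_mult''[symmetric])
    qed simp
  qed
  also have "\<dots> = ennreal (q * A / (q - d) * B powr (- (q - d) / b)) * (\<integral>\<^sup>+x. ennreal (h x powr (1 + (q - d) / b)) \<partial>lborel)"
    by (rule nn_integral_cmult) measurable
  finally show ?thesis .
qed

section \<open>Level sets of the heat extension\<close>

text \<open>What remains of the layer cake constant after all powers of \<open>V\<close> and
  \<open>G\<close> are split off. The first factor comes from \<open>layer_cake_bound\<close>, the
  second from the Markov step, the third from the choice of the time cut \<open>T\<close>, and the
  last from the height of the truncation of \<open>g\<close>.\<close>

definition gn_const :: "real \<Rightarrow> real \<Rightarrow> real \<Rightarrow> real \<Rightarrow> real \<Rightarrow> real \<Rightarrow> real" where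
  "gn_const k n r a w q = q / ((1 + a) * (r - 1)) * (8 / (k * Gamma k))
     * (4 * (1 / (n - k) + 1 / k) / Gamma k) powr w * (k * Gamma k / 8) powr ((1 - r) * (1 + w))"

text \<open>\<open>V\<close> and \<open>G\<close> are positive upper bounds for the norms, which
  keeps vanishing norms out of the estimates. The functions \<open>v\<close> and \<open>g\<close>
  are linked only through \<open>representation\<close>.\<close>

locale heat_pair =
  fixes v g :: "'a::euclidean_space \<Rightarrow> complex" and p r k V G \<delta> :: real
  assumes v_measurable [measurable]: "v \<in> borel_measurable borel"
    and g_measurable [measurable]: "g \<in> borel_measurable borel"
    and p: "1 \<le> p" and r: "1 < r" and k: "0 < k" "k < 1" "k < real DIM('a) / 2"
    and V: "0 < V" "(\<integral>\<^sup>+x. ennreal (norm (v x) powr p) \<partial>lborel) \<le> ennreal (V powr p)"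
    and G: "0 < G" "(\<integral>\<^sup>+x. ennreal (norm (g x) powr r) \<partial>lborel) \<le> ennreal (G powr r)"
    and \<delta>: "0 < \<delta>"
    and representation: "\<And>t y. 0 < t \<Longrightarrow> of_real (Gamma k) * (heat_conv \<delta> v y - heat_conv (t + \<delta>) v y)
      = (LINT s|lborel. of_real (riesz_weight k t s) * heat_conv (s + \<delta>) g y)"
begin

text \<open>On the set where \<open>g\<close> exceeds the height, all of \<open>|g|\<close> is kept
  and not just the excess over \<open>\<mu>\<close>; this is the shape of the right side in
  \<open>layer_cake_bound\<close>.\<close>

definition tail :: "real \<Rightarrow> 'a \<Rightarrow> ennreal" where
  "tail \<mu> x = ennreal (norm (g x)) * indicator {x. \<mu> < norm (g x)} x"

lemma tail_measurable [measurable]: "tail \<mu> \<in> borel_measurable borel"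
  unfolding tail_def by measurable

lemma Gamma_k: "0 < Gamma k"
  using k by (intro Gamma_real_pos) auto

text \<open>Where \<open>|g| > \<mu>\<close>, the factor \<open>|g| powr (1 - r)\<close> is at most
  \<open>\<mu> powr (1 - r)\<close>, because \<open>r > 1\<close>.\<close>

lemma nn_integral_tail_le:
  assumes "0 < \<mu>"
  shows "(\<integral>\<^sup>+x. tail \<mu> x \<partial>lborel) \<le> ennreal (\<mu> powr (1 - r) * G powr r)"
proof -
  have "(\<integral>\<^sup>+x. tail \<mu> x \<partial>lborel) \<le> (\<integral>\<^sup>+x. ennreal (\<mu> powr (1 - r)) * ennreal (norm (g x) powr r) \<partial>lborel)"
  proof (intro nn_integral_mono)
    fix x
    show "tail \<mu> x \<le> ennreal (\<mu> powr (1 - r)) * ennreal (norm (g x) powr r)"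
    proof (cases "\<mu> < norm (g x)")
      case True
      then have "norm (g x) powr (1 - r) * norm (g x) powr r \<le> \<mu> powr (1 - r) * norm (g x) powr r"
        using assms r by (intro mult_right_mono powr_mono2') auto
      moreover have "norm (g x) powr (1 - r) * norm (g x) powr r = norm (g x)"
        using True assms by (simp add: powr_add[symmetric])
      ultimately show ?thesis
        using True by (simp add: tail_def ennreal_mult'[symmetric] ennreal_leI)
    qed (simp add: tail_def)
  qed
  also have "\<dots> \<le> ennreal (\<mu> powr (1 - r)) * ennreal (G powr r)"
    using G by (auto simp: nn_integral_cmult intro: mult_left_mono)
  finally show ?thesis by (simp add: ennreal_mult'[symmetric])
qed

lemma norm_heat_conv_g_le:
  assumes "0 < s" "0 \<le> \<mu>"
  shows "ennreal (norm (heat_conv s g y)) \<le> ennreal \<mu> + nn_heat_conv s (tail \<mu>) y"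
proof -
  have "ennreal (norm (heat_conv s g y)) \<le> (\<integral>\<^sup>+x. ennreal (norm (g x)) * ennreal (heat s (x - y)) \<partial>lborel)"
    unfolding heat_conv_def by (rule order_trans[OF norm_integral_le_nn_integral]) (simp add: norm_mult ennreal_mult')
  also have "\<dots> \<le> (\<integral>\<^sup>+x. ennreal \<mu> * ennreal (heat s (x - y)) + tail \<mu> x * ennreal (heat s (x - y)) \<partial>lborel)"
    unfolding distrib_right[symmetric]
    using assms by (intro nn_integral_mono mult_right_mono) (auto simp: tail_def indicator_def intro!: ennreal_leI)
  also have "\<dots> = ennreal \<mu> + nn_heat_conv s (tail \<mu>) y"
    by (subst nn_integral_add) (auto simp: nn_integral_cmult heat_nn_integral[OF assms(1)] nn_heat_conv_def)
  finally show ?thesis .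
qed

lemma norm_heat_conv_v_le:
  assumes t: "0 < t" and \<mu>: "0 \<le> \<mu>"
  shows "ennreal (norm (heat_conv \<delta> v y)) \<le> ennreal (2 * t powr (- (real DIM('a) / 2) / p) * V)
    + ennreal (1 / Gamma k) * (ennreal (\<mu> * (2 * t powr k / k))
      + (\<integral>\<^sup>+s. ennreal \<bar>riesz_weight k t s\<bar> * nn_heat_conv (s + \<delta>) (tail \<mu>) y \<partial>lborel))"
proof -
  have "ennreal (Gamma k * norm (heat_conv \<delta> v y - heat_conv (t + \<delta>) v y))
    = ennreal (norm (LINT s|lborel. of_real (riesz_weight k t s) * heat_conv (s + \<delta>) g y))"
    using Gamma_k unfolding representation[OF t, symmetric] by (simp add: norm_mult)
  also have "\<dots> \<le> (\<integral>\<^sup>+s. ennreal \<bar>riesz_weight k t s\<bar> * ennreal (norm (heat_conv (s + \<delta>) g y)) \<partial>lborel)"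
    by (rule order_trans[OF norm_integral_le_nn_integral]) (simp add: norm_mult ennreal_mult')
  also have "\<dots> \<le> (\<integral>\<^sup>+s. ennreal \<bar>riesz_weight k t s\<bar> * ennreal \<mu> + ennreal \<bar>riesz_weight k t s\<bar> * nn_heat_conv (s + \<delta>) (tail \<mu>) y \<partial>lborel)"
    unfolding distrib_left[symmetric]
  proof (intro nn_integral_mono)
    fix s
    show "ennreal \<bar>riesz_weight k t s\<bar> * ennreal (norm (heat_conv (s + \<delta>) g y))
       \<le> ennreal \<bar>riesz_weight k t s\<bar> * (ennreal \<mu> + nn_heat_conv (s + \<delta>) (tail \<mu>) y)"
      using norm_heat_conv_g_le[of "s + \<delta>" \<mu> y] \<delta> \<mu> riesz_weight_nonpos[of s t k] t
      by (cases "0 < s") (auto intro: mult_left_mono)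
  qed
  also have "\<dots> = ennreal (\<mu> * (2 * t powr k / k))
      + (\<integral>\<^sup>+s. ennreal \<bar>riesz_weight k t s\<bar> * nn_heat_conv (s + \<delta>) (tail \<mu>) y \<partial>lborel)"
  proof -
    have "(\<integral>\<^sup>+s. ennreal \<bar>riesz_weight k t s\<bar> * ennreal \<mu> \<partial>lborel) = ennreal (2 * t powr k / k) * ennreal \<mu>"
      using t k by (simp only: nn_integral_riesz_weight[symmetric]) (rule nn_integral_multc, measurable)
    also have "\<dots> = ennreal (\<mu> * (2 * t powr k / k))"
      using \<mu> by (simp add: ennreal_mult' mult.commute flip: times_divide_eq_right)
    finally show ?thesis by (subst nn_integral_add) auto
  qed
  finally have *: "ennreal (Gamma k * norm (heat_conv \<delta> v y - heat_conv (t + \<delta>) v y)) \<le> \<dots>" .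
  have "ennreal (norm (heat_conv \<delta> v y - heat_conv (t + \<delta>) v y))
     = ennreal (1 / Gamma k) * ennreal (Gamma k * norm (heat_conv \<delta> v y - heat_conv (t + \<delta>) v y))"
    using Gamma_k by (simp add: ennreal_mult'[symmetric])
  also have "\<dots> \<le> ennreal (1 / Gamma k) * (ennreal (\<mu> * (2 * t powr k / k))
      + (\<integral>\<^sup>+s. ennreal \<bar>riesz_weight k t s\<bar> * nn_heat_conv (s + \<delta>) (tail \<mu>) y \<partial>lborel))"
    by (intro mult_left_mono *) simp
  finally have 1: "ennreal (norm (heat_conv \<delta> v y - heat_conv (t + \<delta>) v y)) \<le> \<dots>" .
  have "norm (heat_conv (t + \<delta>) v y) \<le> 2 * (t + \<delta>) powr (- (real DIM('a) / 2) / p) * V"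
    using t \<delta> V p by (intro norm_heat_conv_le) auto
  \<comment> \<open>Passing from \<open>t + \<delta>\<close> to \<open>t\<close> keeps the bound,
    and every constant derived from it, independent of \<open>\<delta>\<close>.\<close>
  also have "\<dots> \<le> 2 * t powr (- (real DIM('a) / 2) / p) * V"
    using t \<delta> V p by (intro mult_right_mono mult_left_mono powr_mono2') (auto simp: divide_nonpos_pos)
  finally have 2: "norm (heat_conv (t + \<delta>) v y) \<le> 2 * t powr (- (real DIM('a) / 2) / p) * V" .
  have "norm (heat_conv \<delta> v y) \<le> norm (heat_conv (t + \<delta>) v y) + norm (heat_conv \<delta> v y - heat_conv (t + \<delta>) v y)"
    by (metis norm_triangle_sub)
  then have "ennreal (norm (heat_conv \<delta> v y)) \<le> ennreal (norm (heat_conv (t + \<delta>) v y)) + ennreal (norm (heat_conv \<delta> v y - heat_conv (t + \<delta>) v y))"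
    by (simp add: ennreal_leI flip: ennreal_plus)
  also have "\<dots> \<le> ennreal (2 * t powr (- (real DIM('a) / 2) / p) * V) + ennreal (1 / Gamma k) * (ennreal (\<mu> * (2 * t powr k / k))
      + (\<integral>\<^sup>+s. ennreal \<bar>riesz_weight k t s\<bar> * nn_heat_conv (s + \<delta>) (tail \<mu>) y \<partial>lborel))"
    by (intro add_mono 1 ennreal_leI 2)
  finally show ?thesis .
qed

text \<open>The level \<open>l\<close> is shared out in quarters. The late value, the bounded part
  of \<open>g\<close>, and the tail over times outside \<open>A\<close> each take at most one, so
  wherever \<open>|U| > l\<close> the tail over times in \<open>A\<close> must exceed the last
  quarter. Markov's inequality bounds the measure of that set; the heat flow preserves mass, so only
  the mass of the weight on \<open>A\<close> and the mass of the tail remain.\<close>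

lemma emeasure_level_set_le:
  assumes t: "0 < t" and \<mu>: "0 \<le> \<mu>" and l: "0 < l" and [measurable]: "A \<in> sets borel"
    and 1: "2 * t powr (- (real DIM('a) / 2) / p) * V \<le> l / 4"
    and 2: "\<mu> * (2 * t powr k / k) / Gamma k \<le> l / 4"
    and 3: "\<And>y. (\<integral>\<^sup>+s. ennreal \<bar>riesz_weight k t s\<bar> * nn_heat_conv (s + \<delta>) (tail \<mu>) y * indicator (- A) s \<partial>lborel) \<le> ennreal (Gamma k * l / 4)"
  shows "emeasure lborel {y. l < norm (heat_conv \<delta> v y)}
    \<le> ennreal (4 / (Gamma k * l)) * ((\<integral>\<^sup>+s. ennreal \<bar>riesz_weight k t s\<bar> * indicator A s \<partial>lborel) * (\<integral>\<^sup>+x. tail \<mu> x \<partial>lborel))"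
proof -
  define \<Phi> where "\<Phi> = (\<lambda>y. \<integral>\<^sup>+s. ennreal \<bar>riesz_weight k t s\<bar> * nn_heat_conv (s + \<delta>) (tail \<mu>) y * indicator A s \<partial>lborel)"
  have [measurable]: "\<Phi> \<in> borel_measurable borel" unfolding \<Phi>_def by measurable
  have "1 \<le> ennreal (4 / (Gamma k * l)) * \<Phi> y" if "l < norm (heat_conv \<delta> v y)" for y
  proof (rule ccontr)
    assume "\<not> 1 \<le> ennreal (4 / (Gamma k * l)) * \<Phi> y"
    then have less: "ennreal (4 / (Gamma k * l)) * \<Phi> y < 1" by simp
    have "\<Phi> y = ennreal (Gamma k * l / 4) * (ennreal (4 / (Gamma k * l)) * \<Phi> y)"
      using Gamma_k l by (simp add: ennreal_mult'[symmetric] mult.assoc[symmetric])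
    also have "\<dots> \<le> ennreal (Gamma k * l / 4) * 1"
      using less by (intro mult_left_mono) auto
    finally have \<Phi>: "\<Phi> y \<le> ennreal (Gamma k * l / 4)" by simp
    have "(\<integral>\<^sup>+s. ennreal \<bar>riesz_weight k t s\<bar> * nn_heat_conv (s + \<delta>) (tail \<mu>) y \<partial>lborel)
       = (\<integral>\<^sup>+s. ennreal \<bar>riesz_weight k t s\<bar> * nn_heat_conv (s + \<delta>) (tail \<mu>) y * indicator A s
          + ennreal \<bar>riesz_weight k t s\<bar> * nn_heat_conv (s + \<delta>) (tail \<mu>) y * indicator (- A) s \<partial>lborel)"
      by (intro nn_integral_cong) (auto simp: indicator_def)
    also have "\<dots> = \<Phi> y + (\<integral>\<^sup>+s. ennreal \<bar>riesz_weight k t s\<bar> * nn_heat_conv (s + \<delta>) (tail \<mu>) y * indicator (- A) s \<partial>lborel)"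
      unfolding \<Phi>_def by (rule nn_integral_add) auto
    also have "\<dots> \<le> ennreal (Gamma k * l / 4) + ennreal (Gamma k * l / 4)"
      by (intro add_mono \<Phi> 3)
    finally have "ennreal (norm (heat_conv \<delta> v y)) \<le> ennreal (2 * t powr (- (real DIM('a) / 2) / p) * V)
      + ennreal (1 / Gamma k) * (ennreal (\<mu> * (2 * t powr k / k)) + (ennreal (Gamma k * l / 4) + ennreal (Gamma k * l / 4)))"
      using norm_heat_conv_v_le[OF t \<mu>, of y] by (auto elim!: order_trans intro!: add_left_mono mult_left_mono)
    also have "\<dots> = ennreal (2 * t powr (- (real DIM('a) / 2) / p) * V + 1 / Gamma k * (\<mu> * (2 * t powr k / k) + (Gamma k * l / 4 + Gamma k * l / 4)))"
      using Gamma_k l \<mu> k V by (simp add: ennreal_mult'[symmetric] flip: ennreal_plus)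
    also have "\<dots> \<le> ennreal l"
    proof (rule ennreal_leI)
      have "1 / Gamma k * (\<mu> * (2 * t powr k / k) + (Gamma k * l / 4 + Gamma k * l / 4)) = \<mu> * (2 * t powr k / k) / Gamma k + l / 2"
        using Gamma_k by (simp add: field_simps)
      with add_mono[OF 1 add_mono[OF 2 order_refl[of "l / 2"]]] show "2 * t powr (- (real DIM('a) / 2) / p) * V + 1 / Gamma k * (\<mu> * (2 * t powr k / k) + (Gamma k * l / 4 + Gamma k * l / 4)) \<le> l"
        by (simp only:)
    qed
    finally show False using that l by simp
  qed
  then have "emeasure lborel {y. l < norm (heat_conv \<delta> v y)} \<le> emeasure lborel {y \<in> UNIV. 1 \<le> ennreal (4 / (Gamma k * l)) * \<Phi> y}"
    by (intro emeasure_mono) auto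
  also have "\<dots> \<le> ennreal (4 / (Gamma k * l)) * (\<integral>\<^sup>+y. \<Phi> y * indicator UNIV y \<partial>lborel)"
    by (rule nn_integral_Markov_inequality) auto
  also have "(\<integral>\<^sup>+y. \<Phi> y * indicator UNIV y \<partial>lborel)
     = (\<integral>\<^sup>+s. \<integral>\<^sup>+y. ennreal \<bar>riesz_weight k t s\<bar> * nn_heat_conv (s + \<delta>) (tail \<mu>) y * indicator A s \<partial>lborel \<partial>lborel)"
    unfolding \<Phi>_def by (simp, rule lborel_pair.Fubini') measurable
  also have "\<dots> = (\<integral>\<^sup>+s. ennreal \<bar>riesz_weight k t s\<bar> * indicator A s * (\<integral>\<^sup>+x. tail \<mu> x \<partial>lborel) \<partial>lborel)"
  proof (intro nn_integral_cong)
    fix s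
    show "(\<integral>\<^sup>+y. ennreal \<bar>riesz_weight k t s\<bar> * nn_heat_conv (s + \<delta>) (tail \<mu>) y * indicator A s \<partial>lborel)
       = ennreal \<bar>riesz_weight k t s\<bar> * indicator A s * (\<integral>\<^sup>+x. tail \<mu> x \<partial>lborel)"
    proof (cases "0 < s")
      case True
      then show ?thesis using \<delta>
        by (simp add: nn_integral_cmult nn_integral_multc nn_integral_nn_heat_conv mult_ac)
    qed (use t in \<open>simp add: riesz_weight_nonpos\<close>)
  qed
  also have "\<dots> = (\<integral>\<^sup>+s. ennreal \<bar>riesz_weight k t s\<bar> * indicator A s \<partial>lborel) * (\<integral>\<^sup>+x. tail \<mu> x \<partial>lborel)"
    by (rule nn_integral_multc) auto
  finally show ?thesis .
qed

text \<open>The two cases are the \<open>L\<^sup>1\<close> bound for the whole potential, and the \<open>L\<^sup>1\<close> bound for its part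
  with \<open>s < T\<close> combined with a uniform bound for the rest.\<close>

lemma emeasure_level_set_le':
  assumes t: "0 < t" and \<mu>: "0 < \<mu>" and l: "0 < l" and T: "0 < T" and \<omega>: "0 \<le> \<omega>" "\<omega> \<le> 1"
    and 1: "2 * t powr (- (real DIM('a) / 2) / p) * V \<le> l / 4"
    and 2: "\<mu> * (2 * t powr k / k) / Gamma k \<le> l / 4"
    and 3: "(1 / (real DIM('a) / 2 - k) + 1 / k) * T powr (k - real DIM('a) / 2) * (\<mu> powr (1 - r) * G powr r) \<le> Gamma k * l / 4"
  shows "emeasure lborel {y. l < norm (heat_conv \<delta> v y)}
    \<le> ennreal (8 / (k * Gamma k * l) * ((t powr k) powr (1 - \<omega>) * (T powr k) powr \<omega>)) * (\<integral>\<^sup>+x. tail \<mu> x \<partial>lborel)"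
\<comment> \<open>The mass of the weight is \<open>T powr k / k\<close> in the first case and
  \<open>2 * t powr k / k\<close> in the second, and the smaller of two numbers lies below each of
  their weighted geometric means. The constant 8 is that of the second case.\<close>
proof (cases "T \<le> t")
  case True
  define n where "n = real DIM('a) / 2"
  have n: "k < n" using k by (simp add: n_def)
  have "emeasure lborel {y. l < norm (heat_conv \<delta> v y)}
    \<le> ennreal (4 / (Gamma k * l)) * ((\<integral>\<^sup>+s. ennreal \<bar>riesz_weight k t s\<bar> * indicator {..<T} s \<partial>lborel) * (\<integral>\<^sup>+x. tail \<mu> x \<partial>lborel))"
  proof (rule emeasure_level_set_le[OF t less_imp_le[OF \<mu>] l _ 1 2])
    fix y
    define m where "m = (\<integral>\<^sup>+x. tail \<mu> x \<partial>lborel)"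
    have "(\<integral>\<^sup>+s. ennreal \<bar>riesz_weight k t s\<bar> * nn_heat_conv (s + \<delta>) (tail \<mu>) y * indicator (- {..<T}) s \<partial>lborel)
      \<le> (\<integral>\<^sup>+s. ennreal (\<bar>riesz_weight k t s\<bar> * s powr (- n)) * indicator {T..} s * m \<partial>lborel)"
    proof (intro nn_integral_mono)
      fix s
      show "ennreal \<bar>riesz_weight k t s\<bar> * nn_heat_conv (s + \<delta>) (tail \<mu>) y * indicator (- {..<T}) s
        \<le> ennreal (\<bar>riesz_weight k t s\<bar> * s powr (- n)) * indicator {T..} s * m"
      proof (cases "T \<le> s")
        case True
        then have s: "0 < s" using T by simp
        have "nn_heat_conv (s + \<delta>) (tail \<mu>) y \<le> ennreal ((s + \<delta>) powr (- n)) * m"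
          unfolding n_def m_def using s \<delta> by (intro nn_heat_conv_le) auto
        also have "\<dots> \<le> ennreal (s powr (- n)) * m"
          using s \<delta> n k by (intro mult_right_mono ennreal_leI powr_mono2') auto
        finally have "ennreal \<bar>riesz_weight k t s\<bar> * nn_heat_conv (s + \<delta>) (tail \<mu>) y \<le> ennreal \<bar>riesz_weight k t s\<bar> * (ennreal (s powr (- n)) * m)"
          by (rule mult_left_mono) simp
        then show ?thesis using True by (simp add: ennreal_mult' mult.assoc)
      qed (simp add: indicator_def)
    qed
    also have "\<dots> = (\<integral>\<^sup>+s. ennreal (\<bar>riesz_weight k t s\<bar> * s powr (- n)) * indicator {T..} s \<partial>lborel) * m"
      by (rule nn_integral_multc) auto
    also have "\<dots> \<le> ennreal ((1 / (n - k) + 1 / k) * T powr (k - n)) * ennreal (\<mu> powr (1 - r) * G powr r)"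
      unfolding m_def using T True k n \<mu> by (intro mult_mono nn_integral_riesz_weight_ge nn_integral_tail_le) auto
    also have "\<dots> = ennreal ((1 / (n - k) + 1 / k) * T powr (k - n) * (\<mu> powr (1 - r) * G powr r))"
      using n k by (subst ennreal_mult[symmetric]) (auto intro!: mult_nonneg_nonneg add_nonneg_nonneg)
    also have "\<dots> \<le> ennreal (Gamma k * l / 4)"
      using 3 unfolding n_def by (rule ennreal_leI)
    finally show "(\<integral>\<^sup>+s. ennreal \<bar>riesz_weight k t s\<bar> * nn_heat_conv (s + \<delta>) (tail \<mu>) y * indicator (- {..<T}) s \<partial>lborel) \<le> ennreal (Gamma k * l / 4)" .
  qed simp
  also have "\<dots> = ennreal (4 / (Gamma k * l) * (T powr k / k)) * (\<integral>\<^sup>+x. tail \<mu> x \<partial>lborel)"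
    using T True k Gamma_k l by (subst ennreal_mult) (auto simp: nn_integral_riesz_weight_less mult.assoc)
  also have "\<dots> \<le> ennreal (8 / (k * Gamma k * l) * ((t powr k) powr (1 - \<omega>) * (T powr k) powr \<omega>)) * (\<integral>\<^sup>+x. tail \<mu> x \<partial>lborel)"
  proof (intro mult_right_mono ennreal_leI)
    have "T powr k = (T powr k) powr (1 - \<omega>) * (T powr k) powr \<omega>"
      using T by (simp add: powr_add[symmetric])
    also have "\<dots> \<le> (t powr k) powr (1 - \<omega>) * (T powr k) powr \<omega>"
      using T True k \<omega> by (intro mult_right_mono powr_mono2) auto
    finally have "4 / (Gamma k * l * k) * T powr k \<le> 8 / (Gamma k * l * k) * ((t powr k) powr (1 - \<omega>) * (T powr k) powr \<omega>)"
      using Gamma_k l k by (intro mult_mono divide_right_mono) auto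
    then show "4 / (Gamma k * l) * (T powr k / k) \<le> 8 / (k * Gamma k * l) * ((t powr k) powr (1 - \<omega>) * (T powr k) powr \<omega>)"
      by (simp add: mult_ac)
  qed simp
  finally show ?thesis .
next
  case False
  have "emeasure lborel {y. l < norm (heat_conv \<delta> v y)}
    \<le> ennreal (4 / (Gamma k * l)) * ((\<integral>\<^sup>+s. ennreal \<bar>riesz_weight k t s\<bar> * indicator UNIV s \<partial>lborel) * (\<integral>\<^sup>+x. tail \<mu> x \<partial>lborel))"
    using Gamma_k l by (intro emeasure_level_set_le[OF t less_imp_le[OF \<mu>] l _ 1 2]) auto
  also have "\<dots> = ennreal (4 / (Gamma k * l) * (2 * t powr k / k)) * (\<integral>\<^sup>+x. tail \<mu> x \<partial>lborel)"
    using t k Gamma_k l by (subst ennreal_mult) (auto simp: nn_integral_riesz_weight mult.assoc)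
  also have "\<dots> \<le> ennreal (8 / (k * Gamma k * l) * ((t powr k) powr (1 - \<omega>) * (T powr k) powr \<omega>)) * (\<integral>\<^sup>+x. tail \<mu> x \<partial>lborel)"
  proof (intro mult_right_mono ennreal_leI)
    have "t powr k = (t powr k) powr (1 - \<omega>) * (t powr k) powr \<omega>"
      using t by (simp add: powr_add[symmetric])
    also have "\<dots> \<le> (t powr k) powr (1 - \<omega>) * (T powr k) powr \<omega>"
      using t False k \<omega> by (intro mult_left_mono powr_mono2) auto
    finally have "8 / (Gamma k * l * k) * t powr k \<le> 8 / (Gamma k * l * k) * ((t powr k) powr (1 - \<omega>) * (T powr k) powr \<omega>)"
      using Gamma_k l k by (intro mult_left_mono) auto
    then show "4 / (Gamma k * l) * (2 * t powr k / k) \<le> 8 / (k * Gamma k * l) * ((t powr k) powr (1 - \<omega>) * (T powr k) powr \<omega>)"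
      by (simp add: mult_ac)
  qed simp
  finally show ?thesis .
qed

text \<open>For each level \<open>l\<close> the parameters \<open>t\<close>, \<open>\<mu>\<close>
  and \<open>T\<close> are chosen so that the three quarter conditions become equalities. All are
  then powers of \<open>l\<close>, and the level set bound decays like \<open>l powr (- d)\<close>:
  the summand 1 in \<open>d\<close> comes from Markov's inequality,
  \<open>a * (1 - \<omega>)\<close> from \<open>t\<close>, the rest from \<open>T\<close>. The gap
  between \<open>q\<close> and \<open>d\<close> is such that the layer cake formula returns exactly
  the power \<open>r\<close> of \<open>|g|\<close>.\<close>

lemma nn_integral_heat_conv_powr_le:
  fixes n a w d q \<omega> :: real
  defines "n \<equiv> real DIM('a) / 2" and "a \<equiv> p * k / n" and "w \<equiv> \<omega> * k / (n - k)"
  defines "d \<equiv> 1 + a * (1 - \<omega>) + w * (1 + (1 + a) * (r - 1))"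
  defines "q \<equiv> d + (1 + a) * (r - 1)"
  assumes \<omega>: "0 \<le> \<omega>" "\<omega> \<le> 1"
  shows "(\<integral>\<^sup>+y. ennreal (norm (heat_conv \<delta> v y) powr q) \<partial>lborel)
    \<le> ennreal (gn_const k n r a w q * (8 * V) powr (a * (1 - \<omega>) + a * (r - 1) * (1 + w)) * G powr (r * (1 + w)))"
proof -
  define c where "c = 1 / (n - k) + 1 / k"
  define B where "B = k * Gamma k / 8 * (8 * V) powr (- a)"
  define A where "A = 8 / (k * Gamma k) * (8 * V) powr (a * (1 - \<omega>)) * (4 * c / Gamma k) powr w * (B powr (1 - r) * G powr r) powr w"
  have n: "0 < n" "k < n" using k by (auto simp: n_def)
  have a: "0 < a" using n p k by (simp add: a_def)
  have w: "0 \<le> w" using \<omega> k n by (simp add: w_def)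
  have c: "0 < c" using n k by (simp add: c_def add_pos_pos)
  have B: "0 < B" using k V Gamma_k by (simp add: B_def)
  have A: "0 \<le> A" using k Gamma_k by (simp add: A_def)
  have ar: "0 < (1 + a) * (r - 1)" using a r by simp
  have d: "1 \<le> d" using a w \<omega> ar by (auto simp: d_def intro!: add_nonneg_nonneg mult_nonneg_nonneg)
  have "(\<integral>\<^sup>+y. ennreal (norm (heat_conv \<delta> v y) powr q) \<partial>lborel)
    \<le> ennreal (q * A / (q - d) * B powr (- (q - d) / (1 + a))) * (\<integral>\<^sup>+x. ennreal (norm (g x) powr (1 + (q - d) / (1 + a))) \<partial>lborel)"
  proof (rule layer_cake_bound[OF _ _ _ _ A B])
    show "d < q" "0 < q" using ar d by (auto simp: q_def)
    show "0 < 1 + a" using a by simp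
    fix l :: real assume l: "0 < l"
    define P where "P = 8 * V"
    have P: "0 < P" using V by (simp add: P_def)
    \<comment> \<open>Solves \<open>2 * t powr (- n / p) * V = l / 4\<close>; the exponent
      \<open>a\<close> is the one in \<open>t powr k = (P / l) powr a\<close>.\<close>
    define t where "t = (P / l) powr (p / n)"
    have t: "0 < t" using P l by (simp add: t_def)
    have tk: "t powr k = (P / l) powr a"
      by (simp add: t_def powr_powr a_def)
    \<comment> \<open>Solves \<open>\<mu> * (2 * t powr k / k) / Gamma k = l / 4\<close>, with
      \<open>t\<close> inserted.\<close>
    define \<mu> where "\<mu> = B * l powr (1 + a)"
    have \<mu>: "0 < \<mu>" using B l by (simp add: \<mu>_def)
    define M where "M = \<mu> powr (1 - r) * G powr r"
    have M: "0 < M" using \<mu> G by (simp add: M_def)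
    \<comment> \<open>Here \<open>M\<close> bounds the mass of the tail, and \<open>T\<close> solves
      \<open>c * T powr (k - n) * M = Gamma k * l / 4\<close>.\<close>
    define T where "T = (4 * c * M / (Gamma k * l)) powr (1 / (n - k))"
    have T: "0 < T" using c M Gamma_k l by (simp add: T_def)
    have "emeasure lborel {y. l < norm (heat_conv \<delta> v y)}
      \<le> ennreal (8 / (k * Gamma k * l) * ((t powr k) powr (1 - \<omega>) * (T powr k) powr \<omega>)) * (\<integral>\<^sup>+x. tail \<mu> x \<partial>lborel)"
    proof (rule emeasure_level_set_le'[OF t \<mu> l T \<omega>])
      have "t powr (- n / p) = l / P"
        using p n P l by (simp add: t_def powr_powr powr_minus field_simps)
      then show "2 * t powr (- (real DIM('a) / 2) / p) * V \<le> l / 4"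
        using V by (simp add: n_def P_def)
      have "\<mu> = k * Gamma k / 8 * (l * (t powr (- k)))"
      proof -
        have "t powr (- k) = P powr (- a) * l powr a"
          using P l by (simp add: powr_minus tk powr_divide field_simps)
        then show ?thesis
          unfolding \<mu>_def B_def P_def[symmetric] using l by (simp add: powr_add)
      qed
      moreover have *: "k * Gamma k / 8 * (l * inverse X) * (2 * X / k) / Gamma k = l / 4" if "0 < X" for X
        using that k Gamma_k[THEN less_imp_neq] by (simp add: field_simps)
      ultimately show "\<mu> * (2 * t powr k / k) / Gamma k \<le> l / 4"
        using *[of "t powr k"] t by (simp only: powr_minus powr_gt_zero)
      have "T powr (k - n) = 1 / (4 * c * M / (Gamma k * l))"
      proof -
        have "T powr (k - n) = (4 * c * M / (Gamma k * l)) powr (1 / (n - k) * (k - n))"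
          by (simp add: T_def powr_powr)
        also have "1 / (n - k) * (k - n) = - 1"
          using n by (simp add: field_simps)
        finally show ?thesis using c M Gamma_k l by (simp add: powr_minus)
      qed
      then show "(1 / (real DIM('a) / 2 - k) + 1 / k) * T powr (k - real DIM('a) / 2) * (\<mu> powr (1 - r) * G powr r) \<le> Gamma k * l / 4"
        unfolding n_def[symmetric] c_def[symmetric] M_def[symmetric]
        using c M Gamma_k l by (simp add: field_simps)
    qed
    also have "8 / (k * Gamma k * l) * ((t powr k) powr (1 - \<omega>) * (T powr k) powr \<omega>) = A * l powr (- d)"
    proof -
      have Tk: "(T powr k) powr \<omega> = (4 * c * M / (Gamma k * l)) powr w"
        by (simp add: T_def powr_powr w_def mult.commute)
      \<comment> \<open>Both sides are products of powers of positive numbers, so their logarithms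
        reduce the claim to linear algebra in the exponents.\<close>
      have "ln (8 / (k * Gamma k * l) * (((P / l) powr a) powr (1 - \<omega>) * (4 * c * M / (Gamma k * l)) powr w)) = ln (A * l powr (- d))"
        unfolding A_def M_def \<mu>_def P_def[symmetric]
        using P l k Gamma_k c B G by (simp add: ln_mult ln_div ln_powr) (simp add: d_def algebra_simps)
      moreover have "0 < A"
        unfolding A_def using k Gamma_k[THEN less_imp_neq] c B G V by (intro mult_pos_pos divide_pos_pos) auto
      moreover have "0 < 8 / (k * Gamma k * l) * (((P / l) powr a) powr (1 - \<omega>) * (4 * c * M / (Gamma k * l)) powr w)"
        using P l k Gamma_k[THEN less_imp_neq] c M by (intro mult_pos_pos divide_pos_pos) auto
      ultimately show ?thesis unfolding tk Tk
        using l by (subst (asm) ln_inj_iff) auto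
    qed
    also have "(\<integral>\<^sup>+x. tail \<mu> x \<partial>lborel) = (\<integral>\<^sup>+x. ennreal (norm (g x)) * indicator {x. B * l powr (1 + a) < norm (g x)} x \<partial>lborel)"
      unfolding tail_def \<mu>_def ..
    finally show "emeasure lborel {y. l < norm (heat_conv \<delta> v y)}
      \<le> ennreal (A * l powr (- d)) * (\<integral>\<^sup>+x. ennreal (norm (g x)) * indicator {x. B * l powr (1 + a) < norm (g x)} x \<partial>lborel)" .
  qed auto
  also have "(q - d) / (1 + a) = r - 1" using a by (simp add: q_def)
  also have "- (q - d) / (1 + a) = 1 - r" using a by (simp add: q_def field_simps)
  also have "ennreal (q * A / (q - d) * B powr (1 - r)) * (\<integral>\<^sup>+x. ennreal (norm (g x) powr (1 + (r - 1))) \<partial>lborel)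
     \<le> ennreal (q * A / (q - d) * B powr (1 - r)) * ennreal (G powr r)"
    using G(2) by (intro mult_left_mono) auto
  also have "\<dots> = ennreal (q * A / (q - d) * B powr (1 - r) * G powr r)"
    by (rule ennreal_mult''[symmetric]) simp
  also have "q * A / (q - d) * B powr (1 - r) * G powr r
      = gn_const k n r a w q * (8 * V) powr (a * (1 - \<omega>) + a * (r - 1) * (1 + w)) * G powr (r * (1 + w))"
  proof -
    define P where "P = 8 * V"
    have P: "0 < P" using V by (simp add: P_def)
    define D where "D = k * Gamma k / 8"
    have D: "0 < D" using k Gamma_k by (simp add: D_def)
    have "(B powr (1 - r) * G powr r) powr w * B powr (1 - r) * G powr r = B powr ((1 - r) * (1 + w)) * G powr (r * (1 + w))"
      using B G by (simp add: powr_mult powr_powr distrib_left powr_add mult_ac)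
    moreover have "B powr ((1 - r) * (1 + w)) = D powr ((1 - r) * (1 + w)) * P powr (a * (r - 1) * (1 + w))"
      using D P by (simp add: B_def D_def[symmetric] P_def[symmetric] powr_mult powr_powr) (simp add: algebra_simps)
    moreover have "q - d = (1 + a) * (r - 1)" by (simp add: q_def)
    ultimately have "q * A / (q - d) * B powr (1 - r) * G powr r
      = q / ((1 + a) * (r - 1)) * (8 / (k * Gamma k)) * (4 * c / Gamma k) powr w * P powr (a * (1 - \<omega>))
        * (D powr ((1 - r) * (1 + w)) * P powr (a * (r - 1) * (1 + w)) * G powr (r * (1 + w)))"
      unfolding A_def P_def[symmetric] by (simp only: mult.assoc times_divide_eq_left times_divide_eq_right) (simp add: mult_ac)
    then show ?thesis
      unfolding gn_const_def c_def D_def P_def powr_add by (simp add: mult_ac)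
  qed
  finally show ?thesis .
qed

end

section \<open>Approximation of the identity\<close>

text \<open>Half of the Gaussian decay is split off. It supplies smallness away from the origin,
  while the remaining factor is still a kernel of mass 1.\<close>

lemma heat_eq_double:
  fixes z :: "'a::euclidean_space"
  assumes "0 < s"
  shows "heat s z = 2 powr (real DIM('a) / 2) * exp (- (norm z)\<^sup>2 / (8 * s)) * heat (2 * s) z"
proof -
  have "(4 * pi * (2 * s)) powr (- (real DIM('a) / 2)) = 2 powr (- (real DIM('a) / 2)) * (4 * pi * s) powr (- (real DIM('a) / 2))"
    using assms by (subst powr_mult[symmetric]) (auto simp: mult_ac)
  moreover have "exp (- (norm z)\<^sup>2 / (4 * s)) = exp (- (norm z)\<^sup>2 / (8 * s)) * exp (- (norm z)\<^sup>2 / (4 * (2 * s)))"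
    using assms by (simp add: exp_add[symmetric] field_simps)
  ultimately show ?thesis
    by (simp add: heat_def powr_minus)
qed

lemma integrable_heat_mult_bounded:
  fixes w :: "'a::euclidean_space \<Rightarrow> complex"
  assumes [measurable]: "w \<in> borel_measurable borel" and M: "\<And>x. norm (w x) \<le> M" and s: "0 < s"
  shows "integrable lborel (\<lambda>x. w x * of_real (heat s (x - y)))"
proof (rule integrableI_bounded)
  have M0: "0 \<le> M" using M[of 0] norm_ge_zero order_trans by blast
  have "(\<integral>\<^sup>+x. ennreal (norm (w x * of_real (heat s (x - y)))) \<partial>lborel) \<le> (\<integral>\<^sup>+x. ennreal M * ennreal (heat s (x - y)) \<partial>lborel)"
    using M M0 by (intro nn_integral_mono) (auto simp: norm_mult ennreal_mult'[symmetric] intro!: ennreal_leI mult_right_mono)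
  also have "\<dots> = ennreal M" by (simp add: nn_integral_cmult heat_nn_integral[OF s])
  finally show "(\<integral>\<^sup>+x. ennreal (norm (w x * of_real (heat s (x - y)))) \<partial>lborel) < \<infinity>"
    by (rule le_less_trans) simp
qed measurable

lemma norm_heat_conv_bounded:
  fixes w :: "'a::euclidean_space \<Rightarrow> complex"
  assumes [measurable]: "w \<in> borel_measurable borel" and M: "\<And>x. norm (w x) \<le> M" and s: "0 < s"
  shows "norm (heat_conv s w y) \<le> M"
proof -
  have M0: "0 \<le> M" using M[of 0] norm_ge_zero order_trans by blast
  have "ennreal (norm (heat_conv s w y)) \<le> (\<integral>\<^sup>+x. ennreal M * ennreal (heat s (x - y)) \<partial>lborel)"
    unfolding heat_conv_def using M M0
    by (intro order_trans[OF norm_integral_le_nn_integral] nn_integral_mono)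
       (auto simp: norm_mult ennreal_mult'[symmetric] intro!: ennreal_leI mult_right_mono)
  also have "\<dots> = ennreal M" by (simp add: nn_integral_cmult heat_nn_integral[OF s])
  finally show ?thesis using M0 by simp
qed

lemma heat_conv_tendsto:
  fixes w :: "'a::euclidean_space \<Rightarrow> complex"
  assumes cont: "continuous_on UNIV w" and M: "\<And>x. norm (w x) \<le> M"
    and \<delta>: "\<And>n. 0 < \<delta> n" "\<delta> \<longlonglongrightarrow> 0"
  shows "(\<lambda>n. heat_conv (\<delta> n) w y) \<longlonglongrightarrow> w y"
proof (rule LIMSEQ_I)
  fix e :: real assume e: "0 < e"
  have [measurable]: "w \<in> borel_measurable borel"
    using cont by (rule borel_measurable_continuous_onI)
  have M0: "0 \<le> M" using M[of 0] norm_ge_zero order_trans by blast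
  from cont have "isCont w y" by (simp add: continuous_on_eq_continuous_at)
  then obtain h where h: "0 < h" "\<And>x. norm (x - y) < h \<Longrightarrow> norm (w x - w y) < e / 2"
    using e unfolding isCont_def LIM_def dist_norm by (metis diff_self norm_zero half_gt_zero)
  define N where "N = 2 powr (real DIM('a) / 2)"
  \<comment> \<open>Bounds the contribution of the points at distance at least \<open>h\<close>,
    after half of the decay has been split off by \<open>heat_eq_double\<close>.\<close>
  define K where "K = (\<lambda>s. 2 * M * N * exp (- h\<^sup>2 / (8 * s)))"
  have N: "0 < N" by (simp add: N_def)
  have "((\<lambda>s. K s) \<longlongrightarrow> 0) (at_right 0)"
    unfolding K_def using h by real_asymp
  moreover have "filterlim \<delta> (at_right 0) sequentially"
    unfolding filterlim_at using \<delta>(2) by (auto intro!: always_eventually \<delta>(1) simp: less_imp_neq[OF \<delta>(1), symmetric])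
  ultimately have "(\<lambda>n. K (\<delta> n)) \<longlonglongrightarrow> 0"
    by (rule filterlim_compose)
  then obtain n0 where n0: "\<And>n. n0 \<le> n \<Longrightarrow> \<bar>K (\<delta> n)\<bar> < e / 2"
    using e LIMSEQ_D[of _ 0 "e / 2"] by fastforce
  show "\<exists>n0. \<forall>n\<ge>n0. norm (heat_conv (\<delta> n) w y - w y) < e"
  proof (intro exI allI impI)
    fix n assume n: "n0 \<le> n"
    define s where "s = \<delta> n"
    have s: "0 < s" using \<delta> by (simp add: s_def)
    have K0: "0 \<le> K s" using M0 N by (simp add: K_def)
    have c: "heat_conv s (\<lambda>x. w y) y = w y"
    proof -
      have "integrable lborel (\<lambda>x. heat s (x - y))"
        by (rule integrableI_bounded) (auto simp: heat_nn_integral[OF s])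
      moreover have "(LINT x|lborel. heat s (x - y)) = 1"
        using heat_nn_integral(1)[OF s, of y] by (simp add: integral_eq_nn_integral)
      ultimately show ?thesis by (simp add: heat_conv_def)
    qed
    have "heat_conv s w y - w y = heat_conv s w y - heat_conv s (\<lambda>x. w y) y"
      by (simp only: c)
    also have "\<dots> = heat_conv s (\<lambda>x. w x - w y) y"
      unfolding heat_conv_def left_diff_distrib
      using M s by (intro Bochner_Integration.integral_diff[symmetric] integrable_heat_mult_bounded[where M = M]) auto
    finally have "ennreal (norm (heat_conv s w y - w y)) \<le> (\<integral>\<^sup>+x. ennreal (norm (w x - w y) * heat s (x - y)) \<partial>lborel)"
      unfolding heat_conv_def using norm_integral_le_nn_integral[of lborel "\<lambda>x. (w x - w y) * of_real (heat s (x - y))"]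
      by (simp add: norm_mult)
    also have "\<dots> \<le> (\<integral>\<^sup>+x. ennreal (e / 2) * ennreal (heat s (x - y)) + ennreal (K s) * ennreal (heat (2 * s) (x - y)) \<partial>lborel)"
    proof (intro nn_integral_mono)
      fix x
      have "norm (w x - w y) * heat s (x - y) \<le> e / 2 * heat s (x - y) + K s * heat (2 * s) (x - y)"
      proof (cases "norm (x - y) < h")
        case True
        then have "norm (w x - w y) * heat s (x - y) \<le> e / 2 * heat s (x - y)"
          using h(2)[of x] by (intro mult_right_mono) auto
        then show ?thesis using K0 by (simp add: add_increasing2)
      next
        case False
        have "norm (w x - w y) \<le> 2 * M"
          using norm_triangle_ineq4[of "w x" "w y"] M[of x] M[of y] by linarith
        then have "norm (w x - w y) * heat s (x - y) \<le> 2 * M * heat s (x - y)"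
          by (intro mult_right_mono) auto
        also have "\<dots> = 2 * M * N * exp (- (norm (x - y))\<^sup>2 / (8 * s)) * heat (2 * s) (x - y)"
          by (subst heat_eq_double[OF s]) (simp add: N_def)
        also have "\<dots> \<le> 2 * M * N * exp (- h\<^sup>2 / (8 * s)) * heat (2 * s) (x - y)"
          using False h s M0 N by (intro mult_right_mono mult_left_mono) (auto intro!: divide_right_mono power_mono)
        finally show ?thesis using e by (simp add: K_def add_increasing)
      qed
      then show "ennreal (norm (w x - w y) * heat s (x - y)) \<le> ennreal (e / 2) * ennreal (heat s (x - y)) + ennreal (K s) * ennreal (heat (2 * s) (x - y))"
        using e K0 by (simp add: ennreal_mult'[symmetric] ennreal_leI flip: ennreal_plus)
    qed
    also have "\<dots> = ennreal (e / 2 + K s)"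
      using s e K0 by (subst nn_integral_add) (auto simp: nn_integral_cmult heat_nn_integral simp flip: ennreal_plus)
    finally have "norm (heat_conv s w y - w y) \<le> e / 2 + K s"
      by (subst (asm) ennreal_le_iff) (use e K0 in auto)
    also have "\<dots> < e" using n0[OF n] by (simp add: s_def)
    finally show "norm (heat_conv (\<delta> n) w y - w y) < e" by (simp add: s_def)
  qed
qed

lemma norm_add_powr_le:
  fixes a b :: "'a::real_normed_vector"
  assumes "0 \<le> p"
  shows "norm (a + b) powr p \<le> 2 powr p * (norm a powr p + norm b powr p)"
proof -
  have "norm (a + b) powr p \<le> (2 * max (norm a) (norm b)) powr p"
    using norm_triangle_ineq[of a b] assms by (intro powr_mono2) auto
  also have "\<dots> = 2 powr p * max (norm a) (norm b) powr p"
    by (simp add: powr_mult)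
  also have "max (norm a) (norm b) powr p \<le> norm a powr p + norm b powr p"
    by (auto simp: max_def)
  finally show ?thesis by simp
qed

text \<open>Measurability yields continuous functions \<open>f n\<close> that converge to
  \<open>v\<close> almost everywhere, but with no common bound. Cutting both sides off produces one,
  keeps continuity, and lets dominated convergence pass to Lp.\<close>

lemma Lp_approx_continuous:
  fixes v :: "'a::euclidean_space \<Rightarrow> complex"
  assumes [measurable]: "v \<in> borel_measurable borel" and p: "1 \<le> p"
    and fin: "(\<integral>\<^sup>+x. ennreal (norm (v x) powr p) \<partial>lborel) < \<infinity>" and \<kappa>: "0 < \<kappa>"
  obtains w M where "continuous_on UNIV w" "\<And>x. norm (w x) \<le> M"
    "(\<integral>\<^sup>+x. ennreal (norm (v x - w x) powr p) \<partial>lborel) \<le> ennreal \<kappa>"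
proof -
  have "v \<in> borel_measurable lebesgue" by (simp add: measurable_completion)
  then have "v measurable_on UNIV" by (intro lebesgue_measurable_imp_measurable_on) auto
  then obtain Z f where Z: "negligible Z" and f: "\<And>n. continuous_on UNIV (f n)" "\<And>x. x \<notin> Z \<Longrightarrow> (\<lambda>n. f n x) \<longlonglongrightarrow> v x"
    unfolding measurable_on_def by auto
  have [measurable]: "f n \<in> borel_measurable borel" for n
    using f(1) by (rule borel_measurable_continuous_onI)
  have AE: "AE x in lborel. x \<notin> Z"
    using Z AE_not_in[of Z lebesgue] by (simp add: negligible_iff_null_sets AE_completion_iff)
  \<comment> \<open>The radial projection of the value \<open>z\<close> to the ball of radius
    \<open>Suc m\<close>, damped by a Gaussian in \<open>x\<close>. The quotient with
    \<open>max\<close> is continuous in \<open>z\<close>, also at 0.\<close>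
  define cut where "cut = (\<lambda>(m::nat) (x::'a) (z::complex). (exp (- (norm x)\<^sup>2 / real (Suc m)) * (real (Suc m) / max (real (Suc m)) (norm z))) *\<^sub>R z)"
  have [measurable]: "(\<lambda>x. cut m x (u x)) \<in> borel_measurable borel" if [measurable]: "u \<in> borel_measurable borel" for m u
    unfolding cut_def by measurable
  have cut_le1: "norm (cut m x z) \<le> norm z" for m x z
  proof -
    have "exp (- (norm x)\<^sup>2 / real (Suc m)) * (real (Suc m) / max (real (Suc m)) (norm z)) \<le> 1 * 1"
      by (intro mult_mono) (auto simp: divide_simps max_def)
    then show ?thesis unfolding cut_def norm_scaleR
      by (intro mult_left_le_one_le) auto
  qed
  have cut_le2: "norm (cut m x z) \<le> real (Suc m) * exp (- (norm x)\<^sup>2 / real (Suc m))" for m x z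
  proof -
    have "real (Suc m) / max (real (Suc m)) (norm z) * norm z \<le> real (Suc m)"
    proof (cases "real (Suc m) \<le> norm z")
      case True
      moreover have "0 < norm z" using True by linarith
      ultimately show ?thesis by (simp only: max_def if_True) simp
    next
      case False
      then show ?thesis by (simp only: max_def if_False) simp
    qed
    then have "exp (- (norm x)\<^sup>2 / real (Suc m)) * (real (Suc m) / max (real (Suc m)) (norm z) * norm z) \<le> exp (- (norm x)\<^sup>2 / real (Suc m)) * real (Suc m)"
      by (intro mult_left_mono) auto
    then show ?thesis unfolding cut_def norm_scaleR by (simp add: abs_mult mult_ac)
  qed
  have cut_lim: "(\<lambda>m. cut m x z) \<longlonglongrightarrow> z" for x z
  proof -
    have 1: "(\<lambda>m. exp (- (norm x)\<^sup>2 / real (Suc m))) \<longlonglongrightarrow> 1"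
      by real_asymp
    have "\<forall>\<^sub>F m in sequentially. real (Suc m) / max (real (Suc m)) (norm z) = 1"
    proof -
      obtain m0 :: nat where "norm z \<le> real m0" using real_arch_simple by blast
      then have "real (Suc m) / max (real (Suc m)) (norm z) = 1" if "m0 \<le> m" for m
        using that by (auto simp: max_def)
      then show ?thesis unfolding eventually_sequentially by blast
    qed
    then have 2: "(\<lambda>m. real (Suc m) / max (real (Suc m)) (norm z)) \<longlonglongrightarrow> 1"
      by (rule tendsto_eventually)
    have "(\<lambda>m. cut m x z) \<longlonglongrightarrow> (1 * 1) *\<^sub>R z"
      unfolding cut_def by (intro tendsto_scaleR tendsto_mult 1 2 tendsto_const)
    then show ?thesis by simp
  qed
  have cut_cont: "continuous_on UNIV (\<lambda>x. cut m x (u x))" if "continuous_on UNIV u" for m u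
    unfolding cut_def using that by (intro continuous_intros) (auto simp: max_def)
  \<comment> \<open>Two errors are added, and \<open>norm_add_powr_le\<close> costs a factor
    \<open>2 powr p\<close>. First \<open>m\<close> is fixed, with dominating function a multiple of
    \<open>|v| powr p\<close>; then \<open>n\<close>, with a Gaussian as dominating
    function.\<close>
  define \<kappa>' where "\<kappa>' = \<kappa> / (2 * 2 powr p)"
  have \<kappa>': "0 < \<kappa>'" using \<kappa> by (simp add: \<kappa>'_def)
  have "(\<lambda>m. \<integral>\<^sup>+x. ennreal (norm (v x - cut m x (v x)) powr p) \<partial>lborel) \<longlonglongrightarrow> (\<integral>\<^sup>+x. 0 \<partial>(lborel::'a measure))"
  proof (rule nn_integral_dominated_convergence)
    show "AE x in lborel. ennreal (norm (v x - cut m x (v x)) powr p) \<le> ennreal (2 powr p) * ennreal (norm (v x) powr p)" for m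
    proof (intro AE_I2)
      fix x
      have "norm (v x - cut m x (v x)) \<le> 2 * norm (v x)"
        using norm_triangle_ineq4[of "v x" "cut m x (v x)"] cut_le1[of m x "v x"] by linarith
      then have "norm (v x - cut m x (v x)) powr p \<le> (2 * norm (v x)) powr p"
        using p by (intro powr_mono2) auto
      then show "ennreal (norm (v x - cut m x (v x)) powr p) \<le> ennreal (2 powr p) * ennreal (norm (v x) powr p)"
        by (simp add: powr_mult ennreal_mult'[symmetric] ennreal_leI)
    qed
    show "(\<integral>\<^sup>+x. ennreal (2 powr p) * ennreal (norm (v x) powr p) \<partial>lborel) < \<infinity>"
      using fin by (simp add: nn_integral_cmult ennreal_mult_less_top)
    show "AE x in lborel. (\<lambda>m. ennreal (norm (v x - cut m x (v x)) powr p)) \<longlonglongrightarrow> 0"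
    proof (intro AE_I2)
      fix x
      have "(\<lambda>m. norm (v x - cut m x (v x)) powr p) \<longlonglongrightarrow> norm (v x - v x) powr p"
        using p by (intro tendsto_powr' tendsto_norm tendsto_diff tendsto_const cut_lim) auto
      then show "(\<lambda>m. ennreal (norm (v x - cut m x (v x)) powr p)) \<longlonglongrightarrow> 0"
        using tendsto_ennrealI by fastforce
    qed
  qed measurable
  then have "\<forall>\<^sub>F m in sequentially. (\<integral>\<^sup>+x. ennreal (norm (v x - cut m x (v x)) powr p) \<partial>lborel) < ennreal \<kappa>'"
    using \<kappa>' by (intro order_tendstoD) auto
  then obtain m where m: "(\<integral>\<^sup>+x. ennreal (norm (v x - cut m x (v x)) powr p) \<partial>lborel) \<le> ennreal \<kappa>'"
    using eventually_happens'[OF sequentially_bot] less_imp_le by blast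
  have "(\<lambda>n. \<integral>\<^sup>+x. ennreal (norm (cut m x (v x) - cut m x (f n x)) powr p) \<partial>lborel) \<longlonglongrightarrow> (\<integral>\<^sup>+x. 0 \<partial>(lborel::'a measure))"
  proof (rule nn_integral_dominated_convergence)
    define b where "b = (\<lambda>x::'a. (2 * real (Suc m)) powr p * exp (- (p / real (Suc m)) * (norm x)\<^sup>2))"
    have [measurable]: "b \<in> borel_measurable borel" unfolding b_def by measurable
    show "AE x in lborel. ennreal (norm (cut m x (v x) - cut m x (f n x)) powr p) \<le> ennreal (b x)" for n
    proof (intro AE_I2 ennreal_leI)
      fix x
      have "norm (cut m x (v x) - cut m x (f n x)) \<le> 2 * real (Suc m) * exp (- (norm x)\<^sup>2 / real (Suc m))"
        using norm_triangle_ineq4[of "cut m x (v x)" "cut m x (f n x)"] cut_le2[of m x "v x"] cut_le2[of m x "f n x"] by linarith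
      then have "norm (cut m x (v x) - cut m x (f n x)) powr p \<le> (2 * real (Suc m) * exp (- (norm x)\<^sup>2 / real (Suc m))) powr p"
        using p by (intro powr_mono2) auto
      also have "\<dots> = b x"
        by (simp add: b_def powr_mult exp_powr_real mult_ac)
      finally show "norm (cut m x (v x) - cut m x (f n x)) powr p \<le> b x" .
    qed
    show "(\<integral>\<^sup>+x. ennreal (b x) \<partial>lborel) < \<infinity>"
    proof -
      have "0 < p / real (Suc m)" using p by simp
      from fourier_gaussian(1)[OF this, of "0::'a"]
      have "integrable lborel (\<lambda>x::'a. complex_of_real (exp (- (p / real (Suc m)) * (norm x)\<^sup>2)))"
        by simp
      then have "integrable lborel b" unfolding b_def
        by (subst (asm) complex_of_real_integrable_eq) (rule integrable_mult_right)
      then show ?thesis by (subst nn_integral_eq_integral) (auto simp: b_def)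
    qed
    show "AE x in lborel. (\<lambda>n. ennreal (norm (cut m x (v x) - cut m x (f n x)) powr p)) \<longlonglongrightarrow> 0"
      using AE
    proof eventually_elim
      case (elim x)
      have "(\<lambda>n. cut m x (f n x)) \<longlonglongrightarrow> cut m x (v x)"
        unfolding cut_def by (intro tendsto_intros f elim) (auto simp: max_def)
      then have "(\<lambda>n. norm (cut m x (v x) - cut m x (f n x)) powr p) \<longlonglongrightarrow> norm (cut m x (v x) - cut m x (v x)) powr p"
        using p by (intro tendsto_powr' tendsto_norm tendsto_diff tendsto_const) auto
      then show ?case
        using tendsto_ennrealI by fastforce
    qed
  qed measurable
  then have "\<forall>\<^sub>F n in sequentially. (\<integral>\<^sup>+x. ennreal (norm (cut m x (v x) - cut m x (f n x)) powr p) \<partial>lborel) < ennreal \<kappa>'"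
    using \<kappa>' by (intro order_tendstoD) auto
  then obtain n where n: "(\<integral>\<^sup>+x. ennreal (norm (cut m x (v x) - cut m x (f n x)) powr p) \<partial>lborel) \<le> ennreal \<kappa>'"
    using eventually_happens'[OF sequentially_bot] less_imp_le by blast
  show thesis
  proof (rule that)
    show "continuous_on UNIV (\<lambda>x. cut m x (f n x))"
      by (intro cut_cont f)
    show "norm (cut m x (f n x)) \<le> real (Suc m)" for x
      using cut_le2[of m x "f n x"] by (rule order_trans) (simp add: mult_left_le)
    have "(\<integral>\<^sup>+x. ennreal (norm (v x - cut m x (f n x)) powr p) \<partial>lborel)
      \<le> (\<integral>\<^sup>+x. ennreal (2 powr p) * (ennreal (norm (v x - cut m x (v x)) powr p) + ennreal (norm (cut m x (v x) - cut m x (f n x)) powr p)) \<partial>lborel)"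
    proof (intro nn_integral_mono)
      fix x
      show "ennreal (norm (v x - cut m x (f n x)) powr p)
        \<le> ennreal (2 powr p) * (ennreal (norm (v x - cut m x (v x)) powr p) + ennreal (norm (cut m x (v x) - cut m x (f n x)) powr p))"
        using norm_add_powr_le[of p "v x - cut m x (v x)" "cut m x (v x) - cut m x (f n x)"] p
        by (simp add: ennreal_mult'[symmetric] ennreal_leI flip: ennreal_plus)
    qed
    also have "\<dots> = ennreal (2 powr p) * ((\<integral>\<^sup>+x. ennreal (norm (v x - cut m x (v x)) powr p) \<partial>lborel) + (\<integral>\<^sup>+x. ennreal (norm (cut m x (v x) - cut m x (f n x)) powr p) \<partial>lborel))"
      by (simp add: nn_integral_cmult nn_integral_add)
    also have "\<dots> \<le> ennreal (2 powr p) * (ennreal \<kappa>' + ennreal \<kappa>')"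
      using m n by (intro mult_left_mono add_mono) auto
    also have "\<dots> = ennreal \<kappa>"
      using \<kappa>' by (simp add: ennreal_mult'[symmetric] flip: ennreal_plus) (simp add: \<kappa>'_def)
    finally show "(\<integral>\<^sup>+x. ennreal (norm (v x - cut m x (f n x)) powr p) \<partial>lborel) \<le> ennreal \<kappa>" .
  qed
qed

text \<open>The weight \<open>heat 1\<close> is at most 1 and has mass 1, so smallness in Lp becomes
  smallness in weighted L1, uniformly in \<open>s\<close>. This stands in for the contraction
  property of the heat flow on Lp.\<close>

lemma nn_integral_weighted_heat_conv_le:
  fixes f :: "'a::euclidean_space \<Rightarrow> complex"
  assumes [measurable]: "f \<in> borel_measurable borel" and p: "1 \<le> p" and \<eta>: "0 < \<eta>" and s: "0 < s"
    and f: "(\<integral>\<^sup>+x. ennreal (norm (f x) powr p) \<partial>lborel) \<le> ennreal (\<eta> powr p)"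
  shows "(\<integral>\<^sup>+y. ennreal (heat 1 y * norm (heat_conv s f y)) \<partial>lborel) \<le> ennreal (2 * \<eta>)"
    and "(\<integral>\<^sup>+y. ennreal (heat 1 y * norm (f y)) \<partial>lborel) \<le> ennreal (2 * \<eta>)"
proof -
  have h1: "heat 1 y \<le> 1" for y :: 'a
    using heat_le[of 1 y] by simp
  have h1': "(\<integral>\<^sup>+y. ennreal (heat 1 (y::'a)) \<partial>lborel) = 1"
    using heat_nn_integral(1)[of 1 "0::'a"] by simp
  define c where "c = \<eta> powr (1 - p)"
  have c: "c * \<eta> powr p = \<eta>" using \<eta> by (simp add: c_def powr_add[symmetric])
  define F where "F = (\<lambda>x. ennreal (norm (f x) powr p))"
  have [measurable]: "F \<in> borel_measurable borel" unfolding F_def by measurable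
  have F: "ennreal (norm (f x)) \<le> ennreal \<eta> + ennreal c * F x" for x
    using le_add_powr[OF norm_ge_zero \<eta> p, of "f x"] \<eta>
    by (simp add: F_def c_def ennreal_mult'[symmetric] ennreal_leI flip: ennreal_plus)
  have tot: "ennreal \<eta> + ennreal c * (\<integral>\<^sup>+x. F x \<partial>lborel) \<le> ennreal (2 * \<eta>)"
  proof -
    have "ennreal c * (\<integral>\<^sup>+x. F x \<partial>lborel) \<le> ennreal c * ennreal (\<eta> powr p)"
      using f unfolding F_def by (intro mult_left_mono) auto
    also have "\<dots> = ennreal \<eta>" by (simp add: ennreal_mult'[symmetric] ennreal_mult''[symmetric] c)
    finally have "ennreal \<eta> + ennreal c * (\<integral>\<^sup>+x. F x \<partial>lborel) \<le> ennreal \<eta> + ennreal \<eta>"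
      by (rule add_left_mono)
    then show ?thesis using \<eta> by (simp flip: ennreal_plus)
  qed
  have hc: "ennreal (norm (heat_conv s f y)) \<le> ennreal \<eta> + ennreal c * nn_heat_conv s F y" for y
  proof -
    have "ennreal (norm (heat_conv s f y)) \<le> (\<integral>\<^sup>+x. ennreal (norm (f x)) * ennreal (heat s (x - y)) \<partial>lborel)"
      unfolding heat_conv_def by (rule order_trans[OF norm_integral_le_nn_integral]) (simp add: norm_mult ennreal_mult')
    also have "\<dots> \<le> (\<integral>\<^sup>+x. ennreal \<eta> * ennreal (heat s (x - y)) + ennreal c * (F x * ennreal (heat s (x - y))) \<partial>lborel)"
      unfolding mult.assoc[symmetric] distrib_right[symmetric]
      by (intro nn_integral_mono mult_right_mono F) auto
    also have "\<dots> = ennreal \<eta> + ennreal c * nn_heat_conv s F y"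
      by (subst nn_integral_add) (auto simp: nn_integral_cmult heat_nn_integral[OF s] nn_heat_conv_def)
    finally show ?thesis .
  qed
  have "(\<integral>\<^sup>+y. ennreal (heat 1 y * norm (heat_conv s f y)) \<partial>lborel)
    \<le> (\<integral>\<^sup>+y. ennreal \<eta> * ennreal (heat 1 y) + ennreal c * nn_heat_conv s F y \<partial>lborel)"
  proof (intro nn_integral_mono)
    fix y :: 'a
    have "ennreal (heat 1 y * norm (heat_conv s f y)) \<le> ennreal (heat 1 y) * (ennreal \<eta> + ennreal c * nn_heat_conv s F y)"
      unfolding ennreal_mult'[OF heat_nonneg] by (intro mult_left_mono hc) auto
    also have "\<dots> \<le> ennreal \<eta> * ennreal (heat 1 y) + 1 * (ennreal c * nn_heat_conv s F y)"
      unfolding distrib_left using h1[of y] by (intro add_mono mult_right_mono) (auto simp: mult.commute)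
    finally show "ennreal (heat 1 y * norm (heat_conv s f y)) \<le> ennreal \<eta> * ennreal (heat 1 y) + ennreal c * nn_heat_conv s F y"
      by simp
  qed
  also have "\<dots> = ennreal \<eta> + ennreal c * (\<integral>\<^sup>+x. F x \<partial>lborel)"
    by (subst nn_integral_add) (auto simp: nn_integral_cmult h1' nn_integral_nn_heat_conv s)
  also note tot
  finally show "(\<integral>\<^sup>+y. ennreal (heat 1 y * norm (heat_conv s f y)) \<partial>lborel) \<le> ennreal (2 * \<eta>)" .
  have "(\<integral>\<^sup>+y. ennreal (heat 1 y * norm (f y)) \<partial>lborel)
    \<le> (\<integral>\<^sup>+y. ennreal \<eta> * ennreal (heat 1 y) + ennreal c * F y \<partial>lborel)"
  proof (intro nn_integral_mono)
    fix y :: 'a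
    have "ennreal (heat 1 y * norm (f y)) \<le> ennreal (heat 1 y) * (ennreal \<eta> + ennreal c * F y)"
      unfolding ennreal_mult'[OF heat_nonneg] by (intro mult_left_mono F) auto
    also have "\<dots> \<le> ennreal \<eta> * ennreal (heat 1 y) + 1 * (ennreal c * F y)"
      unfolding distrib_left using h1[of y] by (intro add_mono mult_right_mono) (auto simp: mult.commute)
    finally show "ennreal (heat 1 y * norm (f y)) \<le> ennreal \<eta> * ennreal (heat 1 y) + ennreal c * F y"
      by simp
  qed
  also have "\<dots> = ennreal \<eta> + ennreal c * (\<integral>\<^sup>+x. F x \<partial>lborel)"
    by (subst nn_integral_add) (auto simp: nn_integral_cmult h1')
  also note tot
  finally show "(\<integral>\<^sup>+y. ennreal (heat 1 y * norm (f y)) \<partial>lborel) \<le> ennreal (2 * \<eta>)" .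
qed

text \<open>Comparison with a bounded continuous \<open>w\<close> gives convergence in L1 with
  weight \<open>heat 1\<close>: the parts with \<open>v - w\<close> cost \<open>2 * \<eta>\<close>
  each and the part with \<open>w\<close> costs \<open>\<eta>\<close>. Convergence in L1 gives a
  subsequence converging almost everywhere, and the weight vanishes nowhere, so it can be divided
  out.\<close>

lemma heat_conv_AE_subseq:
  fixes v :: "'a::euclidean_space \<Rightarrow> complex"
  assumes [measurable]: "v \<in> borel_measurable borel" and p: "1 \<le> p"
    and fin: "(\<integral>\<^sup>+x. ennreal (norm (v x) powr p) \<partial>lborel) < \<infinity>"
    and \<delta>: "\<And>n. 0 < \<delta> n" "\<delta> \<longlonglongrightarrow> 0"
  obtains \<rho> :: "nat \<Rightarrow> nat" where "AE y in lborel. (\<lambda>n. heat_conv (\<delta> (\<rho> n)) v y) \<longlonglongrightarrow> v y"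
proof -
  define E where "E = (\<lambda>n. \<integral>\<^sup>+y. ennreal (heat 1 y * norm (heat_conv (\<delta> n) v y - v y)) \<partial>lborel)"
  have E_small: "\<exists>n0. \<forall>n\<ge>n0. E n \<le> ennreal (5 * \<eta>)" if \<eta>: "0 < \<eta>" for \<eta> :: real
  proof -
    obtain w M where w: "continuous_on UNIV w" and M: "\<And>x. norm (w x) \<le> M"
      and vw: "(\<integral>\<^sup>+x. ennreal (norm (v x - w x) powr p) \<partial>lborel) \<le> ennreal (\<eta> powr p)"
      using Lp_approx_continuous[of v p "\<eta> powr p"] p fin \<eta> by auto
    have [measurable]: "w \<in> borel_measurable borel"
      using w by (rule borel_measurable_continuous_onI)
    have "(\<lambda>n. \<integral>\<^sup>+y. ennreal (heat 1 y * norm (heat_conv (\<delta> n) w y - w y)) \<partial>lborel) \<longlonglongrightarrow> (\<integral>\<^sup>+y. 0 \<partial>(lborel::'a measure))"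
    proof (rule nn_integral_dominated_convergence)
      show "AE y in lborel. ennreal (heat 1 y * norm (heat_conv (\<delta> n) w y - w y)) \<le> ennreal (2 * M) * ennreal (heat 1 y)" for n
      proof (intro AE_I2)
        fix y
        have "norm (heat_conv (\<delta> n) w y - w y) \<le> 2 * M"
          using norm_triangle_ineq4[of "heat_conv (\<delta> n) w y" "w y"]
            norm_heat_conv_bounded[OF \<open>w \<in> borel_measurable borel\<close> M \<delta>(1), of n y] M[of y] by linarith
        then have "heat 1 y * norm (heat_conv (\<delta> n) w y - w y) \<le> 2 * M * heat 1 y"
          by (subst mult.commute) (intro mult_right_mono heat_nonneg)
        then show "ennreal (heat 1 y * norm (heat_conv (\<delta> n) w y - w y)) \<le> ennreal (2 * M) * ennreal (heat 1 y)"
          unfolding ennreal_mult''[OF heat_nonneg, symmetric] by (rule ennreal_leI)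
      qed
      show "(\<integral>\<^sup>+y. ennreal (2 * M) * ennreal (heat 1 y) \<partial>(lborel::'a measure)) < \<infinity>"
        using heat_nn_integral(1)[of 1 "0::'a"] by (simp add: nn_integral_cmult)
      show "AE y in lborel. (\<lambda>n. ennreal (heat 1 y * norm (heat_conv (\<delta> n) w y - w y))) \<longlonglongrightarrow> 0"
      proof (intro AE_I2)
        fix y
        have "(\<lambda>n. heat 1 y * norm (heat_conv (\<delta> n) w y - w y)) \<longlonglongrightarrow> heat 1 y * norm (w y - w y)"
          by (intro tendsto_intros heat_conv_tendsto[OF w M \<delta>])
        then show "(\<lambda>n. ennreal (heat 1 y * norm (heat_conv (\<delta> n) w y - w y))) \<longlonglongrightarrow> 0"
          using tendsto_ennrealI by fastforce
      qed
    qed measurable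
    then have "\<forall>\<^sub>F n in sequentially. (\<integral>\<^sup>+y. ennreal (heat 1 y * norm (heat_conv (\<delta> n) w y - w y)) \<partial>lborel) < ennreal \<eta>"
      using \<eta> by (intro order_tendstoD) auto
    then obtain n0 where n0: "\<And>n. n0 \<le> n \<Longrightarrow> (\<integral>\<^sup>+y. ennreal (heat 1 y * norm (heat_conv (\<delta> n) w y - w y)) \<partial>lborel) \<le> ennreal \<eta>"
      unfolding eventually_sequentially using less_imp_le by blast
    show ?thesis
    proof (intro exI allI impI)
      fix n assume n: "n0 \<le> n"
      have lin: "heat_conv (\<delta> n) v y = heat_conv (\<delta> n) (\<lambda>x. v x - w x) y + heat_conv (\<delta> n) w y" for y
        unfolding heat_conv_def left_diff_distrib
        using Bochner_Integration.integral_diff[OF integrable_heat_mult[OF assms(1) \<delta>(1) p fin]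
            integrable_heat_mult_bounded[OF \<open>w \<in> borel_measurable borel\<close> M \<delta>(1)], of n y n y]
        by simp
      have "E n \<le> (\<integral>\<^sup>+y. ennreal (heat 1 y * norm (heat_conv (\<delta> n) (\<lambda>x. v x - w x) y))
          + (ennreal (heat 1 y * norm (v y - w y)) + ennreal (heat 1 y * norm (heat_conv (\<delta> n) w y - w y))) \<partial>lborel)"
        unfolding E_def
      proof (intro nn_integral_mono)
        fix y
        have "norm (heat_conv (\<delta> n) v y - v y) \<le> norm (heat_conv (\<delta> n) (\<lambda>x. v x - w x) y) + (norm (v y - w y) + norm (heat_conv (\<delta> n) w y - w y))"
          unfolding lin by norm
        from mult_left_mono[OF this heat_nonneg[of 1 y]]
        show "ennreal (heat 1 y * norm (heat_conv (\<delta> n) v y - v y)) \<le> ennreal (heat 1 y * norm (heat_conv (\<delta> n) (\<lambda>x. v x - w x) y))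
          + (ennreal (heat 1 y * norm (v y - w y)) + ennreal (heat 1 y * norm (heat_conv (\<delta> n) w y - w y)))"
          by (simp add: distrib_left ennreal_leI flip: ennreal_plus)
      qed
      also have "\<dots> = (\<integral>\<^sup>+y. ennreal (heat 1 y * norm (heat_conv (\<delta> n) (\<lambda>x. v x - w x) y)) \<partial>lborel)
          + ((\<integral>\<^sup>+y. ennreal (heat 1 y * norm (v y - w y)) \<partial>lborel) + (\<integral>\<^sup>+y. ennreal (heat 1 y * norm (heat_conv (\<delta> n) w y - w y)) \<partial>lborel))"
        by (simp add: nn_integral_add)
      also have "\<dots> \<le> ennreal (2 * \<eta>) + (ennreal (2 * \<eta>) + ennreal \<eta>)"
        using vw n0[OF n] p \<eta> \<delta>(1)[of n] by (intro add_mono nn_integral_weighted_heat_conv_le[where p = p and s = "\<delta> n"]) auto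
      also have "\<dots> = ennreal (5 * \<eta>)"
        using \<eta> by (simp flip: ennreal_plus)
      finally show "E n \<le> ennreal (5 * \<eta>)" .
    qed
  qed
  \<comment> \<open>Finiteness of \<open>E n\<close> is known for large \<open>n\<close> only, so
    the sequence is started at \<open>n1\<close> to have every \<open>u n\<close>
    integrable.\<close>
  obtain n1 where n1: "\<And>n. n1 \<le> n \<Longrightarrow> E n \<le> ennreal 5"
    using E_small[of 1] by auto
  define u where "u = (\<lambda>n y. of_real (heat 1 y) * (heat_conv (\<delta> (n + n1)) v y - v y))"
  have E_u: "(\<integral>\<^sup>+y. ennreal (norm (u n y)) \<partial>lborel) = E (n + n1)" for n
    by (simp add: u_def E_def norm_mult)
  have int: "integrable lborel (u n)" for n
  proof (rule integrableI_bounded)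
    show "(\<integral>\<^sup>+y. ennreal (norm (u n y)) \<partial>lborel) < \<infinity>"
      using n1[of "n + n1"] unfolding E_u by (auto intro: le_less_trans)
  qed (simp add: u_def)
  have "(\<lambda>n. LINT y|lborel. norm (u n y)) \<longlonglongrightarrow> 0"
  proof (rule LIMSEQ_I)
    fix e :: real assume "0 < e"
    then obtain n0 where n0: "\<And>n. n0 \<le> n \<Longrightarrow> E n \<le> ennreal (e / 2)"
      using E_small[of "e / 10"] by auto
    have "norm ((LINT y|lborel. norm (u n y)) - 0) < e" if "n0 \<le> n" for n
    proof -
      have "ennreal (LINT y|lborel. norm (u n y)) = E (n + n1)"
        using int[of n] unfolding E_u[symmetric] by (intro nn_integral_eq_integral[symmetric]) auto
      also have "\<dots> \<le> ennreal (e / 2)" using that by (intro n0) simp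
      finally have "(LINT y|lborel. norm (u n y)) \<le> e / 2" using \<open>0 < e\<close> by simp
      moreover have "0 \<le> (LINT y|lborel. norm (u n y))" by simp
      ultimately show ?thesis using \<open>0 < e\<close> by simp
    qed
    then show "\<exists>n0. \<forall>n\<ge>n0. norm ((LINT y|lborel. norm (u n y)) - 0) < e" by blast
  qed
  from tendsto_L1_AE_subseq[OF int this] obtain \<rho> :: "nat \<Rightarrow> nat" where \<rho>: "AE y in lborel. (\<lambda>n. u (\<rho> n) y) \<longlonglongrightarrow> 0"
    by blast
  show thesis
  proof (rule that)
    show "AE y in lborel. (\<lambda>n. heat_conv (\<delta> (\<rho> n + n1)) v y) \<longlonglongrightarrow> v y"
      using \<rho>
    proof eventually_elim
      case (elim y)
      have h: "heat 1 y \<noteq> 0" by (simp add: heat_def)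
      have "(\<lambda>n. of_real (1 / heat 1 y) * u (\<rho> n) y) \<longlonglongrightarrow> of_real (1 / heat 1 y) * 0"
        by (intro tendsto_intros elim)
      moreover have "of_real (1 / heat 1 y) * u (\<rho> n) y = heat_conv (\<delta> (\<rho> n + n1)) v y - v y" for n
        using h by (simp add: u_def)
      ultimately have "(\<lambda>n. heat_conv (\<delta> (\<rho> n + n1)) v y - v y) \<longlonglongrightarrow> 0" by simp
      then show ?case by (simp add: LIM_zero_iff)
    qed
  qed
qed

lemma nn_integral_powr_le_of_heat_conv:
  fixes v :: "'a::euclidean_space \<Rightarrow> complex"
  assumes [measurable]: "v \<in> borel_measurable borel" and p: "1 \<le> p" and q: "0 < q"
    and fin: "(\<integral>\<^sup>+x. ennreal (norm (v x) powr p) \<partial>lborel) < \<infinity>"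
    and le: "\<And>\<delta>. 0 < \<delta> \<Longrightarrow> (\<integral>\<^sup>+x. ennreal (norm (heat_conv \<delta> v x) powr q) \<partial>lborel) \<le> B"
  shows "(\<integral>\<^sup>+x. ennreal (norm (v x) powr q) \<partial>lborel) \<le> B"
proof -
  define \<delta> where "\<delta> = (\<lambda>n::nat. 1 / real (Suc n))"
  have \<delta>: "0 < \<delta> n" "\<delta> \<longlonglongrightarrow> 0" for n
    unfolding \<delta>_def using LIMSEQ_Suc[OF lim_1_over_n] by auto
  obtain \<rho> :: "nat \<Rightarrow> nat" where AE: "AE y in lborel. (\<lambda>n. heat_conv (\<delta> (\<rho> n)) v y) \<longlonglongrightarrow> v y"
    using heat_conv_AE_subseq[of v p \<delta>] p fin \<delta> by auto
  have "(\<integral>\<^sup>+x. ennreal (norm (v x) powr q) \<partial>lborel)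
      = (\<integral>\<^sup>+x. liminf (\<lambda>n. ennreal (norm (heat_conv (\<delta> (\<rho> n)) v x) powr q)) \<partial>lborel)"
  proof (rule nn_integral_cong_AE, use AE in eventually_elim)
    case (elim x)
    have "(\<lambda>n. norm (heat_conv (\<delta> (\<rho> n)) v x) powr q) \<longlonglongrightarrow> norm (v x) powr q"
      using q by (intro tendsto_powr' tendsto_norm elim tendsto_const) auto
    then have "(\<lambda>n. ennreal (norm (heat_conv (\<delta> (\<rho> n)) v x) powr q)) \<longlonglongrightarrow> ennreal (norm (v x) powr q)"
      by (rule tendsto_ennrealI)
    then show ?case by (intro lim_imp_Liminf[symmetric]) auto
  qed
  also have "\<dots> \<le> liminf (\<lambda>n. \<integral>\<^sup>+x. ennreal (norm (heat_conv (\<delta> (\<rho> n)) v x) powr q) \<partial>lborel)"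
    by (rule nn_integral_liminf) measurable
  also have "\<dots> \<le> liminf (\<lambda>n::nat. B)"
    by (intro Liminf_mono always_eventually allI le \<delta>)
  also have "\<dots> = B" by (simp add: Liminf_const)
  finally show ?thesis .
qed

section \<open>Gagliardo--Nirenberg inequalities for Borel functions\<close>

text \<open>The bound of \<open>nn_integral_heat_conv_powr_le\<close> has the same right side for
  every \<open>\<delta>\<close>, so it survives the limit; the weight \<open>\<omega>\<close> is
  still free.\<close>

lemma gagliardo_nirenberg_family:
  fixes v g :: "'a::euclidean_space \<Rightarrow> complex" and p r k V G n a w d q \<omega> :: real
  defines "n \<equiv> real DIM('a) / 2" and "a \<equiv> p * k / n" and "w \<equiv> \<omega> * k / (n - k)"
  defines "q \<equiv> 1 + a * (1 - \<omega>) + w * (1 + (1 + a) * (r - 1)) + (1 + a) * (r - 1)"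
  assumes [measurable]: "v \<in> borel_measurable borel" "g \<in> borel_measurable borel"
    and p: "1 \<le> p" and r: "1 < r" and k: "0 < k" "k < 1" "k < n" and \<omega>: "0 \<le> \<omega>" "\<omega> \<le> 1"
    and V: "0 < V" "(\<integral>\<^sup>+x. ennreal (norm (v x) powr p) \<partial>lborel) \<le> ennreal (V powr p)"
    and G: "0 < G" "(\<integral>\<^sup>+x. ennreal (norm (g x) powr r) \<partial>lborel) \<le> ennreal (G powr r)"
    and eq: "\<And>s y. 0 < s \<Longrightarrow> heat_conv s g y = (LINT x|lborel. v x * frac_heat (2 * k) s (x - y))"
  shows "(\<integral>\<^sup>+y. ennreal (norm (v y) powr q) \<partial>lborel)
    \<le> ennreal (gn_const k n r a w q * (8 * V) powr (a * (1 - \<omega>) + a * (r - 1) * (1 + w)) * G powr (r * (1 + w)))"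
proof (rule nn_integral_powr_le_of_heat_conv[where p = p])
  show fin: "(\<integral>\<^sup>+x. ennreal (norm (v x) powr p) \<partial>lborel) < \<infinity>"
    using V(2) by (rule le_less_trans) simp
  have a: "0 \<le> a" "0 \<le> w" using p k \<omega> by (auto simp: a_def w_def)
  then show "0 < q"
    unfolding q_def using r \<omega> by (intro add_pos_nonneg) (auto intro!: mult_nonneg_nonneg add_nonneg_nonneg)
  fix \<delta> :: real assume \<delta>: "0 < \<delta>"
  interpret heat_pair v g p r k V G \<delta>
  proof
    show "complex_of_real (Gamma k) * (heat_conv \<delta> v y - heat_conv (t + \<delta>) v y)
      = (LINT s|lborel. of_real (riesz_weight k t s) * heat_conv (s + \<delta>) g y)" if "0 < t" for t y
      using heat_conv_diff_eq[OF assms(5) fin p, of "2 * k" t \<delta> g y] k \<delta> that eq by simp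
  qed (use assms \<delta> in \<open>auto simp: n_def\<close>)
  show "(\<integral>\<^sup>+y. ennreal (norm (heat_conv \<delta> v y) powr q) \<partial>lborel)
    \<le> ennreal (gn_const k n r a w q * (8 * V) powr (a * (1 - \<omega>) + a * (r - 1) * (1 + w)) * G powr (r * (1 + w)))"
    using nn_integral_heat_conv_powr_le[OF \<omega>] unfolding n_def a_def w_def q_def by (simp add: add.assoc)
qed (use p in auto)

text \<open>Young's inequality is applied pointwise to \<open>f / F\<close> and
  \<open>h / H\<close>. After integration the two terms have weights \<open>1 - \<tau>\<close> and
  \<open>\<tau>\<close>, so no constant is lost.\<close>

lemma nn_integral_interpolation:
  fixes f h :: "'a \<Rightarrow> real"
  assumes [measurable]: "f \<in> borel_measurable M" "h \<in> borel_measurable M"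
    and nonneg: "\<And>x. 0 \<le> f x" "\<And>x. 0 \<le> h x" and \<tau>: "0 < \<tau>" "\<tau> < 1" and F: "0 < F" "0 < H"
    and f: "(\<integral>\<^sup>+x. ennreal (f x) \<partial>M) \<le> ennreal F" and h: "(\<integral>\<^sup>+x. ennreal (h x) \<partial>M) \<le> ennreal H"
  shows "(\<integral>\<^sup>+x. ennreal (f x powr (1 - \<tau>) * h x powr \<tau>) \<partial>M) \<le> ennreal (F powr (1 - \<tau>) * H powr \<tau>)"
proof -
  define c where "c = F powr (1 - \<tau>) * H powr \<tau>"
  have c: "0 < c" using F by (simp add: c_def)
  have le: "f x powr (1 - \<tau>) * h x powr \<tau> \<le> c * (1 - \<tau>) / F * f x + c * \<tau> / H * h x" for x
  proof (cases "f x = 0 \<or> h x = 0")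
    case True
    then show ?thesis using nonneg[of x] F \<tau> c by auto
  next
    case False
    then have pos: "0 < f x" "0 < h x" using nonneg[of x] by (auto simp: order_less_le)
    have "f x powr (1 - \<tau>) * h x powr \<tau> = c * ((f x / F) powr (1 - \<tau>) * (h x / H) powr \<tau>)"
      using pos F by (simp add: c_def powr_divide)
    also have "\<dots> \<le> c * ((1 - \<tau>) * (f x / F) + \<tau> * (h x / H))"
      using pos F \<tau> c by (intro mult_left_mono Youngs_inequality_0) auto
    finally show ?thesis by (simp add: distrib_left)
  qed
  have "(\<integral>\<^sup>+x. ennreal (f x powr (1 - \<tau>) * h x powr \<tau>) \<partial>M)
      \<le> (\<integral>\<^sup>+x. ennreal (c * (1 - \<tau>) / F) * ennreal (f x) + ennreal (c * \<tau> / H) * ennreal (h x) \<partial>M)"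
    using le nonneg F \<tau> c by (intro nn_integral_mono) (simp add: ennreal_mult''[symmetric] ennreal_leI flip: ennreal_plus)
  also have "\<dots> = ennreal (c * (1 - \<tau>) / F) * (\<integral>\<^sup>+x. ennreal (f x) \<partial>M) + ennreal (c * \<tau> / H) * (\<integral>\<^sup>+x. ennreal (h x) \<partial>M)"
    by (subst nn_integral_add) (auto simp: nn_integral_cmult)
  also have "\<dots> \<le> ennreal (c * (1 - \<tau>) / F) * ennreal F + ennreal (c * \<tau> / H) * ennreal H"
    by (intro add_mono mult_left_mono f h) auto
  also have "\<dots> = ennreal (c * (1 - \<tau>) + c * \<tau>)"
    using F \<tau> c by (simp add: ennreal_mult''[symmetric] flip: ennreal_plus)
  also have "c * (1 - \<tau>) + c * \<tau> = c" by (simp add: algebra_simps)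
  finally show ?thesis by (simp add: c_def)
qed

text \<open>The conclusion is the inequality of the theorem raised to the power
  \<open>\<rho>\<close>. In terms of \<open>\<rho>\<close> one has
  \<open>k / (n - k) = \<rho> - 1\<close> and \<open>a = p - p / \<rho>\<close>, which turns the
  matching of exponents into identities between rational functions of \<open>p\<close>,
  \<open>r\<close> and \<open>\<rho>\<close>.\<close>

lemma gagliardo_nirenberg_lborel:
  fixes p r \<gamma> \<alpha> r2 N \<rho> :: real
  assumes N: "N = real DIM('a::euclidean_space)" and p: "1 \<le> p" and r: "1 < r" and \<gamma>: "0 < \<gamma>" "\<gamma> < min N 2"
    and r2: "r2 = N * (r * p + r - p) / (r * (N - \<gamma>))" and \<alpha>: "\<alpha> = p * (r - 1) / r" and \<rho>: "\<rho> = N / (N - \<gamma>)"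
  obtains K where "0 < K" "\<And>(v :: 'a \<Rightarrow> complex) g V G. v \<in> borel_measurable borel \<Longrightarrow> g \<in> borel_measurable borel \<Longrightarrow>
     0 < V \<Longrightarrow> 0 < G \<Longrightarrow> (\<integral>\<^sup>+x. ennreal (norm (v x) powr p) \<partial>lborel) \<le> ennreal (V powr p) \<Longrightarrow>
     (\<integral>\<^sup>+x. ennreal (norm (g x) powr r) \<partial>lborel) \<le> ennreal (G powr r) \<Longrightarrow>
     (\<And>s y. 0 < s \<Longrightarrow> heat_conv s g y = (LINT x|lborel. v x * frac_heat \<gamma> s (x - y))) \<Longrightarrow>
     (\<integral>\<^sup>+x. ennreal (norm (v x) powr r2) \<partial>lborel) \<le> ennreal (K * V powr (\<rho> * \<alpha>) * G powr \<rho>)"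
proof -
  define k where "k = \<gamma> / 2"
  define n where "n = real DIM('a) / 2"
  have Nn: "N = 2 * n" "\<gamma> = 2 * k" using N by (auto simp: n_def k_def)
  have k: "0 < k" "k < 1" "k < n" using \<gamma> by (auto simp: Nn)
  have n: "0 < n" using k by simp
  define a where "a = p * k / n"
  have \<rho>': "\<rho> = n / (n - k)" using k by (simp add: \<rho> Nn field_simps)
  have \<rho>1: "1 < \<rho>" using k n by (simp add: \<rho>')
  have a_\<rho>: "a = p - p / \<rho>" using k n by (simp add: a_def \<rho>' field_simps)
  have k_\<rho>: "k / (n - k) = \<rho> - 1" using k by (simp add: \<rho>' field_simps)
  have r2_\<rho>: "r2 = \<rho> * (r * p + r - p) / r" using k r by (simp add: r2 \<rho> Nn field_simps)
  \<comment> \<open>The maximum with 1 provides a positive constant without discussing the sign of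
    \<open>gn_const\<close>.\<close>
  have max1: "ennreal (c * x) \<le> ennreal (max 1 c * x)" if "0 \<le> x" for c x :: real
    using that by (intro ennreal_leI mult_right_mono) auto
  show thesis
  proof (cases "r \<le> \<rho>")
    case True
    \<comment> \<open>Forced by the power of \<open>G\<close>, which has to satisfy
      \<open>r * (1 + w) = \<rho>\<close>. The relation \<open>w = \<omega> * (\<rho> - 1)\<close>
      then fixes \<open>\<omega>\<close>, where \<open>r \<le> \<rho>\<close> gives
      \<open>0 \<le> \<omega>\<close> and \<open>r > 1\<close> gives
      \<open>\<omega> \<le> 1\<close>.\<close>
    define w where "w = \<rho> / r - 1"
    have w: "0 \<le> w" "w \<le> \<rho> - 1" using True r \<rho>1 by (auto simp: w_def field_simps)
    define \<omega> where "\<omega> = w / (\<rho> - 1)"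
    have \<omega>: "0 \<le> \<omega>" "\<omega> \<le> 1" using w \<rho>1 by (auto simp: \<omega>_def)
    have w_eq: "\<omega> * k / (n - k) = w"
      unfolding times_divide_eq_right[symmetric] k_\<rho> \<omega>_def using \<rho>1 by simp
    have a\<omega>: "a * \<omega> = p * w / \<rho>" using \<rho>1 by (simp add: \<omega>_def a_\<rho> field_simps)
    have q: "1 + a * (1 - \<omega>) + w * (1 + (1 + a) * (r - 1)) + (1 + a) * (r - 1) = r2"
    proof -
      have "1 + a * (1 - \<omega>) + w * (1 + (1 + a) * (r - 1)) + (1 + a) * (r - 1)
        = 1 + a - a * \<omega> + w + (w + 1) * ((1 + a) * (r - 1))" by (simp add: algebra_simps)
      also have "\<dots> = r2"
        unfolding a\<omega> unfolding a_\<rho> r2_\<rho> w_def using r \<rho>1 by (simp add: field_simps)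
      finally show ?thesis .
    qed
    have x: "a * (1 - \<omega>) + a * (r - 1) * (1 + w) = \<rho> * \<alpha>"
    proof -
      have "a * (1 - \<omega>) + a * (r - 1) * (1 + w) = a - a * \<omega> + a * ((r - 1) * (1 + w))" by (simp add: algebra_simps)
      also have "\<dots> = \<rho> * \<alpha>"
        unfolding a\<omega> unfolding a_\<rho> \<alpha> w_def using r \<rho>1 by (simp add: field_simps)
      finally show ?thesis .
    qed
    have rw: "r * (1 + w) = \<rho>" using r by (simp add: w_def)
    show thesis
    proof (rule that)
      show "0 < max 1 (gn_const k n r a w r2 * 8 powr (\<rho> * \<alpha>))" by simp
      fix v g :: "'a \<Rightarrow> complex" and V G :: real
      assume *: "v \<in> borel_measurable borel" "g \<in> borel_measurable borel" "0 < V" "0 < G"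
         "(\<integral>\<^sup>+x. ennreal (norm (v x) powr p) \<partial>lborel) \<le> ennreal (V powr p)"
         "(\<integral>\<^sup>+x. ennreal (norm (g x) powr r) \<partial>lborel) \<le> ennreal (G powr r)"
         "\<And>s y. 0 < s \<Longrightarrow> heat_conv s g y = (LINT x|lborel. v x * frac_heat \<gamma> s (x - y))"
      have "(\<integral>\<^sup>+x. ennreal (norm (v x) powr r2) \<partial>lborel) \<le> ennreal (gn_const k n r a w r2 * (8 * V) powr (\<rho> * \<alpha>) * G powr \<rho>)"
        using gagliardo_nirenberg_family[OF *(1,2) p r k[unfolded n_def] \<omega> *(3,5,4,6)] *(7)
        unfolding n_def[symmetric] a_def[symmetric] w_eq q x rw Nn(2)[symmetric] by blast
      also have "\<dots> = ennreal (gn_const k n r a w r2 * 8 powr (\<rho> * \<alpha>) * (V powr (\<rho> * \<alpha>) * G powr \<rho>))"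
        using * by (simp add: powr_mult mult_ac)
      also have "\<dots> \<le> ennreal (max 1 (gn_const k n r a w r2 * 8 powr (\<rho> * \<alpha>)) * (V powr (\<rho> * \<alpha>) * G powr \<rho>))"
        by (rule max1) simp
      finally show "(\<integral>\<^sup>+x. ennreal (norm (v x) powr r2) \<partial>lborel)
        \<le> ennreal (max 1 (gn_const k n r a w r2 * 8 powr (\<rho> * \<alpha>)) * V powr (\<rho> * \<alpha>) * G powr \<rho>)"
        by (simp only: mult.assoc)
    qed
  next
    case False
    \<comment> \<open>now \<open>r2\<close> lies between \<open>p\<close> and the exponent obtained for \<open>\<omega> = 0\<close>\<close>
    define \<tau> where "\<tau> = \<rho> / r"
    have \<tau>: "0 < \<tau>" "\<tau> < 1" using False r \<rho>1 by (auto simp: \<tau>_def)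
    define q where "q = r * (1 + a)"
    have q_eq: "1 + a * (1 - 0) + 0 * (1 + (1 + a) * (r - 1)) + (1 + a) * (r - 1) = q"
      by (simp add: q_def algebra_simps)
    have r2_\<tau>: "r2 = p * (1 - \<tau>) + q * \<tau>"
      unfolding r2_\<rho> q_def \<tau>_def a_\<rho> using r \<rho>1 by (simp add: field_simps)
    \<comment> \<open>The weight \<open>\<tau>\<close> is dictated by the power of \<open>G\<close>,
      namely \<open>r * \<tau> = \<rho>\<close>; with it the power of \<open>V\<close> comes out as
      required.\<close>
    have x: "p * (1 - \<tau>) + a * r * \<tau> = \<rho> * \<alpha>"
      unfolding \<alpha> \<tau>_def a_\<rho> using r \<rho>1 by (simp add: field_simps)
    define c where "c = max 1 (gn_const k n r a 0 q * 8 powr (a * r))"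
    have c: "0 < c" by (simp add: c_def)
    show thesis
    proof (rule that)
      show "0 < c powr \<tau>" using c by simp
      fix v g :: "'a \<Rightarrow> complex" and V G :: real
      assume *: "v \<in> borel_measurable borel" "g \<in> borel_measurable borel" "0 < V" "0 < G"
         "(\<integral>\<^sup>+x. ennreal (norm (v x) powr p) \<partial>lborel) \<le> ennreal (V powr p)"
         "(\<integral>\<^sup>+x. ennreal (norm (g x) powr r) \<partial>lborel) \<le> ennreal (G powr r)"
         "\<And>s y. 0 < s \<Longrightarrow> heat_conv s g y = (LINT x|lborel. v x * frac_heat \<gamma> s (x - y))"
      note [measurable] = *(1)
      have x0: "a * (1 - 0) + a * (r - 1) * (1 + 0) = a * r" "r * (1 + 0) = r" "0 * k / (n - k) = 0"
        by (simp_all add: algebra_simps)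
      have "(\<integral>\<^sup>+x. ennreal (norm (v x) powr q) \<partial>lborel) \<le> ennreal (gn_const k n r a 0 q * (8 * V) powr (a * r) * G powr r)"
        using gagliardo_nirenberg_family[OF *(1,2) p r k[unfolded n_def] order_refl zero_le_one *(3,5,4,6)] *(7)
        unfolding n_def[symmetric] a_def[symmetric] x0 q_eq Nn(2)[symmetric] by blast
      also have "\<dots> = ennreal (gn_const k n r a 0 q * 8 powr (a * r) * (V powr (a * r) * G powr r))"
        using * by (simp add: powr_mult mult_ac)
      also have "\<dots> \<le> ennreal (c * (V powr (a * r) * G powr r))"
        unfolding c_def by (rule max1) simp
      finally have h: "(\<integral>\<^sup>+x. ennreal (norm (v x) powr q) \<partial>lborel) \<le> ennreal (c * (V powr (a * r) * G powr r))" .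
      have "(\<integral>\<^sup>+x. ennreal (norm (v x) powr r2) \<partial>lborel)
        = (\<integral>\<^sup>+x. ennreal ((norm (v x) powr p) powr (1 - \<tau>) * (norm (v x) powr q) powr \<tau>) \<partial>lborel)"
        by (simp add: powr_powr r2_\<tau> powr_add)
      also have "\<dots> \<le> ennreal ((V powr p) powr (1 - \<tau>) * (c * (V powr (a * r) * G powr r)) powr \<tau>)"
        using * c \<tau> by (intro nn_integral_interpolation h) auto
      also have "(V powr p) powr (1 - \<tau>) * (c * (V powr (a * r) * G powr r)) powr \<tau>
         = c powr \<tau> * (V powr (p * (1 - \<tau>)) * V powr (a * r * \<tau>)) * G powr (r * \<tau>)"
        using * c by (simp add: powr_mult powr_powr mult_ac)
      also have "V powr (p * (1 - \<tau>)) * V powr (a * r * \<tau>) = V powr (\<rho> * \<alpha>)"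
        by (simp only: powr_add[symmetric] x)
      also have "r * \<tau> = \<rho>" using r by (simp add: \<tau>_def)
      finally show "(\<integral>\<^sup>+x. ennreal (norm (v x) powr r2) \<partial>lborel) \<le> ennreal (c powr \<tau> * V powr (\<rho> * \<alpha>) * G powr \<rho>)" .
    qed
  qed
qed

section \<open>Gaussian test functions\<close>

text \<open>Polynomials in the coordinates, generated inductively so that both facts needed, closure
  under partial derivatives and polynomial growth, follow by rule induction.\<close>

inductive poly_fun :: "(real ^ 'n::finite \<Rightarrow> complex) \<Rightarrow> bool" where
  const: "poly_fun (\<lambda>x. c)"
| coord: "poly_fun (\<lambda>x. of_real (x $ i))"
| add: "poly_fun P \<Longrightarrow> poly_fun Q \<Longrightarrow> poly_fun (\<lambda>x. P x + Q x)"
| mult: "poly_fun P \<Longrightarrow> poly_fun Q \<Longrightarrow> poly_fun (\<lambda>x. P x * Q x)"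

lemma poly_fun_derivative:
  fixes P :: "real ^ 'n::finite \<Rightarrow> complex"
  shows "poly_fun P \<Longrightarrow> \<exists>D. (\<forall>x. (P has_derivative D x) (at x)) \<and> (\<forall>i. poly_fun (\<lambda>x. D x (axis i 1)))"
proof (induction rule: poly_fun.induct)
  case (const c)
  show ?case by (intro exI[of _ "\<lambda>x h. 0"]) (auto intro: poly_fun.const)
next
  case (coord i)
  have "((\<lambda>x::real^'n. complex_of_real (x $ i)) has_derivative (\<lambda>h. of_real (h $ i))) (at x)" for x
    by (intro bounded_linear_imp_has_derivative bounded_linear_compose[OF bounded_linear_of_real bounded_linear_vec_nth])
  then show ?case
    by (intro exI[of _ "\<lambda>x h. of_real (h $ i)"]) (auto intro: poly_fun.const)
next
  case (add P Q)
  then obtain D E where "\<And>x. (P has_derivative D x) (at x)" "\<And>i. poly_fun (\<lambda>x. D x (axis i 1))"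
    "\<And>x. (Q has_derivative E x) (at x)" "\<And>i. poly_fun (\<lambda>x. E x (axis i 1))" by blast
  then show ?case
    by (intro exI[of _ "\<lambda>x h. D x h + E x h"]) (auto intro: poly_fun.add has_derivative_add)
next
  case (mult P Q)
  then obtain D E where "\<And>x. (P has_derivative D x) (at x)" "\<And>i. poly_fun (\<lambda>x. D x (axis i 1))"
    "\<And>x. (Q has_derivative E x) (at x)" "\<And>i. poly_fun (\<lambda>x. E x (axis i 1))" by blast
  then show ?case using mult.hyps
    by (intro exI[of _ "\<lambda>x h. P x * E x h + D x h * Q x"]) (auto intro!: poly_fun.add poly_fun.mult has_derivative_mult)
qed

lemma poly_fun_bound:
  fixes P :: "real ^ 'n::finite \<Rightarrow> complex"
  shows "poly_fun P \<Longrightarrow> \<exists>C m. 0 \<le> C \<and> (\<forall>x. norm (P x) \<le> C * (1 + norm x) ^ m)"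
proof (induction rule: poly_fun.induct)
  case (const c)
  show ?case by (intro exI[of _ "norm c"] exI[of _ 0]) auto
next
  case (coord i)
  have "norm (complex_of_real (x $ i)) \<le> 1 * (1 + norm x) ^ 1" for x :: "real^'n"
    using component_le_norm_cart[of x i] by simp
  then show ?case by (intro exI[of _ 1] exI[of _ 1]) auto
next
  case (add P Q)
  then obtain C m D k where C: "0 \<le> C" "\<And>x. norm (P x) \<le> C * (1 + norm x) ^ m"
    and D: "0 \<le> D" "\<And>x. norm (Q x) \<le> D * (1 + norm x) ^ k" by blast
  have "norm (P x + Q x) \<le> (C + D) * (1 + norm x) ^ (m + k)" for x
  proof -
    have "C * (1 + norm x) ^ m \<le> C * (1 + norm x) ^ (m + k)" "D * (1 + norm x) ^ k \<le> D * (1 + norm x) ^ (m + k)"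
      using C D by (auto intro!: mult_left_mono power_increasing)
    then show ?thesis using norm_triangle_ineq[of "P x" "Q x"] C(2)[of x] D(2)[of x] by (simp add: distrib_right)
  qed
  then show ?case using C D by (intro exI[of _ "C + D"] exI[of _ "m + k"]) auto
next
  case (mult P Q)
  then obtain C m D k where C: "0 \<le> C" "\<And>x. norm (P x) \<le> C * (1 + norm x) ^ m"
    and D: "0 \<le> D" "\<And>x. norm (Q x) \<le> D * (1 + norm x) ^ k" by blast
  have "norm (P x * Q x) \<le> (C * D) * (1 + norm x) ^ (m + k)" for x
  proof -
    have "norm (P x * Q x) \<le> (C * (1 + norm x) ^ m) * (D * (1 + norm x) ^ k)"
      unfolding norm_mult using C D by (intro mult_mono) auto
    then show ?thesis by (simp add: power_add mult_ac)
  qed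
  then show ?case using C D by (intro exI[of _ "C * D"] exI[of _ "m + k"]) auto
qed

text \<open>The modulation by \<open>y\<close> moves the centre of the Fourier transform, so pairing
  with it evaluates a heat extension at \<open>y\<close>. The single exponential makes each
  derivative a linear factor times the function itself.\<close>

definition gauss_wave :: "real \<Rightarrow> real ^ 'n::finite \<Rightarrow> real ^ 'n \<Rightarrow> complex" where
  "gauss_wave s y \<xi> = exp (\<i> * of_real (\<xi> \<bullet> y) - of_real (s * (\<xi> \<bullet> \<xi>)))"

lemma gauss_wave_derivative:
  "(gauss_wave s y has_derivative (\<lambda>h. (\<i> * of_real (h \<bullet> y) - of_real (2 * s * (\<xi> \<bullet> h))) * gauss_wave s y \<xi>)) (at \<xi>)"
proof -
  have "((\<lambda>\<xi>. \<i> * of_real (\<xi> \<bullet> y) - of_real (s * (\<xi> \<bullet> \<xi>)))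
      has_derivative (\<lambda>h. \<i> * of_real (h \<bullet> y) - of_real (2 * s * (\<xi> \<bullet> h)))) (at \<xi>)"
    by (rule derivative_eq_intros refl)+ (auto simp: inner_commute algebra_simps)
  from has_derivative_compose[OF this DERIV_exp[unfolded has_field_derivative_def]]
  show ?thesis unfolding gauss_wave_def[abs_def] by (simp add: mult.commute)
qed

lemma partial_derivs_gauss_wave:
  "\<exists>P. poly_fun P \<and> partial_derivs is (gauss_wave s y) = (\<lambda>\<xi>. P \<xi> * gauss_wave s y \<xi>)"
proof (induction "is")
  case Nil
  show ?case by (intro exI[of _ "\<lambda>x. 1"]) (auto intro: poly_fun.const)
next
  case (Cons i "is")
  then obtain P where P: "poly_fun P" "partial_derivs is (gauss_wave s y) = (\<lambda>\<xi>. P \<xi> * gauss_wave s y \<xi>)" by blast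
  from poly_fun_derivative[OF P(1)] obtain D where D: "\<And>x. (P has_derivative D x) (at x)" "\<And>i. poly_fun (\<lambda>x. D x (axis i 1))" by blast
  define Q where "Q = (\<lambda>\<xi>. P \<xi> * ((\<i> * of_real (y $ i)) + of_real (- 2 * s) * of_real (\<xi> $ i)) + D \<xi> (axis i 1))"
  have "poly_fun Q"
    unfolding Q_def by (intro poly_fun.intros P D)
  moreover have "partial_deriv i (\<lambda>\<xi>. P \<xi> * gauss_wave s y \<xi>) \<xi> = Q \<xi> * gauss_wave s y \<xi>" for \<xi>
    unfolding partial_deriv_def
    by (subst frechet_derivative_at[OF has_derivative_mult[OF D(1) gauss_wave_derivative], symmetric])
       (simp add: Q_def inner_axis inner_axis' algebra_simps)
  ultimately show ?case using P(2) by (intro exI[of _ Q]) auto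
qed

text \<open>The left side, divided by \<open>fact m\<close>, is one term of the exponential series,
  whose terms are all nonnegative.\<close>

lemma power_le_fact_exp:
  fixes x :: real
  assumes "0 \<le> x"
  shows "x ^ m \<le> fact m * exp x"
proof -
  have "(\<Sum>i\<in>{m}. x ^ i /\<^sub>R fact i) \<le> (\<Sum>i. x ^ i /\<^sub>R fact i)"
    using assms by (intro sum_le_suminf summable_exp_generic) auto
  then show ?thesis by (simp add: exp_def field_simps)
qed

lemma gauss_wave_schwartz:
  assumes s: "0 < s"
  shows "gauss_wave s y \<in> schwartz"
  unfolding schwartz_def
proof (intro CollectI allI conjI)
  fix "is" :: "'a list"
  obtain P where P: "poly_fun P" "partial_derivs is (gauss_wave s y) = (\<lambda>\<xi>. P \<xi> * gauss_wave s y \<xi>)"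
    using partial_derivs_gauss_wave by blast
  show "partial_derivs is (gauss_wave s y) differentiable (at x)" for x
    using poly_fun_derivative[OF P(1)] gauss_wave_derivative unfolding P(2) differentiable_def
    by (blast intro: has_derivative_mult)
  obtain C m where C: "0 \<le> C" "\<And>x. norm (P x) \<le> C * (1 + norm x) ^ m"
    using poly_fun_bound[OF P(1)] by blast
  fix k :: nat
  show "bounded (range (\<lambda>x. norm x ^ k *\<^sub>R partial_derivs is (gauss_wave s y) x))"
    unfolding bounded_iff P(2)
  proof (intro exI ballI, elim rangeE, hypsubst)
    fix x :: "real ^ 'a"
    define t where "t = norm x"
    have t: "0 \<le> t" by (simp add: t_def)
    have gw: "norm (gauss_wave s y x) = exp (- s * t\<^sup>2)"
      by (simp add: gauss_wave_def t_def power2_norm_eq_inner)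
    have "norm (norm x ^ k *\<^sub>R (P x * gauss_wave s y x)) = t ^ k * norm (P x) * exp (- s * t\<^sup>2)"
      by (simp add: norm_mult gw t_def)
    also have "\<dots> \<le> (1 + t) ^ k * (C * (1 + t) ^ m) * exp (- s * t\<^sup>2)"
      using C t by (intro mult_right_mono mult_mono power_mono) (auto simp: t_def)
    also have "\<dots> = C * ((1 + t) ^ (k + m) * exp (- s * t\<^sup>2))"
      by (simp add: power_add mult_ac)
    also have "\<dots> \<le> C * (fact (k + m) * exp (1 + t) * exp (- s * t\<^sup>2))"
      using C t by (intro mult_left_mono mult_right_mono power_le_fact_exp) auto
    also have "\<dots> \<le> C * (fact (k + m) * exp (1 + 1 / (4 * s)))"
    proof -
      \<comment> \<open>Completing the square: \<open>t - s * t^2\<close> is at most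
        \<open>1 / (4 * s)\<close>, which makes the bound uniform in \<open>x\<close>.\<close>
      have "0 \<le> (2 * s * t - 1)\<^sup>2 / (4 * s)" using s by simp
      also have "(2 * s * t - 1)\<^sup>2 / (4 * s) = s * t\<^sup>2 - t + 1 / (4 * s)"
        using s by (simp add: power2_diff power_mult_distrib field_simps) (simp add: power2_eq_square)
      finally have "exp (1 + t) * exp (- s * t\<^sup>2) \<le> exp (1 + 1 / (4 * s))"
        by (simp add: exp_add[symmetric])
      then show ?thesis
        unfolding mult.assoc using C by (intro mult_left_mono) auto
    qed
    finally show "norm (norm x ^ k *\<^sub>R (P x * gauss_wave s y x)) \<le> C * (fact (k + m) * exp (1 + 1 / (4 * s)))" .
  qed
qed

section \<open>From Lebesgue measurable functions to Borel representatives\<close>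

lemma completion_ex_borel_measurable_complex:
  fixes f :: "'a \<Rightarrow> complex"
  assumes [measurable]: "f \<in> borel_measurable (completion M)"
  obtains f' where "f' \<in> borel_measurable M" "AE x in M. f x = f' x"
proof -
  obtain a where a: "a \<in> borel_measurable M" "AE x in M. Re (f x) = a x"
    using completion_ex_borel_measurable_real[of "\<lambda>x. Re (f x)" M] by auto
  obtain b where b: "b \<in> borel_measurable M" "AE x in M. Im (f x) = b x"
    using completion_ex_borel_measurable_real[of "\<lambda>x. Im (f x)" M] by auto
  show thesis
  proof (rule that)
    show "(\<lambda>x. Complex (a x) (b x)) \<in> borel_measurable M"
      using a(1) b(1) unfolding Complex_eq by measurable
    show "AE x in M. f x = Complex (a x) (b x)"
      using a(2) b(2) by eventually_elim (simp add: complex_eq_iff)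
  qed
qed

lemma exp_mult_gauss_wave:
  "exp (- \<i> * of_real (\<xi> \<bullet> x)) * gauss_wave s y \<xi>
    = exp (- \<i> * of_real ((x - y) \<bullet> \<xi>)) * of_real (exp (- s * (norm \<xi>)\<^sup>2))"
proof -
  have "gauss_wave s y \<xi> = exp (\<i> * of_real (\<xi> \<bullet> y)) * of_real (exp (- s * (norm \<xi>)\<^sup>2))"
    by (simp add: gauss_wave_def exp_diff exp_minus power2_norm_eq_inner divide_inverse exp_of_real flip: exp_of_real)
  moreover have "exp (- \<i> * of_real ((x - y) \<bullet> \<xi>)) = exp (- \<i> * of_real (\<xi> \<bullet> x)) * exp (\<i> * of_real (\<xi> \<bullet> y))"
    by (simp add: exp_add[symmetric] inner_diff_left inner_commute algebra_simps)
  ultimately show ?thesis by simp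
qed

lemma fourier_frac_gauss_wave:
  fixes y :: "real ^ 'n::finite"
  shows "fourier (\<lambda>\<xi>. of_real (norm \<xi> powr \<gamma>) * gauss_wave s y \<xi>) x
    = of_real ((2 * pi) ^ CARD('n)) * frac_heat \<gamma> s (x - y)"
proof -
  have *: "exp (- \<i> * of_real (\<xi> \<bullet> x)) * (of_real (norm \<xi> powr \<gamma>) * gauss_wave s y \<xi>)
      = exp (- \<i> * of_real ((x - y) \<bullet> \<xi>)) * of_real (norm \<xi> powr \<gamma> * exp (- s * (norm \<xi>)\<^sup>2))" for \<xi>
    using exp_mult_gauss_wave[of \<xi> x s y] by (simp add: mult.left_commute)
  have "fourier (\<lambda>\<xi>. of_real (norm \<xi> powr \<gamma>) * gauss_wave s y \<xi>) x
    = (LINT \<xi>|lborel. exp (- \<i> * of_real ((x - y) \<bullet> \<xi>)) * of_real (norm \<xi> powr \<gamma> * exp (- s * (norm \<xi>)\<^sup>2)))"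
    unfolding fourier_def inner_commute[of x] * by (rule integral_completion) measurable
  then show ?thesis by (simp add: frac_heat_def)
qed

lemma fourier_gauss_wave:
  fixes y :: "real ^ 'n::finite"
  assumes "0 < s"
  shows "fourier (gauss_wave s y) x = of_real ((2 * pi) ^ CARD('n)) * of_real (heat s (x - y))"
proof -
  have "fourier (gauss_wave s y) x
    = (LINT \<xi>|lborel. exp (- \<i> * of_real ((x - y) \<bullet> \<xi>)) * of_real (exp (- s * (norm \<xi>)\<^sup>2)))"
    unfolding fourier_def inner_commute[of x] exp_mult_gauss_wave by (rule integral_completion) measurable
  also have "\<dots> = of_real ((2 * pi) ^ CARD('n)) * of_real (heat s (x - y))"
    using fourier_gaussian(2)[OF assms, of "x - y"] by simp
  finally show ?thesis .
qed

text \<open>The distributional definition is exploited for the test functions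
  \<open>gauss_wave s y\<close> alone. Their transforms are heat kernels on the side of
  \<open>g\<close> and the kernels \<open>frac_heat\<close> on the side of \<open>v\<close>, with
  the same factor \<open>(2 * pi) ^ CARD('n)\<close>, which cancels.\<close>

lemma is_frac_laplacian_heat_conv:
  fixes v g v' g' :: "real ^ 'n::finite \<Rightarrow> complex"
  assumes lap: "is_frac_laplacian \<gamma> v g" and s: "0 < s"
    and m [measurable]: "v \<in> borel_measurable lebesgue" "g \<in> borel_measurable lebesgue"
      "v' \<in> borel_measurable borel" "g' \<in> borel_measurable borel"
    and ae: "AE x in lborel. v x = v' x" "AE x in lborel. g x = g' x"
  shows "heat_conv s g' y = (LINT x|lborel. v' x * frac_heat \<gamma> s (x - y))"
proof -
  have swap: "(LINT x|lebesgue. u x * h x) = (LINT x|lborel. u' x * h x)"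
    if [measurable]: "u \<in> borel_measurable lebesgue" "u' \<in> borel_measurable borel" "h \<in> borel_measurable borel"
      and u: "AE x in lborel. u x = u' x" for u u' h :: "real ^ 'n \<Rightarrow> complex"
  proof -
    have [measurable]: "u' \<in> borel_measurable lebesgue" "h \<in> borel_measurable lebesgue"
      by (simp_all add: measurable_completion)
    have "(LINT x|lebesgue. u x * h x) = (LINT x|lebesgue. u' x * h x)"
      using AE_completion[OF u] by (intro integral_cong_AE) auto
    also have "\<dots> = (LINT x|lborel. u' x * h x)"
      by (rule integral_completion) measurable
    finally show ?thesis .
  qed
  have "fourier_distr g (gauss_wave s y) = fourier_distr v (\<lambda>\<xi>. of_real (norm \<xi> powr \<gamma>) * gauss_wave s y \<xi>)"
    using lap gauss_wave_schwartz[OF s] unfolding is_frac_laplacian_def by blast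
  then have "(LINT x|lebesgue. g x * (of_real ((2 * pi) ^ CARD('n)) * of_real (heat s (x - y))))
      = (LINT x|lebesgue. v x * (of_real ((2 * pi) ^ CARD('n)) * frac_heat \<gamma> s (x - y)))"
    unfolding fourier_distr_def fourier_gauss_wave[OF s] fourier_frac_gauss_wave .
  then have "(LINT x|lborel. g' x * (of_real ((2 * pi) ^ CARD('n)) * of_real (heat s (x - y))))
      = (LINT x|lborel. v' x * (of_real ((2 * pi) ^ CARD('n)) * frac_heat \<gamma> s (x - y)))"
    using ae by (subst (asm) swap[where u' = g'], simp_all, subst (asm) swap[where u' = v'], simp_all)
  then have "of_real ((2 * pi) ^ CARD('n)) * heat_conv s g' y
      = of_real ((2 * pi) ^ CARD('n)) * (LINT x|lborel. v' x * frac_heat \<gamma> s (x - y))"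
    unfolding heat_conv_def mult.left_commute[of _ "of_real ((2 * pi) ^ CARD('n))"] integral_mult_right_zero .
  then show ?thesis by simp
qed

lemma nn_integral_Lp_norm:
  fixes f f' :: "real ^ 'n::finite \<Rightarrow> complex"
  assumes "f \<in> Lp_space q" "0 < q" "AE x in lborel. f x = f' x"
  shows "(\<integral>\<^sup>+x. ennreal (norm (f' x) powr q) \<partial>lborel) = ennreal (Lp_norm q f powr q)"
proof -
  have "(\<integral>\<^sup>+x. ennreal (norm (f' x) powr q) \<partial>lborel) = (\<integral>\<^sup>+x. ennreal (norm (f x) powr q) \<partial>lborel)"
    using assms(3) by (intro nn_integral_cong_AE) auto
  also have "\<dots> = (\<integral>\<^sup>+x. ennreal (norm (f x) powr q) \<partial>lebesgue)"
    by (rule nn_integral_completion[symmetric])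
  also have "\<dots> = ennreal (LINT x|lebesgue. norm (f x) powr q)"
    using assms(1) by (intro nn_integral_eq_integral) (auto simp: Lp_space_def)
  also have "(LINT x|lebesgue. norm (f x) powr q) = Lp_norm q f powr q"
    using assms(2) by (simp add: Lp_norm_def powr_powr)
  finally show ?thesis .
qed

theorem lemma5p3:
  fixes p r \<gamma> \<alpha> r2 N :: real
  assumes "N = real CARD('n::finite)"
    and "p \<ge> 1" and "r > 1" and "0 < \<gamma>" and "\<gamma> < min N 2"
    and "r2 = N * (r * p + r - p) / (r * (N - \<gamma>))"
    and "\<alpha> = p * (r - 1) / r"
  shows "\<exists>C>0. \<forall>v g :: real ^ 'n \<Rightarrow> complex.
           v \<in> Lp_space p \<and> g \<in> Lp_space r \<and> is_frac_laplacian \<gamma> v g \<longrightarrow>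
           v \<in> Lp_space r2 \<and>
           Lp_norm r2 v powr (\<alpha> + 1) \<le> C * Lp_norm r g * Lp_norm p v powr \<alpha>"
proof -
  define \<rho> where "\<rho> = N / (N - \<gamma>)"
  have N: "N = real DIM(real ^ 'n)" using assms(1) by simp
  obtain K where K: "0 < K" and bound: "\<And>(v :: real ^ 'n \<Rightarrow> complex) g V G. v \<in> borel_measurable borel \<Longrightarrow> g \<in> borel_measurable borel \<Longrightarrow>
     0 < V \<Longrightarrow> 0 < G \<Longrightarrow> (\<integral>\<^sup>+x. ennreal (norm (v x) powr p) \<partial>lborel) \<le> ennreal (V powr p) \<Longrightarrow>
     (\<integral>\<^sup>+x. ennreal (norm (g x) powr r) \<partial>lborel) \<le> ennreal (G powr r) \<Longrightarrow>
     (\<And>s y. 0 < s \<Longrightarrow> heat_conv s g y = (LINT x|lborel. v x * frac_heat \<gamma> s (x - y))) \<Longrightarrow>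
     (\<integral>\<^sup>+x. ennreal (norm (v x) powr r2) \<partial>lborel) \<le> ennreal (K * V powr (\<rho> * \<alpha>) * G powr \<rho>)"
    using gagliardo_nirenberg_lborel[OF N assms(2-7) \<rho>_def] by blast
  have \<rho>: "0 < \<rho>" using assms by (simp add: \<rho>_def)
  have \<alpha>: "0 < \<alpha>" using assms by simp
  \<comment> \<open>This is why the root of order \<open>\<rho>\<close> of the integral estimate is
    the claim: it leaves the powers \<open>\<alpha> + 1\<close>, 1 and \<open>\<alpha>\<close> of
    the three norms.\<close>
  have r2: "r2 = \<rho> * (\<alpha> + 1)"
  proof -
    have "N - \<gamma> \<noteq> 0" "r \<noteq> 0" using assms(3,5) by auto
    then show ?thesis unfolding assms(6,7) \<rho>_def by (simp add: field_simps)
  qed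
  have r2_pos: "0 < r2" using \<rho> \<alpha> by (simp add: r2)
  show ?thesis
  proof (intro exI[of _ "K powr (1 / \<rho>)"] conjI allI impI)
    show "0 < K powr (1 / \<rho>)" using K by simp
    fix v g :: "real ^ 'n \<Rightarrow> complex"
    assume "v \<in> Lp_space p \<and> g \<in> Lp_space r \<and> is_frac_laplacian \<gamma> v g"
    then have v: "v \<in> Lp_space p" and g: "g \<in> Lp_space r" and lap: "is_frac_laplacian \<gamma> v g" by auto
    have vm [measurable]: "v \<in> borel_measurable lebesgue" and gm [measurable]: "g \<in> borel_measurable lebesgue"
      using v g by (auto simp: Lp_space_def)
    obtain v' where v': "v' \<in> borel_measurable borel" "AE x in lborel. v x = v' x"
      using completion_ex_borel_measurable_complex[OF vm] by auto
    obtain g' where g': "g' \<in> borel_measurable borel" "AE x in lborel. g x = g' x"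
      using completion_ex_borel_measurable_complex[OF gm] by auto
    define V where "V = Lp_norm p v"
    define G where "G = Lp_norm r g"
    have VG: "0 \<le> V" "0 \<le> G" by (simp_all add: V_def G_def Lp_norm_def)
    define I where "I = (\<integral>\<^sup>+x. ennreal (norm (v' x) powr r2) \<partial>lborel)"
    \<comment> \<open>\<open>V\<close> or \<open>G\<close> may vanish, so they are approached from above\<close>
    have "I \<le> ennreal (K * (V + e) powr (\<rho> * \<alpha>) * (G + e) powr \<rho>)" if "0 < e" for e
      unfolding I_def
    proof (rule bound[OF v'(1) g'(1)])
      show "(\<integral>\<^sup>+x. ennreal (norm (v' x) powr p) \<partial>lborel) \<le> ennreal ((V + e) powr p)"
        using nn_integral_Lp_norm[OF v _ v'(2)] VG that assms
        by (auto simp: V_def[symmetric] intro!: ennreal_leI powr_mono2)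
      show "(\<integral>\<^sup>+x. ennreal (norm (g' x) powr r) \<partial>lborel) \<le> ennreal ((G + e) powr r)"
        using nn_integral_Lp_norm[OF g _ g'(2)] VG that assms
        by (auto simp: G_def[symmetric] intro!: ennreal_leI powr_mono2)
      show "heat_conv s g' y = (LINT x|lborel. v' x * frac_heat \<gamma> s (x - y))" if "0 < s" for s y
        using lap that vm gm v'(1) g'(1) v'(2) g'(2) by (rule is_frac_laplacian_heat_conv)
    qed (use VG that in auto)
    \<comment> \<open>The exponents \<open>\<rho> * \<alpha>\<close> and \<open>\<rho>\<close> are
      positive, so both powers are continuous from the right even at 0, where \<open>powr\<close>
      gives 0.\<close>
    moreover have "((\<lambda>e. ennreal (K * (V + e) powr (\<rho> * \<alpha>) * (G + e) powr \<rho>)) \<longlongrightarrow> ennreal (K * (V + 0) powr (\<rho> * \<alpha>) * (G + 0) powr \<rho>)) (at_right 0)"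
      using VG \<rho> \<alpha>
      by (intro tendsto_ennrealI tendsto_mult tendsto_const tendsto_powr' tendsto_add tendsto_ident_at)
         (auto intro!: eventually_at_right_less[THEN eventually_mono] simp: eventually_at_filter)
    ultimately have I: "I \<le> ennreal (K * V powr (\<rho> * \<alpha>) * G powr \<rho>)"
      by (intro tendsto_lowerbound[of _ _ "at_right 0"]) (auto simp: eventually_at_right_less eventually_at_filter)
    have I_eq: "I = (\<integral>\<^sup>+x. ennreal (norm (v x) powr r2) \<partial>lebesgue)"
      unfolding I_def nn_integral_completion using v'(2) by (intro nn_integral_cong_AE) auto
    have "integrable lebesgue (\<lambda>x. norm (v x) powr r2)"
      using le_less_trans[OF I] by (intro integrableI_bounded) (auto simp: I_eq)
    then show "v \<in> Lp_space r2" by (simp add: Lp_space_def)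
    then have "ennreal (Lp_norm r2 v powr r2) = I"
      using nn_integral_Lp_norm[OF _ r2_pos v'(2)] by (simp add: I_def)
    then have "Lp_norm r2 v powr r2 \<le> K * V powr (\<rho> * \<alpha>) * G powr \<rho>"
      using I K by (metis ennreal_le_iff mult_nonneg_nonneg powr_ge_zero less_imp_le)
    then have "(Lp_norm r2 v powr r2) powr (1 / \<rho>) \<le> (K * V powr (\<rho> * \<alpha>) * G powr \<rho>) powr (1 / \<rho>)"
      using \<rho> by (intro powr_mono2) auto
    also have "(Lp_norm r2 v powr r2) powr (1 / \<rho>) = Lp_norm r2 v powr (\<alpha> + 1)"
      using \<rho> by (simp add: powr_powr r2)
    also have "(K * V powr (\<rho> * \<alpha>) * G powr \<rho>) powr (1 / \<rho>) = K powr (1 / \<rho>) * G * V powr \<alpha>"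
      using K VG \<rho> by (simp add: powr_mult powr_powr)
    finally show "Lp_norm r2 v powr (\<alpha> + 1) \<le> K powr (1 / \<rho>) * Lp_norm r g * Lp_norm p v powr \<alpha>"
      by (simp add: V_def G_def)
  qed
qed

end
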